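(* There exists a constant $C>0$ such that for $p\geq C\log n/n$ the following holds with probability tending to $1$ as $n\to\infty$. Let $(G_1,\ldots,G_n)$ be a tuple of independent random graphs on the same vertex set of size $n$, each sampled from $G(n,p)$. Then $(G_1,\ldots,G_n)$ is Hamilton-universal.
   Context: $G(n,p)$ denotes the Erdős–Rényi random graph on $n$ vertices in which each pair of vertices is an edge independently with probability $p$. A tuple $(G_1,\ldots,G_n)$ of graphs on a common vertex set $V$ with $|V|=n$ is called Hamilton-universal if for every map $\chi:[n]\to[n]$ there is a Hamilton cycle, with its edges listed in cyclic order as $(e_1,\ldots,e_n)$ (i.e. an $n$-tuple of edges of the complete graph on $V$ forming a Hamilton cycle in this order), such that $e_i\in E(G_{\chi(i)})$ for every $1\leq i\leq n$. *)

theory Defs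
  imports "HOL-Probability.Probability"
begin

text \<open>A simple graph on the vertex set \<open>V\<close> is represented by its edge set, a set of
  two-element subsets of \<open>V\<close>.\<close>

definition complete_edges :: "'a set \<Rightarrow> 'a set set" where
  "complete_edges V = {e. e \<subseteq> V \<and> card e = 2}"

definition random_graph :: "'a set \<Rightarrow> real \<Rightarrow> 'a set set pmf" where
  "random_graph V p =
     map_pmf (\<lambda>present. {e \<in> complete_edges V. present e})
       (Pi_pmf (complete_edges V) False (\<lambda>_. bernoulli_pmf p))"

text \<open>Tuples are indexed by \<open>{1..card V}\<close>; outside this range a sampled tuple takes the
  irrelevant value \<open>{}\<close>.\<close>

definition random_graph_tuple :: "'a set \<Rightarrow> real \<Rightarrow> (nat \<Rightarrow> 'a set set) pmf" where
  "random_graph_tuple V p = Pi_pmf {1..card V} {} (\<lambda>_. random_graph V p)"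

text \<open>The vertex following \<open>v i\<close> on the cycle is \<open>v (i mod card V + 1)\<close>, so the last edge joins
  \<open>v (card V)\<close> to \<open>v 1\<close>.\<close>

definition hamilton_cycle :: "'a set \<Rightarrow> (nat \<Rightarrow> 'a set) \<Rightarrow> bool" where
  "hamilton_cycle V e \<longleftrightarrow>
     3 \<le> card V \<and>
     (\<exists>v. bij_betw v {1..card V} V \<and>
          (\<forall>i\<in>{1..card V}. e i = {v i, v (i mod card V + 1)}))"

definition hamilton_universal :: "'a set \<Rightarrow> (nat \<Rightarrow> 'a set set) \<Rightarrow> bool" where
  "hamilton_universal V G \<longleftrightarrow>
     (\<forall>chi \<in> {1..card V} \<rightarrow> {1..card V}.
        \<exists>e. hamilton_cycle V e \<and> (\<forall>i\<in>{1..card V}. e i \<in> G (chi i)))"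

end

theory Submission
  imports Defs "HOL-Real_Asymp.Real_Asymp"
begin

text \<open>Expose the graphs in independent rounds. For a fixed map \<open>chi\<close>, McDiarmid's coupling lets
  us replace the last round by an uncoloured random graph of jokers, whose edges may be used at
  any position of the cycle. All joker properties used fail with probability at most
  \<open>n ^ (- 2 n)\<close>, so that the union bound over the \<open>n ^ n\<close> maps \<open>chi\<close> is affordable; the price is
  that jokers expand only outside an uncontrolled set \<open>B\<close> of up to a small linear size.

  The first rounds provide coloured expansion for all choices of colours at once, since edges are
  counted from the side that chooses the colour. This is enough to cover \<open>B\<close>, for every \<open>chi\<close>, by
  one coloured path at fixed positions: depth-first search with two-step hops covers all but
  \<open>O(n / ln n)\<close> vertices of \<open>B\<close>, and the remaining ones are joined by paths of length \<open>O(ln n)\<close>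
  found by a coloured version of the Friedman--Pippenger tree embedding. The only vertices that
  have to be treated before the search are the few whose coloured neighbours lie mostly in \<open>B\<close>.

  Finally, the jokers restricted to the rest of the vertex set expand, and the rotation method of
  Posa closes the cycle with boosters from a second round of jokers: there are quadratically many
  of them, so that missing all of them has probability \<open>n ^ (- c n)\<close>.\<close>

section \<open>Extendability in the style of Friedman and Pippenger\<close>

text \<open>For a fixed \<open>chi\<close> the union bound rules out any property that a single
  vertex can spoil: at this density a given vertex is isolated with probability about n^(-C), far
  above n^(-n). Only statements about linearly many vertices survive, hence the set
  \<open>B\<close>. Expansion of small sets, which fails with merely polynomially small probability,
  must be one event that does not mention \<open>chi\<close>; this is why it is stated for (vertex,
  colour) pairs, all colours at once. Choosing \<open>s\<close> such pairs costs n^(2s), which is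
  exp(O(n)) only for \<open>s\<close> up to order n / ln n; this fixes the scale that separates the
  search from the tree embedding. Reaching O(s) vertices by paths of length O(ln n) then uses
  linearly many vertices, with a small constant, and the reservoir has to pay for them. The ranks
  resolve a circularity: trees should not consume \<open>B\<close> before the search has visited it,
  yet some agents see little besides \<open>B\<close>; there are so few of them that their vertices
  can be served first.\<close>

text \<open>Agents are vertices together with the colour of the edge they ask for;
  \<open>par w = Some a\<close> records that the vertex \<open>w\<close> has been given to the agent \<open>a\<close>. With ownership
  recorded, discarding unused parts of a tree preserves Hall's condition trivially.\<close>

definition avail :: "('a \<Rightarrow> 'v set) \<Rightarrow> ('v \<Rightarrow> 'a option) \<Rightarrow> 'a \<Rightarrow> 'v set" where
  "avail N par a = {w \<in> N a. par w = None \<or> par w = Some a}"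

definition extendable ::
    "('a \<Rightarrow> 'v set) \<Rightarrow> nat \<Rightarrow> nat \<Rightarrow> 'a set \<Rightarrow> ('v \<Rightarrow> 'a option) \<Rightarrow> bool" where
  "extendable N d m A par \<longleftrightarrow>
     (\<forall>U. U \<subseteq> A \<longrightarrow> finite U \<longrightarrow> card U \<le> m \<longrightarrow> d * card U \<le> card (\<Union>a\<in>U. avail N par a))"

lemma extendableD:
  "extendable N d m A par \<Longrightarrow> U \<subseteq> A \<Longrightarrow> finite U \<Longrightarrow> card U \<le> m \<Longrightarrow>
     d * card U \<le> card (\<Union>a\<in>U. avail N par a)"
  unfolding extendable_def by blast

lemma avail_subset: "avail N par a \<subseteq> N a"
  by (auto simp: avail_def)

lemma extendable_mono:
  assumes "extendable N d m A par" "A' \<subseteq> A"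
  shows "extendable N d m A' par"
  using assms unfolding extendable_def by blast

lemma extendable_restrict:
  assumes ext: "extendable N d m A par" and fin: "\<And>a. a \<in> A \<Longrightarrow> finite (N a)"
    and le: "\<And>w. par' w = None \<or> par' w = par w"
  shows "extendable N d m A par'"
  unfolding extendable_def
proof (intro allI impI)
  fix U assume U: "U \<subseteq> A" "finite U" "card U \<le> m"
  have "avail N par a \<subseteq> avail N par' a" for a
    unfolding avail_def using le by (auto, metis+)
  then have "(\<Union>a\<in>U. avail N par a) \<subseteq> (\<Union>a\<in>U. avail N par' a)" by blast
  moreover have "finite (\<Union>a\<in>U. avail N par' a)"
    using U fin by (meson avail_subset finite_UN finite_subset subsetD)
  ultimately have "card (\<Union>a\<in>U. avail N par a) \<le> card (\<Union>a\<in>U. avail N par' a)"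
    by (rule card_mono[rotated])
  with extendableD[OF ext U] show "d * card U \<le> card (\<Union>a\<in>U. avail N par' a)" by linarith
qed

text \<open>Sets violating extendability after a new leaf are tight beforehand, and tight sets are
  closed under union because coverage is submodular.\<close>

lemma extendable_add_leaf:
  assumes ext: "extendable N d (2 * s) A par"
    and fin: "\<And>a. a \<in> A \<Longrightarrow> finite (N a)"
    and big: "\<And>U. U \<subseteq> A \<Longrightarrow> finite U \<Longrightarrow> s \<le> card U \<Longrightarrow> card U \<le> 2 * s \<Longrightarrow>
      2 * s * d < card ((\<Union>a\<in>U. N a) - dom par)"
    and a: "a \<in> A" and s: "s \<ge> 1"
    and own: "card {w. par w = Some a} + 2 \<le> d" "finite {w. par w = Some a}"
  obtains w where "w \<in> N a" "par w = None" "w \<noteq> z" "extendable N d (2 * s) A (par(w \<mapsto> a))"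
proof -
  define M where "M U = (\<Union>a\<in>U. avail N par a)" for U
  define tight where "tight U \<longleftrightarrow> U \<subseteq> A \<and> finite U \<and> card U \<le> 2 * s \<and> card (M U) = d * card U" for U
  have finM: "finite (M U)" if "U \<subseteq> A" "finite U" for U
    using that fin unfolding M_def by (meson avail_subset finite_UN finite_subset subsetD)
  have inv: "d * card U \<le> card (M U)" if "U \<subseteq> A" "finite U" "card U \<le> 2 * s" for U
    using extendableD[OF ext that] by (simp add: M_def)
  \<comment> \<open>Sets of \<open>s\<close> to \<open>2 * s\<close> agents see more than
    \<open>2 * s * d\<close> free vertices, so no tight set has such a size. Two tight sets
    therefore have a union of fewer than \<open>2 * s\<close> agents, where the invariant still
    applies.\<close>
  have small: "card U < s" if "tight U" for U
  proof (rule ccontr)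
    assume "\<not> card U < s"
    then have "2 * s * d < card ((\<Union>a\<in>U. N a) - dom par)"
      using big that by (simp add: tight_def)
    also have "\<dots> \<le> card (M U)"
      using that finM by (intro card_mono) (auto simp: tight_def M_def avail_def)
    also have "\<dots> = d * card U" using that by (simp add: tight_def)
    also have "\<dots> \<le> d * (2 * s)" using that by (simp add: tight_def)
    finally show False by (simp add: mult.commute)
  qed
  have un: "tight (U \<union> U')" if t: "tight U" "tight U'" for U U'
  proof -
    have sub: "U \<subseteq> A" "U' \<subseteq> A" "finite U" "finite U'" using t by (auto simp: tight_def)
    have c: "card (U \<union> U') \<le> 2 * s"
      using small[OF t(1)] small[OF t(2)] card_Un_le[of U U'] by linarith
    have "card (M (U \<union> U')) + card (M (U \<inter> U')) \<le> card (M U \<union> M U') + card (M U \<inter> M U')"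
      using sub finM by (intro add_mono card_mono) (auto simp: M_def)
    also have "\<dots> = card (M U) + card (M U')"
      using card_Un_Int[of "M U" "M U'"] sub finM by simp
    also have "\<dots> = d * card U + d * card U'" using t by (simp add: tight_def)
    also have "\<dots> = d * card (U \<union> U') + d * card (U \<inter> U')"
      using card_Un_Int[of U U'] sub by (metis add_mult_distrib2)
    finally have "card (M (U \<union> U')) + card (M (U \<inter> U')) \<le> d * card (U \<union> U') + d * card (U \<inter> U')" .
    moreover have "d * card (U \<inter> U') \<le> card (M (U \<inter> U'))"
    proof (rule inv)
      have "card (U \<inter> U') \<le> card U" using sub by (intro card_mono) auto
      then show "card (U \<inter> U') \<le> 2 * s" using t by (simp add: tight_def)
    qed (use sub in auto)
    moreover have "d * card (U \<union> U') \<le> card (M (U \<union> U'))" using sub c by (intro inv) auto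
    ultimately show ?thesis using sub c by (simp add: tight_def)
  qed
  define good where "good w \<longleftrightarrow> extendable N d (2 * s) A (par(w \<mapsto> a))" for w
  define free where "free = {w \<in> N a. par w = None}"
  have finfree: "finite free" using fin[OF a] by (simp add: free_def)
  \<comment> \<open>Giving \<open>w\<close> to \<open>a\<close> costs only those sets that reach
    \<open>w\<close> and do not contain \<open>a\<close>, and each of them just one vertex; such a
    set can break only if it was tight.\<close>
  have bad: "\<exists>U. tight U \<and> a \<notin> U \<and> w \<in> M U" if w: "w \<in> free" "\<not> good w" for w
  proof -
    obtain U where U: "U \<subseteq> A" "finite U" "card U \<le> 2 * s"
      "card (\<Union>b\<in>U. avail N (par(w \<mapsto> a)) b) < d * card U"
      using w unfolding good_def extendable_def by (meson not_le)
    let ?M' = "\<Union>b\<in>U. avail N (par(w \<mapsto> a)) b"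
    have eq: "?M' = M U - (if a \<in> U then {} else {w})"
      using w by (auto simp: M_def avail_def free_def split: if_splits)
    have aU: "a \<notin> U" using eq U inv[of U] by (auto simp: not_le[symmetric])
    have wM: "w \<in> M U" using eq aU U inv[of U] by (cases "w \<in> M U") (auto simp: not_le[symmetric])
    have "card ?M' = card (M U) - 1" using eq aU wM finM[OF U(1,2)] by simp
    moreover have "card (M U) \<ge> d * card U" using U inv by blast
    ultimately have "tight U" using U by (auto simp: tight_def)
    then show ?thesis using aU wM by blast
  qed
  have "\<exists>U. tight U \<and> a \<notin> U \<and> F \<subseteq> M U" if "finite F" "F \<subseteq> {w \<in> free. \<not> good w}" for F
    using that
  proof (induction F)
    case empty
    show ?case by (rule exI[of _ "{}"]) (auto simp: tight_def M_def)
  next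
    case (insert w F)
    then obtain U where "tight U" "a \<notin> U" "F \<subseteq> M U" by auto
    moreover obtain U' where "tight U'" "a \<notin> U'" "w \<in> M U'" using bad[of w] insert by auto
    ultimately show ?case
      by (intro exI[of _ "U \<union> U'"]) (auto simp: un M_def)
  qed
  from this[of "{w \<in> free. \<not> good w}"] finfree
  obtain U where U: "tight U" "a \<notin> U" "{w \<in> free. \<not> good w} \<subseteq> M U" by auto
  have Uf: "finite U" "U \<subseteq> A" using U by (auto simp: tight_def)
  \<comment> \<open>Adding \<open>a\<close> to a tight set that reaches all bad candidates forces at
    least \<open>d\<close> further vertices, each a good candidate or already owned by
    \<open>a\<close>. At least two good candidates result, so one differs from
    \<open>z\<close>.\<close>
  have "d * card (insert a U) \<le> card (M (insert a U))"
    using Uf a small[OF U(1)] U(2) s by (intro inv) auto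
  also have "\<dots> \<le> card (M U \<union> ({w \<in> free. good w} \<union> {w. par w = Some a}))"
    using Uf finM[OF Uf(2,1)] finfree own U(3)
    by (intro card_mono) (auto simp: M_def avail_def free_def intro: finite_subset[OF _ finfree[unfolded free_def]])
  also have "\<dots> \<le> card (M U) + (card {w \<in> free. good w} + card {w. par w = Some a})"
    by (meson add_left_mono card_Un_le le_trans)
  finally have "d + d * card U \<le> d * card U + (card {w \<in> free. good w} + card {w. par w = Some a})"
    using U Uf by (simp add: tight_def)
  then have "card {w \<in> free. good w} \<ge> 2" using own by linarith
  then have "\<not> {w \<in> free. good w} \<subseteq> {z}"
    using card_mono[of "{z}" "{w \<in> free. good w}"] by fastforce
  then obtain w where "w \<in> free" "good w" "w \<noteq> z" by blast
  then show thesis using that by (auto simp: good_def free_def)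
qed

text \<open>Vertices with blocked neighbours get a positive rank; a vertex may only use neighbours
  of rank 0 or of strictly smaller rank, so that nothing it relies on is visited before it.\<close>

lemma rank_blocked:
  fixes N :: "'v \<times> 'c \<Rightarrow> 'v set"
  assumes "finite A" and "\<And>a. a \<in> A \<Longrightarrow> finite (N a)"
    and "\<And>U. U \<subseteq> A \<Longrightarrow> (d + 2) * card U \<le> card (\<Union>a\<in>U. N a)"
  shows "\<exists>lev :: 'v \<Rightarrow> nat. (\<forall>u. 0 < lev u \<longleftrightarrow> u \<in> fst ` A) \<and>
     (\<forall>U\<subseteq>A. d * card U \<le> card (\<Union>a\<in>U. {y \<in> N a. lev y < lev (fst a)}))"
  using assms
proof (induction "card A" arbitrary: A rule: less_induct)
  case less
  show ?case
  proof (cases "A = {}")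
    case True
    then show ?thesis by (intro exI[of _ "\<lambda>_. 0"]) auto
  next
    case False
    \<comment> \<open>A maximal set \<open>W\<close> of agents with too few neighbours outside the
      blocked vertices is ranked recursively; the agents outside \<open>W\<close> keep enough
      neighbours of rank 0 that \<open>W\<close> does not see.\<close>
    define bad where "bad W \<longleftrightarrow> W \<subseteq> A \<and> card ((\<Union>a\<in>W. N a) - fst ` A) \<le> d * card W" for W
    have "bad {}" by (simp add: bad_def)
    moreover have "\<forall>W. bad W \<longrightarrow> card W \<le> card A"
      using less.prems(1) by (auto simp: bad_def intro: card_mono)
    ultimately obtain W where W: "bad W" "\<And>W'. bad W' \<Longrightarrow> card W' \<le> card W"
      using ex_has_greatest_nat[of bad "{}" card "card A + 1"] by (metis less_Suc_eq_le Suc_eq_plus1)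
    have finN: "finite (\<Union>a\<in>U. N a)" if "U \<subseteq> A" for U
      using that less.prems by (meson finite_UN finite_subset subsetD)
    have fU: "finite U" if "U \<subseteq> A" for U using that less.prems(1) finite_subset by blast
    have WA: "W \<subseteq> A" using W by (simp add: bad_def)
    \<comment> \<open>\<open>A\<close> involves at most \<open>card A\<close> vertices, so blocking
      them costs at most one of the two surplus neighbours per agent; hence \<open>A\<close> itself
      is not bad and the recursion descends.\<close>
    have "W \<noteq> A"
    proof
      assume "W = A"
      have "(d + 2) * card A \<le> card (\<Union>a\<in>A. N a)" using less.prems(3) by simp
      also have "\<dots> \<le> card ((\<Union>a\<in>A. N a) - fst ` A) + card (fst ` A)"
        by (rule order.trans[OF card_mono card_Un_le]) (use finN[of A] less.prems(1) in auto)
      also have "\<dots> \<le> d * card A + card A"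
        using W \<open>W = A\<close> card_image_le[OF less.prems(1), of fst] by (simp add: bad_def add_mono)
      finally show False using False less.prems(1) by (simp add: card_gt_0_iff)
    qed
    then have "card W < card A" using WA less.prems(1) by (meson psubset_card_mono psubsetI)
    have "\<exists>lev :: 'v \<Rightarrow> nat. (\<forall>u. 0 < lev u \<longleftrightarrow> u \<in> fst ` W) \<and>
       (\<forall>U\<subseteq>W. d * card U \<le> card (\<Union>a\<in>U. {y \<in> N a. lev y < lev (fst a)}))"
    proof (rule less.hyps[OF \<open>card W < card A\<close> fU[OF WA]])
      show "finite (N a)" if "a \<in> W" for a using that WA less.prems(2) by blast
      show "(d + 2) * card U \<le> card (\<Union>a\<in>U. N a)" if "U \<subseteq> W" for U
        using that WA less.prems(3)[of U] by blast
    qed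
    then obtain lev :: "'v \<Rightarrow> nat" where lev:
      "\<And>u. 0 < lev u \<longleftrightarrow> u \<in> fst ` W"
      "\<And>U. U \<subseteq> W \<Longrightarrow> d * card U \<le> card (\<Union>a\<in>U. {y \<in> N a. lev y < lev (fst a)})"
      by blast
    define lev' where "lev' u = (if u \<in> fst ` A then Suc (lev u) else 0)" for u
    have "d * card U \<le> card (\<Union>a\<in>U. {y \<in> N a. lev' y < lev' (fst a)})" if U: "U \<subseteq> A" for U
    proof -
      define U1 where "U1 = U - W"
      define U2 where "U2 = U \<inter> W"
      have UU: "U1 \<subseteq> A" "U2 \<subseteq> A" "U1 \<inter> U2 = {}" "U = U1 \<union> U2" "U1 \<inter> W = {}" "U2 \<subseteq> W"
        using U by (auto simp: U1_def U2_def)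
      let ?K1 = "(\<Union>a\<in>U1. N a) - fst ` A - (\<Union>a\<in>W. N a)"
      let ?K2 = "\<Union>a\<in>U2. {y \<in> N a. lev y < lev (fst a)}"
      \<comment> \<open>By maximality of \<open>W\<close>: otherwise \<open>W \<union> U1\<close>
        would be bad as well.\<close>
      have k1: "d * card U1 \<le> card ?K1"
      proof (rule ccontr)
        assume *: "\<not> ?thesis"
        have "card ((\<Union>a\<in>W \<union> U1. N a) - fst ` A) \<le> card (((\<Union>a\<in>W. N a) - fst ` A) \<union> ?K1)"
          using finN[OF WA] finN[OF UU(1)] by (intro card_mono) auto
        also have "\<dots> \<le> card ((\<Union>a\<in>W. N a) - fst ` A) + card ?K1" by (rule card_Un_le)
        also have "\<dots> \<le> d * card W + d * card U1" using * W by (simp add: bad_def)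
        also have "\<dots> = d * card (W \<union> U1)"
          using UU fU[OF WA] fU[OF UU(1)] by (simp add: card_Un_disjoint Int_commute add_mult_distrib2)
        finally have "bad (W \<union> U1)" using WA UU by (simp add: bad_def)
        then have "card (W \<union> U1) \<le> card W" by (rule W)
        then have "U1 = {}"
          using UU fU[OF WA] fU[OF UU(1)] by (simp add: card_Un_disjoint Int_commute)
        then show False using * by simp
      qed
      have k2: "d * card U2 \<le> card ?K2" using lev(2) UU by blast
      have "?K1 \<inter> ?K2 = {}" using UU by auto
      moreover have "finite ?K1" "finite ?K2"
        using finN UU by (auto intro: finite_subset[OF _ finN[OF UU(2)]])
      ultimately have "card (?K1 \<union> ?K2) = card ?K1 + card ?K2" by (simp add: card_Un_disjoint)
      moreover have "d * card U = d * card U1 + d * card U2"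
        using UU fU by (simp add: card_Un_disjoint add_mult_distrib2)
      moreover have "?K1 \<union> ?K2 \<subseteq> (\<Union>a\<in>U. {y \<in> N a. lev' y < lev' (fst a)})"
      proof (intro Un_least subsetI)
        fix y assume "y \<in> ?K1"
        then obtain a where a: "a \<in> U1" "y \<in> N a" "y \<notin> fst ` A" by blast
        then have "lev' y < lev' (fst a)" using UU by (auto simp: lev'_def)
        then show "y \<in> (\<Union>a\<in>U. {y \<in> N a. lev' y < lev' (fst a)})" using a UU by blast
      next
        fix y assume "y \<in> ?K2"
        then obtain a where a: "a \<in> U2" "y \<in> N a" "lev y < lev (fst a)" by blast
        then have "lev' y < lev' (fst a)" using UU by (auto simp: lev'_def)
        then show "y \<in> (\<Union>a\<in>U. {y \<in> N a. lev' y < lev' (fst a)})" using a UU by blast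
      qed
      then have "card (?K1 \<union> ?K2) \<le> card (\<Union>a\<in>U. {y \<in> N a. lev' y < lev' (fst a)})"
        using finN[OF U] by (intro card_mono) (auto intro: finite_subset[OF _ finN[OF U]])
      ultimately show ?thesis using k1 k2 by linarith
    qed
    then show ?thesis by (intro exI[of _ lev']) (auto simp: lev'_def)
  qed
qed

section \<open>Connecting vertices by coloured paths\<close>

text \<open>A family of graphs is one set \<open>S\<close> of (colour, edge) pairs, so that the
  whole tuple becomes a single random set. Colours are tied to positions in the list, which makes
  the path rigid: it cannot be shifted, and reversing it reverses the colour sequence.\<close>

definition coloured_path :: "('c \<times> 'v set) set \<Rightarrow> (nat \<Rightarrow> 'c) \<Rightarrow> 'v list \<Rightarrow> bool" where
  "coloured_path S f us \<longleftrightarrow> (\<forall>i. Suc i < length us \<longrightarrow> (f i, {us ! i, us ! Suc i}) \<in> S)"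

lemma coloured_path_append:
  "coloured_path S f (xs @ ys) \<longleftrightarrow> coloured_path S f xs \<and>
     coloured_path S (\<lambda>i. f (length xs + i)) ys \<and>
     (xs \<noteq> [] \<longrightarrow> ys \<noteq> [] \<longrightarrow> (f (length xs - 1), {last xs, hd ys}) \<in> S)"
  (is "?L \<longleftrightarrow> ?A \<and> ?B \<and> ?C")
proof
  assume L: ?L
  have ?A
    unfolding coloured_path_def
  proof (intro allI impI)
    fix i assume "Suc i < length xs"
    then show "(f i, {xs ! i, xs ! Suc i}) \<in> S"
      using L[unfolded coloured_path_def, rule_format, of i] by (simp add: nth_append)
  qed
  moreover have ?B
    unfolding coloured_path_def
  proof (intro allI impI)
    fix i assume "Suc i < length ys"
    then show "(f (length xs + i), {ys ! i, ys ! Suc i}) \<in> S"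
      using L[unfolded coloured_path_def, rule_format, of "length xs + i"] by (simp add: nth_append)
  qed
  moreover have ?C
  proof (intro impI)
    assume "xs \<noteq> []" "ys \<noteq> []"
    then show "(f (length xs - 1), {last xs, hd ys}) \<in> S"
      using L[unfolded coloured_path_def, rule_format, of "length xs - 1"]
      by (simp add: nth_append last_conv_nth hd_conv_nth)
  qed
  ultimately show "?A \<and> ?B \<and> ?C" by blast
next
  assume R: "?A \<and> ?B \<and> ?C"
  show ?L
    unfolding coloured_path_def
  proof (intro allI impI)
    fix i assume i: "Suc i < length (xs @ ys)"
    consider "Suc i < length xs" | "Suc i = length xs" | "length xs \<le> i" by linarith
    then show "(f i, {(xs @ ys) ! i, (xs @ ys) ! Suc i}) \<in> S"
    proof cases
      case 1
      then show ?thesis using R by (simp add: coloured_path_def nth_append)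
    next
      case 2
      then have "xs \<noteq> []" "ys \<noteq> []" "i = length xs - 1" using i by auto
      then show ?thesis using R by (simp add: nth_append last_conv_nth hd_conv_nth 2)
    next
      case 3
      then obtain k where "i = length xs + k" using le_Suc_ex by blast
      then show ?thesis using R i by (simp add: coloured_path_def nth_append)
    qed
  qed
qed

lemma coloured_path_rev:
  assumes "coloured_path S (\<lambda>i. f (length us - 2 - i)) us"
  shows "coloured_path S f (rev us)"
  unfolding coloured_path_def
proof (intro allI impI)
  fix i assume i: "Suc i < length (rev us)"
  define k where "k = length us - 2 - i"
  have k: "Suc k < length us" "length us - 2 - k = i" "length us - Suc i = Suc k" "length us - Suc (Suc i) = k"
    using i by (auto simp: k_def)
  have "(f i, {us ! k, us ! Suc k}) \<in> S"
    using assms[unfolded coloured_path_def, rule_format, OF k(1)] k(2) by simp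
  then show "(f i, {rev us ! i, rev us ! Suc i}) \<in> S"
    using i k by (simp add: rev_nth insert_commute)
qed

lemma coloured_path_single [simp]: "coloured_path S f [x]" "coloured_path S f []"
  by (simp_all add: coloured_path_def)

text \<open>\<open>Z\<close> supplies the inner vertices of the connecting paths. An agent may use
  only neighbours of rank 0 or of smaller rank, and \<open>Q\<close> is the budget of vertices in
  use: by \<open>N_big\<close>, medium sets of agents still expand after losing any \<open>Q\<close>
  vertices. Two binary trees of depth \<open>l\<close> have \<open>2 ^ l\<close> leaves each, just
  enough for \<open>joined\<close> to give an edge of any colour between them.\<close>

locale reservoir =
  fixes S :: "('c \<times> 'v set) set" and V Z :: "'v set" and C :: "'c set"
    and N :: "'v \<times> 'c \<Rightarrow> 'v set" and lev :: "'v \<Rightarrow> nat" and s Q l :: nat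
  assumes fin: "finite V" "finite C" and ZV: "Z \<subseteq> V" and NZ: "N a \<subseteq> Z"
    and N_edge: "w \<in> N (u, c) \<Longrightarrow> (c, {u, w}) \<in> S"
    and N_lev: "w \<in> N (u, c) \<Longrightarrow> lev w = 0 \<or> lev w < lev u"
    and N_big: "U \<subseteq> V \<times> C \<Longrightarrow> s \<le> card U \<Longrightarrow> card U \<le> 2 * s \<Longrightarrow> 2 * s * 5 + Q < card (\<Union>a\<in>U. N a)"
    and joined: "X \<subseteq> V \<Longrightarrow> Y \<subseteq> V \<Longrightarrow> X \<inter> Y = {} \<Longrightarrow> card X = 2 ^ l \<Longrightarrow> card Y = 2 ^ l \<Longrightarrow> c \<in> C \<Longrightarrow>
      \<exists>x\<in>X. \<exists>y\<in>Y. (c, {x, y}) \<in> S"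
    and s_pos: "s \<ge> 1" and l_pos: "l \<ge> 1"
begin

text \<open>The cap \<open>j\<close> sinks while ranked vertices are covered in order of decreasing
  rank. An agent of rank at most \<open>j\<close> never uses a vertex of rank
  \<open>j \<ge> 1\<close>, so the path may take such a vertex without harming the remaining
  agents.\<close>

definition agents :: "nat \<Rightarrow> ('v \<times> 'c) set" where
  "agents j = {u \<in> V. lev u \<le> j} \<times> C"

lemma card_insert_le_Suc: "finite A \<Longrightarrow> card (insert x A) \<le> Suc (card A)"
  by (simp add: card_insert_if)

lemma finite_N: "finite (N a)"
  using fin ZV NZ by (meson finite_subset)

text \<open>\<open>R\<close> collects the occupied vertices. Each of them is owned, is the target
  \<open>z\<close>, or is out of reach of all active agents; so an unowned neighbour of an active
  agent, other than \<open>z\<close>, is automatically new.\<close>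

definition forest_state :: "nat \<Rightarrow> 'v \<Rightarrow> ('v \<Rightarrow> ('v \<times> 'c) option) \<Rightarrow> 'v set \<Rightarrow> bool" where
  "forest_state j z par R \<longleftrightarrow> extendable N 5 (2 * s) (agents j) par \<and> R \<subseteq> V \<and> dom par \<subseteq> R \<and>
     (\<forall>w u c. par w = Some (u, c) \<longrightarrow> u \<in> R) \<and>
     (\<forall>w u c. par w = Some (u, c) \<longrightarrow> w \<in> N (u, c)) \<and>
     (\<forall>w\<in>R - dom par. w = z \<or> (\<forall>a\<in>agents j. w \<notin> N a))"

abbreviation children :: "('v \<Rightarrow> ('v \<times> 'c) option) \<Rightarrow> 'v \<Rightarrow> 'c \<Rightarrow> 'v set" where
  "children par u c \<equiv> {w. par w = Some (u, c)}"

text \<open>Of the five vertices guaranteed per agent up to three may be taken already; two are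
  needed so that one suitable candidate differs from the target \<open>z\<close>.\<close>

lemma grow_one:
  assumes st: "forest_state j z par R" and y: "y \<in> R" "lev y \<le> j" and c: "c \<in> C"
    and few: "card (children par y c) \<le> 3" and small: "card (dom par) \<le> Q"
  obtains w where "w \<in> N (y, c)" "w \<notin> R" "forest_state j z (par(w \<mapsto> (y, c))) (insert w R)"
proof -
  have R: "R \<subseteq> V" "finite R" "dom par \<subseteq> R" "finite (dom par)"
    using st fin by (auto simp: forest_state_def intro: finite_subset)
  have a: "(y, c) \<in> agents j" using y c R by (auto simp: agents_def)
  obtain w where w: "w \<in> N (y, c)" "par w = None" "w \<noteq> z"
    "extendable N 5 (2 * s) (agents j) (par(w \<mapsto> (y, c)))"
  proof (rule extendable_add_leaf[where z = z, OF _ finite_N _ a s_pos])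
    show "extendable N 5 (2 * s) (agents j) par" using st by (simp add: forest_state_def)
    show "card (children par y c) + 2 \<le> 5" using few by simp
    show "finite (children par y c)"
      using R(4) by (rule finite_subset[rotated]) auto
    fix U assume U: "U \<subseteq> agents j" "s \<le> card U" "card U \<le> 2 * s"
    then have "2 * s * 5 + Q < card (\<Union>a\<in>U. N a)" by (intro N_big) (auto simp: agents_def)
    also have "\<dots> \<le> card ((\<Union>a\<in>U. N a) - dom par) + card (dom par)"
    proof -
      have "finite U" using U s_pos by (auto intro: card_ge_0_finite)
      then have "card (\<Union>a\<in>U. N a) \<le> card (((\<Union>a\<in>U. N a) - dom par) \<union> dom par)"
        using R(4) finite_N by (intro card_mono) auto
      then show ?thesis using card_Un_le le_trans by blast
    qed
    finally show "2 * s * 5 < card ((\<Union>a\<in>U. N a) - dom par)" using small by linarith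
  qed
  have "w \<notin> R" using w st a unfolding forest_state_def by blast
  have "w \<in> V" using w NZ ZV by blast
  have "forest_state j z (par(w \<mapsto> (y, c))) (insert w R)"
    unfolding forest_state_def
  proof (intro conjI)
    show "insert w R \<subseteq> V" using \<open>w \<in> V\<close> R by simp
  qed (use w st y(1) in \<open>auto simp: forest_state_def split: if_splits\<close>)
  then show thesis using that w(1) \<open>w \<notin> R\<close> by blast
qed

lemma grow_level:
  assumes "finite L" "forest_state j z par R" "L \<subseteq> R" "\<And>y. y \<in> L \<Longrightarrow> lev y \<le> j" "c \<in> C"
    "\<And>y. y \<in> L \<Longrightarrow> card (children par y c) \<le> 1" "card (dom par) + 2 * card L \<le> Q"
  shows "\<exists>par' R'. forest_state j z par' R' \<and> R \<subseteq> R' \<and> dom par' = dom par \<union> (R' - R) \<and>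
     card (R' - R) = 2 * card L \<and> (\<forall>w\<in>dom par. par' w = par w) \<and>
     (\<forall>w\<in>R' - R. \<exists>y\<in>L. par' w = Some (y, c))"
  using assms
proof (induction L)
  case empty
  then show ?case by (intro exI[of _ par] exI[of _ R]) auto
next
  case (insert y L)
  then obtain par' R' where IH: "forest_state j z par' R'" "R \<subseteq> R'" "dom par' = dom par \<union> (R' - R)"
     "card (R' - R) = 2 * card L" "\<forall>w\<in>dom par. par' w = par w"
     "\<forall>w\<in>R' - R. \<exists>y\<in>L. par' w = Some (y, c)" by auto
  have R: "R \<subseteq> V" "dom par \<subseteq> R" "finite R" using insert.prems fin by (auto simp: forest_state_def intro: finite_subset)
  have R': "finite R'" using IH(1) fin by (auto simp: forest_state_def intro: finite_subset)
  have dp: "card (dom par') = card (dom par) + 2 * card L"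
    using IH(3,4) R R' by (subst IH(3), subst card_Un_disjoint) (auto intro: finite_subset)
  have "children par' y c \<subseteq> children par y c"
  proof
    fix w assume w: "w \<in> children par' y c"
    show "w \<in> children par y c"
    proof (cases "w \<in> dom par")
      case True
      then show ?thesis using w IH(5) by auto
    next
      case False
      then have "w \<in> R' - R" using w IH(3) by blast
      then obtain y' where "y' \<in> L" "par' w = Some (y', c)" using IH(6) by blast
      then show ?thesis using w insert.hyps(2) by auto
    qed
  qed
  moreover have fch: "finite (children par y c)" using R by (intro finite_subset[of "children par y c" R]) auto
  ultimately have ch: "card (children par' y c) \<le> 1"
    using card_mono[of "children par y c" "children par' y c"] insert.prems(5)[of y] by auto
  have y: "y \<in> R'" "lev y \<le> j" using insert.prems IH by auto
  have small: "card (dom par') \<le> Q" "Suc (card (dom par')) \<le> Q" using insert.prems dp insert.hyps by auto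
  obtain w1 where w1: "w1 \<in> N (y, c)" "w1 \<notin> R'" "forest_state j z (par'(w1 \<mapsto> (y, c))) (insert w1 R')"
    using grow_one[OF IH(1) y insert.prems(4) _ small(1)] ch by auto
  have fch': "finite (children par' y c)" using finite_subset[OF _ R', of "dom par'"] IH(1)
    by (intro finite_subset[of "children par' y c" "dom par'"]) (auto simp: forest_state_def)
  have "card (children (par'(w1 \<mapsto> (y, c))) y c) \<le> card (insert w1 (children par' y c))"
    by (rule card_mono) (use fch' in auto)
  also have "\<dots> \<le> Suc (card (children par' y c))" by (rule card_insert_le_Suc[OF fch'])
  finally have "card (children (par'(w1 \<mapsto> (y, c))) y c) \<le> Suc (card (children par' y c))" .
  then have ch1: "card (children (par'(w1 \<mapsto> (y, c))) y c) \<le> 3" using ch by simp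
  have "card (dom (par'(w1 \<mapsto> (y, c)))) \<le> Suc (card (dom par'))"
    by (simp add: card_insert_le_m1 card_insert_if domIff)
  then have small1: "card (dom (par'(w1 \<mapsto> (y, c)))) \<le> Q" using small by simp
  have y1: "y \<in> insert w1 R'" using y(1) by simp
  obtain w2 where w2': "w2 \<in> N (y, c)" and w2: "w2 \<notin> insert w1 R'"
    "forest_state j z (par'(w1 \<mapsto> (y, c), w2 \<mapsto> (y, c))) (insert w2 (insert w1 R'))"
    by (rule grow_one[OF w1(3) y1 y(2) insert.prems(4) ch1 small1])
  let ?par = "par'(w1 \<mapsto> (y, c), w2 \<mapsto> (y, c))" and ?R = "insert w2 (insert w1 R')"
  have new: "?R - R = insert w2 (insert w1 (R' - R))" using w1 w2 IH(2) by auto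
  have "card (?R - R) = 2 * card (insert y L)"
    unfolding new using w1 w2 R' IH(4) insert.hyps by simp
  moreover have "dom ?par = dom par \<union> (?R - R)" unfolding new using IH(3) by auto
  moreover have "\<forall>w\<in>dom par. ?par w = par w" using IH(2,5) R w1 w2 by auto
  moreover have "\<forall>w\<in>?R - R. \<exists>y'\<in>insert y L. ?par w = Some (y', c)" unfolding new using IH(6) by auto
  moreover have "R \<subseteq> ?R" using IH(2) by auto
  ultimately show ?case using w2(2) by - (rule exI[of _ ?par], rule exI[of _ ?R], intro conjI; assumption)
qed

text \<open>\<open>card (R' - R) + 2 = 2 * 2 ^ k\<close> counts the nonroot vertices of a binary
  tree of depth \<open>k\<close> without subtraction. The leaves \<open>L\<close> own at most one
  vertex per colour, so they can branch again, and each comes with its path from the root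
  \<open>x\<close>.\<close>

definition grown :: "nat \<Rightarrow> 'v \<Rightarrow> ('v \<Rightarrow> ('v \<times> 'c) option) \<Rightarrow> 'v set \<Rightarrow> 'v \<Rightarrow> (nat \<Rightarrow> 'c) \<Rightarrow> nat \<Rightarrow>
    ('v \<Rightarrow> ('v \<times> 'c) option) \<Rightarrow> 'v set \<Rightarrow> 'v set \<Rightarrow> bool" where
  "grown j z par R x col k par' R' L \<longleftrightarrow>
     forest_state j z par' R' \<and> R \<subseteq> R' \<and> dom par' = dom par \<union> (R' - R) \<and>
     card (R' - R) + 2 = 2 * 2 ^ k \<and> (\<forall>w\<in>dom par. par' w = par w) \<and>
     L \<subseteq> R' \<and> card L = 2 ^ k \<and> (k > 0 \<longrightarrow> L \<inter> R = {}) \<and>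
     (\<forall>y\<in>L. lev y \<le> j \<and> (\<forall>c. card (children par' y c) \<le> 1)) \<and>
     (\<forall>w\<in>R' - R. \<exists>y c. par' w = Some (y, c) \<and> (y = x \<or> y \<in> R' - R)) \<and>
     (\<forall>y\<in>L. \<exists>p. distinct p \<and> length p = Suc k \<and> hd p = x \<and> last p = y \<and> set (tl p) \<subseteq> R' - R \<and>
        (\<forall>i<k. par' (p ! Suc i) = Some (p ! i, col i)))"

lemma grownD:
  assumes "grown j z par R x col k par' R' L"
  shows "forest_state j z par' R'" "R \<subseteq> R'" "dom par' = dom par \<union> (R' - R)"
    "card (R' - R) + 2 = 2 * 2 ^ k" "\<forall>w\<in>dom par. par' w = par w"
    "L \<subseteq> R'" "card L = 2 ^ k" "k > 0 \<longrightarrow> L \<inter> R = {}"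
    "\<forall>w\<in>R' - R. \<exists>y c. par' w = Some (y, c) \<and> (y = x \<or> y \<in> R' - R)"
    "\<forall>y\<in>L. \<exists>p. distinct p \<and> length p = Suc k \<and> hd p = x \<and> last p = y \<and> set (tl p) \<subseteq> R' - R \<and>
        (\<forall>i<k. par' (p ! Suc i) = Some (p ! i, col i))"
    "\<forall>y\<in>L. lev y \<le> j \<and> (\<forall>c. card (children par' y c) \<le> 1)"
  using assms unfolding grown_def by - (elim conjE, assumption)+

text \<open>Colours depend on the depth only. All paths from the root to a leaf then show the same
  colour sequence, so that the leaf used for the connection can be chosen afterwards.\<close>

lemma grow_tree:
  assumes "forest_state j z par R" "x \<in> R" "lev x \<le> j" "\<And>i. col i \<in> C"
    "\<And>c. card (children par x c) \<le> 1" "card (dom par) + 2 * 2 ^ k \<le> Q"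
  shows "\<exists>par' R' L. grown j z par R x col k par' R' L"
  unfolding grown_def
  using assms
proof (induction k)
  case 0
  then show ?case
    by (intro exI[of _ par] exI[of _ R] exI[of _ "{x}"]) (auto intro: exI[of _ "[x]"])
next
  case (Suc k)
  have "\<exists>par' R' L. grown j z par R x col k par' R' L"
    unfolding grown_def using Suc.prems by (intro Suc.IH) auto
  then obtain par1 R1 L1 where G: "grown j z par R x col k par1 R1 L1" by blast
  have IH: "forest_state j z par1 R1" "R \<subseteq> R1" "dom par1 = dom par \<union> (R1 - R)"
     "card (R1 - R) + 2 = 2 * 2 ^ k" "\<forall>w\<in>dom par. par1 w = par w"
     "L1 \<subseteq> R1" "card L1 = 2 ^ k"
     "\<forall>y\<in>L1. lev y \<le> j \<and> (\<forall>c. card (children par1 y c) \<le> 1)"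
     "\<forall>w\<in>R1 - R. \<exists>y c. par1 w = Some (y, c) \<and> (y = x \<or> y \<in> R1 - R)"
     "\<forall>y\<in>L1. \<exists>p. distinct p \<and> length p = Suc k \<and> hd p = x \<and> last p = y \<and> set (tl p) \<subseteq> R1 - R \<and>
        (\<forall>i<k. par1 (p ! Suc i) = Some (p ! i, col i))"
    using grownD[OF G] by - assumption+
  have R: "dom par \<subseteq> R" "finite R" using Suc.prems(1) fin by (auto simp: forest_state_def intro: finite_subset)
  have R1: "finite R1" using IH(1) fin by (auto simp: forest_state_def intro: finite_subset)
  have d1: "card (dom par1) = card (dom par) + card (R1 - R)"
    using R R1 by (subst IH(3), subst card_Un_disjoint) (auto intro: finite_subset)
  have "\<exists>par' R'. forest_state j z par' R' \<and> R1 \<subseteq> R' \<and> dom par' = dom par1 \<union> (R' - R1) \<and>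
     card (R' - R1) = 2 * card L1 \<and> (\<forall>w\<in>dom par1. par' w = par1 w) \<and>
     (\<forall>w\<in>R' - R1. \<exists>y\<in>L1. par' w = Some (y, col k))"
    using IH(8) IH(4) d1 Suc.prems(6) IH(7) Suc.prems(4)
    by (intro grow_level IH(1,6) finite_subset[OF IH(6) R1]) auto
  then obtain par2 R2 where S: "forest_state j z par2 R2" "R1 \<subseteq> R2" "dom par2 = dom par1 \<union> (R2 - R1)"
    "card (R2 - R1) = 2 * card L1" "\<forall>w\<in>dom par1. par2 w = par1 w"
    "\<forall>w\<in>R2 - R1. \<exists>y\<in>L1. par2 w = Some (y, col k)" by blast
  have R2: "finite R2" using S(1) fin by (auto simp: forest_state_def intro: finite_subset)
  have "R2 - R = (R2 - R1) \<union> (R1 - R)" using IH(2) S(2) by blast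
  then have c2: "card (R2 - R) = card (R2 - R1) + card (R1 - R)"
    using R1 R2 by (simp add: card_Un_disjoint Int_Diff Diff_Int_distrib2) (subst card_Un_disjoint, auto)
  have "forest_state j z par2 R2" "R \<subseteq> R2" "dom par2 = dom par \<union> (R2 - R)"
    using S IH(2,3) by auto
  moreover have "card (R2 - R) + 2 = 2 * 2 ^ Suc k" using c2 S(4) IH(4,7) by simp
  moreover have "\<forall>w\<in>dom par. par2 w = par w" using S(5) IH(3,5) by auto
  moreover have "R2 - R1 \<subseteq> R2" "card (R2 - R1) = 2 ^ Suc k" "(R2 - R1) \<inter> R = {}"
    using S(4) IH(2,7) by auto
  moreover have "lev y \<le> j \<and> (\<forall>c. card (children par2 y c) \<le> 1)" if y: "y \<in> R2 - R1" for y
  proof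
    obtain y' where y': "y' \<in> L1" "par2 y = Some (y', col k)" using S(6) y by blast
    then have "y \<in> N (y', col k)" using S(1) by (auto simp: forest_state_def)
    then show "lev y \<le> j" using N_lev[of y y' "col k"] IH(8) y'(1) by fastforce
    have "children par2 y c = {}" for c
    proof (rule ccontr)
      assume "children par2 y c \<noteq> {}"
      then obtain w where w: "par2 w = Some (y, c)" by blast
      show False
      proof (cases "w \<in> dom par1")
        case True
        then have "par1 w = Some (y, c)" using S(5) w by auto
        then have "y \<in> R1" using IH(1) unfolding forest_state_def by blast
        then show False using y by blast
      next
        case False
        then have "w \<in> R2 - R1" using S(3) w by blast
        then obtain y' where "y' \<in> L1" "par2 w = Some (y', col k)" using S(6) by blast
        then have "y \<in> L1" using w by simp
        then show False using IH(6) y by blast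
      qed
    qed
    then show "\<forall>c. card (children par2 y c) \<le> 1" by simp
  qed
  moreover have "\<exists>y c. par2 w = Some (y, c) \<and> (y = x \<or> y \<in> R2 - R)" if w: "w \<in> R2 - R" for w
  proof (cases "w \<in> R1")
    case True
    then have "w \<in> dom par1" "w \<in> R1 - R" using IH(3) w by auto
    then show ?thesis using IH(9) S(2,5) by (metis Diff_iff subsetD)
  next
    case False
    then obtain y where y: "y \<in> L1" "par2 w = Some (y, col k)" using S(6) w by blast
    obtain p where p: "length p = Suc k" "hd p = x" "last p = y" "set (tl p) \<subseteq> R1 - R" using IH(10) y by blast
    have "y = x \<or> y \<in> R1 - R"
    proof (cases "tl p = []")
      case True
      then show ?thesis using p by (cases p) auto
    next
      case False
      then have "y \<in> set (tl p)" using p(3) by (metis last_in_set last_tl)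
      then show ?thesis using p by blast
    qed
    then show ?thesis using y S(2) by auto
  qed
  moreover have "\<exists>p. distinct p \<and> length p = Suc (Suc k) \<and> hd p = x \<and> last p = y \<and> set (tl p) \<subseteq> R2 - R \<and>
        (\<forall>i<Suc k. par2 (p ! Suc i) = Some (p ! i, col i))" if y: "y \<in> R2 - R1" for y
  proof -
    obtain y' where y': "y' \<in> L1" "par2 y = Some (y', col k)" using S(6) y by blast
    obtain p where p: "distinct p" "length p = Suc k" "hd p = x" "last p = y'" "set (tl p) \<subseteq> R1 - R"
        "\<forall>i<k. par1 (p ! Suc i) = Some (p ! i, col i)" using IH(10) y' by blast
    have ne: "p \<noteq> []" using p(2) by auto
    have "set p \<subseteq> R1" using p(3,5) ne Suc.prems(2) IH(2) by (cases p) auto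
    then have "y \<notin> set p" using y by blast
    have "par2 ((p @ [y]) ! Suc i) = Some ((p @ [y]) ! i, col i)" if i: "i < Suc k" for i
    proof (cases "i = k")
      case True
      then show ?thesis using p(2,4) ne y'(2) by (simp add: nth_append last_conv_nth)
    next
      case False
      then have "i < k" using i by simp
      then have "par1 (p ! Suc i) = Some (p ! i, col i)" using p(6) by blast
      moreover from this have "p ! Suc i \<in> dom par1" by blast
      ultimately show ?thesis using S(5) p(2) \<open>i < k\<close> by (simp add: nth_append)
    qed
    moreover have "set (tl (p @ [y])) \<subseteq> R2 - R" using p(5) ne y S(2) IH(2) by auto
    ultimately show ?thesis
      using p ne \<open>y \<notin> set p\<close> by (intro exI[of _ "p @ [y]"]) simp
  qed
  ultimately show ?case
    by (intro exI[of _ par2] exI[of _ R2] exI[of _ "R2 - R1"] conjI ballI impI allI; simp)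
qed

text \<open>The path consumes nothing that active agents count on: each of its vertices is owned or
  out of their reach. The last vertex owns at most one vertex per colour (after
  \<open>connect\<close>, possibly its predecessor), hence it can root a new binary tree.\<close>

definition walk_state :: "(nat \<Rightarrow> 'c) \<Rightarrow> nat \<Rightarrow> 'v list \<Rightarrow> ('v \<Rightarrow> ('v \<times> 'c) option) \<Rightarrow> bool" where
  "walk_state f j us par \<longleftrightarrow> us \<noteq> [] \<and> distinct us \<and> set us \<subseteq> V \<and> coloured_path S f us \<and>
     dom par \<subseteq> set us \<and> extendable N 5 (2 * s) (agents j) par \<and>
     (\<forall>w u c. par w = Some (u, c) \<longrightarrow> u \<in> set us \<and> w \<in> N (u, c)) \<and>
     (\<forall>w\<in>set us - dom par. \<forall>a\<in>agents j. w \<notin> N a) \<and>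
     (\<forall>c. card (children par (last us) c) \<le> 1) \<and> lev (last us) \<le> j"

text \<open>A tree of depth \<open>l\<close> is grown from the end of the path and another one from
  \<open>w\<close>, and \<open>joined\<close> gives an edge between their leaves. Only the path
  through that edge is kept and all other tree vertices are released, so the lasting cost is
  \<open>2 * l\<close> inner vertices although \<open>4 * 2 ^ l\<close> are reserved for the moment.
  The first tree avoids \<open>w\<close>, its protected vertex \<open>z\<close>. The set
  \<open>F\<close> is out of reach of the active agents and can therefore simply be declared
  occupied.\<close>

lemma connect:
  assumes st: "walk_state f j us par" and w: "w \<in> V" "w \<notin> set us" "lev w \<le> j"
    and j': "j' \<le> j" "lev w \<le> j'" "\<And>a. a \<in> agents j' \<Longrightarrow> w \<notin> N a"
    and f: "\<And>i. f i \<in> C" and room: "length us + 4 * 2 ^ l \<le> Q"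
    and F: "F \<subseteq> V" "\<And>x a. x \<in> F \<Longrightarrow> a \<in> agents j \<Longrightarrow> x \<notin> N a"
  obtains mid par' where "length mid = 2 * l" "set mid \<subseteq> Z" "set mid \<inter> F = {}" "dom par' = dom par \<union> set mid"
    "walk_state f j' (us @ mid @ [w]) par'"
proof -
  define v where "v = last us"
  define k where "k = length us - 1"
  have us: "us \<noteq> []" "distinct us" "set us \<subseteq> V" "coloured_path S f us" "dom par \<subseteq> set us"
    using st by (auto simp: walk_state_def)
  have len: "length us = Suc k" using us(1) by (cases us) (auto simp: k_def)
  have own: "\<And>w u c. par w = Some (u, c) \<Longrightarrow> u \<in> set us \<and> w \<in> N (u, c)"
    using st unfolding walk_state_def by blast
  have st0: "forest_state j w par (insert w (set us \<union> F))"
    using st w F unfolding walk_state_def forest_state_def by blast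
  have "card (dom par) \<le> card (set us)" using us(5) by (intro card_mono) auto
  then have cd: "card (dom par) \<le> length us" using card_length le_trans by blast
  let ?R0 = "insert w (set us \<union> F)"
  have "v \<in> ?R0" "lev v \<le> j" "\<And>c. card (children par v c) \<le> 1"
    using st us(1) by (auto simp: walk_state_def v_def)
  then have "\<exists>par' R' L. grown j w par ?R0 v (\<lambda>i. f (k + i)) l par' R' L"
    using cd room by (intro grow_tree st0 f) auto
  then obtain par1 R1 L1 where G1: "grown j w par ?R0 v (\<lambda>i. f (k + i)) l par1 R1 L1" by blast
  note A = grownD[OF G1]
  have chw: "children par1 w c = {}" for c
  proof (rule ccontr)
    assume "children par1 w c \<noteq> {}"
    then obtain x where x: "par1 x = Some (w, c)" by blast
    show False
    proof (cases "x \<in> dom par")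
      case True
      then have "par x = Some (w, c)" using A(5) x by auto
      then show False using own w by blast
    next
      case False
      then have "x \<in> R1 - ?R0" using A(3) x by blast
      then obtain y c' where "par1 x = Some (y, c')" "y = v \<or> y \<in> R1 - ?R0" using A(9) by blast
      moreover have "v \<noteq> w" using w us(1) by (auto simp: v_def)
      ultimately show False using x by auto
    qed
  qed
  have finR1: "finite R1" using A(1) fin by (auto simp: forest_state_def intro: finite_subset)
  have "card (dom par1) \<le> card (dom par) + card (R1 - ?R0)" unfolding A(3) by (rule card_Un_le)
  then have room1: "card (dom par1) + 2 * 2 ^ l \<le> Q" using A(4) cd room by linarith
  have "w \<in> R1" "\<And>c. card (children par1 w c) \<le> 1" using A(2) chw by auto
  \<comment> \<open>\<open>w\<close> will stand at position \<open>k + 2 * l + 1\<close>, so the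
    second tree reads the colours backwards from \<open>k + 2 * l\<close>; colour
    \<open>k + l\<close> is left for the joining edge.\<close>
  then have "\<exists>par' R' L. grown j w par1 R1 w (\<lambda>i. f (k + 2 * l - i)) l par' R' L"
    by (intro grow_tree A(1) f w(3) room1)
  then obtain par2 R2 L2 where G2: "grown j w par1 R1 w (\<lambda>i. f (k + 2 * l - i)) l par2 R2 L2" by blast
  note B = grownD(1,2,3,5,6,7,8,9,10)[OF G2]
  have R2V: "R2 \<subseteq> V" using B(1) by (simp add: forest_state_def)
  have "\<exists>x\<in>L1. \<exists>y\<in>L2. (f (k + l), {x, y}) \<in> S"
    using A(6,7) B(2,5,6,7) R2V f l_pos by (intro joined) auto
  then obtain x y where xy: "x \<in> L1" "y \<in> L2" "(f (k + l), {x, y}) \<in> S" by blast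
  obtain p where p: "distinct p" "length p = Suc l" "hd p = v" "last p = x" "set (tl p) \<subseteq> R1 - ?R0"
    "\<And>i. i < l \<Longrightarrow> par1 (p ! Suc i) = Some (p ! i, f (k + i))" using A(10) xy(1) by blast
  obtain q where q: "distinct q" "length q = Suc l" "hd q = w" "last q = y" "set (tl q) \<subseteq> R2 - R1"
    "\<And>i. i < l \<Longrightarrow> par2 (q ! Suc i) = Some (q ! i, f (k + 2 * l - i))" using B(9) xy(2) by blast
  obtain p' where p': "p = v # p'" using p(2,3) by (cases p) auto
  obtain q' where q': "q = w # q'" using q(2,3) by (cases q) auto
  have lpq: "length p' = l" "length q' = l" using p(2) q(2) p' q' by auto
  have pne: "p' \<noteq> []" "q' \<noteq> []" using lpq l_pos by auto
  have sp: "set p' \<subseteq> R1 - ?R0" and sq: "set q' \<subseteq> R2 - R1" using p(5) q(5) p' q' by auto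
  define mid where "mid = p' @ rev q'"
  define par' where "par' = (\<lambda>x. if x \<in> dom par \<union> set mid then par2 x else None)"
  have smid: "set mid = set p' \<union> set q'" by (simp add: mid_def)
  have domm: "set mid \<subseteq> dom par2" using sp sq A(3) B(3) smid by auto
  have dom': "dom par' = dom par \<union> set mid"
  proof -
    have "dom par' = (dom par \<union> set mid) \<inter> dom par2" by (auto simp: par'_def split: if_splits)
    moreover have "dom par \<subseteq> dom par2" using A(3) B(3) by blast
    ultimately show ?thesis using domm by blast
  qed
  have par'_old: "par' x = par x" if "x \<in> dom par" for x
  proof -
    have "x \<in> dom par1" using that A(3) by blast
    then have "par2 x = par x" using that A(5) B(4) by simp
    then show ?thesis using that by (simp add: par'_def)
  qed
  have N2: "\<And>x u c. par2 x = Some (u, c) \<Longrightarrow> x \<in> N (u, c)"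
    using B(1) unfolding forest_state_def by blast
  have par_p: "par' (p ! Suc i) = Some (p ! i, f (k + i))" if i: "i < l" for i
  proof -
    have m: "p ! Suc i \<in> set p'" using i lpq p' by auto
    then have "p ! Suc i \<in> dom par1" using sp A(3) by auto
    then have "par2 (p ! Suc i) = par1 (p ! Suc i)" using B(4) by auto
    then show ?thesis using p(6)[OF i] m smid by (simp add: par'_def)
  qed
  have par_q: "par' (q ! Suc i) = Some (q ! i, f (k + 2 * l - i))" if i: "i < l" for i
  proof -
    have "q ! Suc i \<in> set q'" using i lpq q' by auto
    then show ?thesis using q(6)[OF i] smid by (simp add: par'_def)
  qed
  have par_N: "x \<in> N (u, c)" if "par' x = Some (u, c)" for x u c
    using that N2 by (auto simp: par'_def split: if_splits)
  have par_mid: "\<exists>u c. par' x = Some (u, c) \<and> u \<in> insert v (insert w (set mid)) \<and> (u = w \<longrightarrow> x = q ! 1)"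
    if x: "x \<in> set mid" for x
  proof -
    consider i where "i < l" "x = p ! Suc i" | i where "i < l" "x = q ! Suc i"
      using x smid lpq p' q' by (auto simp: in_set_conv_nth)
    then show ?thesis
    proof cases
      case (1 i)
      have "p ! i \<in> set p" using 1 p(2) by simp
      then have "p ! i \<in> insert v (set p')" using p' by simp
      moreover have "p ! i \<noteq> w" using calculation sp w us(1) by (auto simp: v_def)
      ultimately show ?thesis using 1 par_p smid by auto
    next
      case (2 i)
      have "q ! i \<in> set q" using 2 q(2) by simp
      then have "q ! i \<in> insert w (set q')" using q' by simp
      moreover have "x = q ! 1" if "q ! i = w"
      proof -
        have "q ! i = q ! 0" using that q' by simp
        then have "i = 0" using q(1,2) 2 by (subst (asm) nth_eq_iff_index_eq) auto
        then show ?thesis using 2 by simp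
      qed
      ultimately show ?thesis using 2 par_q smid by auto
    qed
  qed
  have dist: "distinct (us @ mid @ [w])"
    using us(2) w sp sq p(1) q(1) p' q' A(2) B(2) by (auto simp: mid_def)
  have path: "coloured_path S f (us @ mid @ [w])"
  proof -
    have P: "coloured_path S (\<lambda>i. f (k + i)) p"
      unfolding coloured_path_def
    proof (intro allI impI)
      fix i assume "Suc i < length p"
      then show "(f (k + i), {p ! i, p ! Suc i}) \<in> S"
        using par_p[of i] p(2) par_N N_edge by auto
    qed
    have "coloured_path S (\<lambda>i. f (k + Suc l + (length q - 2 - i))) q"
      unfolding coloured_path_def
    proof (intro allI impI)
      fix i assume i: "Suc i < length q"
      have "(f (k + 2 * l - i), {q ! i, q ! Suc i}) \<in> S"
        using par_q[of i] i q(2) par_N N_edge by auto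
      moreover have "k + Suc l + (length q - 2 - i) = k + 2 * l - i" using q(2) i by simp
      ultimately show "(f (k + Suc l + (length q - 2 - i)), {q ! i, q ! Suc i}) \<in> S" by simp
    qed
    then have Q: "coloured_path S (\<lambda>i. f (k + Suc l + i)) (rev q)" by (rule coloured_path_rev)
    have PQ: "coloured_path S (\<lambda>i. f (k + i)) (p @ rev q)"
      using P Q xy(3) p(2,4) q(2,4) by (subst coloured_path_append) (auto simp: add.assoc hd_rev)
    have "p @ rev q = v # (mid @ [w])" by (simp add: p' q' mid_def)
    with PQ have PQ': "coloured_path S (\<lambda>i. f (k + i)) ([v] @ (mid @ [w]))" by simp
    have "(f k, {v, hd (mid @ [w])}) \<in> S" "coloured_path S (\<lambda>i. f (Suc k + i)) (mid @ [w])"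
      using PQ' by (subst (asm) coloured_path_append, simp)+
    then show ?thesis using us(1,4) len by (subst coloured_path_append) (simp add: v_def)
  qed
  have "walk_state f j' (us @ mid @ [w]) par'"
    unfolding walk_state_def
  proof (intro conjI)
    show "set (us @ mid @ [w]) \<subseteq> V" using us(3) w(1) smid sp sq R2V B(2) by auto
    show "dom par' \<subseteq> set (us @ mid @ [w])" using dom' us(5) by auto
    have "extendable N 5 (2 * s) (agents j) par'"
    proof (rule extendable_restrict[OF _ finite_N])
      show "extendable N 5 (2 * s) (agents j) par2" using B(1) by (simp add: forest_state_def)
    qed (simp add: par'_def)
    then show "extendable N 5 (2 * s) (agents j') par'"
      by (rule extendable_mono) (use j'(1) in \<open>auto simp: agents_def\<close>)
    show "\<forall>x u c. par' x = Some (u, c) \<longrightarrow> u \<in> set (us @ mid @ [w]) \<and> x \<in> N (u, c)"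
    proof (intro allI impI conjI)
      fix x u c assume x: "par' x = Some (u, c)"
      then show "x \<in> N (u, c)" by (rule par_N)
      show "u \<in> set (us @ mid @ [w])"
      proof (cases "x \<in> dom par")
        case True
        then show ?thesis using x par'_old own by auto
      next
        case False
        then have "x \<in> set mid" using x dom' by blast
        then show ?thesis using par_mid[of x] x us(1) by (auto simp: v_def)
      qed
    qed
    show "\<forall>x\<in>set (us @ mid @ [w]) - dom par'. \<forall>a\<in>agents j'. x \<notin> N a"
    proof (intro ballI)
      fix x a assume x: "x \<in> set (us @ mid @ [w]) - dom par'" and a: "a \<in> agents j'"
      then have "x \<in> set us - dom par \<or> x = w" using dom' by auto
      moreover have "a \<in> agents j" using a j'(1) by (auto simp: agents_def)
      ultimately show "x \<notin> N a" using st j'(3)[OF a] unfolding walk_state_def by blast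
    qed
    show "\<forall>c. card (children par' (last (us @ mid @ [w])) c) \<le> 1"
    proof
      fix c
      have "children par' w c \<subseteq> {q ! 1}"
      proof
        fix x assume "x \<in> children par' w c"
        then have x: "par' x = Some (w, c)" by simp
        show "x \<in> {q ! 1}"
        proof (cases "x \<in> dom par")
          case True
          then show ?thesis using x par'_old own w by metis
        next
          case False
          then have "x \<in> set mid" using x dom' by blast
          then show ?thesis using par_mid[of x] x by auto
        qed
      qed
      then show "card (children par' (last (us @ mid @ [w])) c) \<le> 1"
        using card_mono[of "{q ! 1}"] by fastforce
    qed
  qed (use dist path j' in auto)
  moreover have "length mid = 2 * l" using lpq by (simp add: mid_def)
  moreover have "set mid \<inter> F = {}" using smid sp sq A(2) by auto
  moreover have "set mid \<subseteq> Z"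
  proof
    fix y assume "y \<in> set mid"
    then obtain u c where "par2 y = Some (u, c)" using domm by auto
    then show "y \<in> Z" using N2 NZ by blast
  qed
  ultimately show thesis using dom' by (intro that[of mid par']) auto
qed

end

section \<open>A rigid coloured path through a prescribed set\<close>

text \<open>\<open>h\<close> takes the position of the current end as an argument, because that
  position prescribes the two colours of a hop.\<close>

inductive hop_path :: "(nat \<Rightarrow> 'v \<Rightarrow> 'v \<Rightarrow> 'v \<Rightarrow> bool) \<Rightarrow> 'v set \<Rightarrow> 'v set \<Rightarrow> 'v list \<Rightarrow> bool"
  for h B X where
  single: "b \<in> B \<Longrightarrow> hop_path h B X [b]"
| hop: "hop_path h B X R \<Longrightarrow> z \<in> X \<Longrightarrow> w \<in> B \<Longrightarrow> h (length R - 1) (last R) z w \<Longrightarrow>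
    hop_path h B X (R @ [z, w])"

lemma hop_path_ends: "hop_path h B X R \<Longrightarrow> R \<noteq> [] \<and> hd R \<in> B \<and> last R \<in> B"
  by (induction rule: hop_path.induct) auto

lemma hop_path_coloured:
  assumes "hop_path (\<lambda>i v z w. (f i, {v, z}) \<in> S \<and> (f (Suc i), {z, w}) \<in> S) B X R"
  shows "coloured_path S f R"
  using assms
proof induction
  case (hop R z w)
  have "R \<noteq> []" using hop_path_ends[OF hop.hyps(1)] by blast
  moreover have "coloured_path S (\<lambda>i. f (length R + i)) [z, w]"
    using hop.hyps \<open>R \<noteq> []\<close> by (auto simp: coloured_path_def)
  ultimately show ?case using hop by (subst coloured_path_append) auto
qed simp

text \<open>A vertex is discarded once it has no hop to the unvisited part; too many discarded vertices
  would contradict the density assumption.\<close>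

lemma depth_first_search:
  assumes fin: "finite B" "finite X" and BX: "B \<inter> X = {}" and B: "B \<noteq> {}"
    and dense: "\<And>D U Q pos. D \<subseteq> B \<Longrightarrow> U \<subseteq> B \<Longrightarrow> D \<inter> U = {} \<Longrightarrow> card D = s \<Longrightarrow> s \<le> card U \<Longrightarrow>
      Q \<subseteq> X \<Longrightarrow> card Q \<le> card B \<Longrightarrow> \<exists>v\<in>D. \<exists>z\<in>X - Q. \<exists>w\<in>U. h (pos v) v z w"
    and s: "1 \<le> s"
  shows "\<exists>R. hop_path h B X R \<and> distinct R \<and> set R \<subseteq> B \<union> X \<and> card (B - set R) \<le> 2 * s \<and>
    length R \<le> 2 * card B"
proof -
  have "\<exists>R. hop_path h B X R \<and> distinct R \<and> set R \<subseteq> B \<union> X \<and> card (B - set R) \<le> 2 * s \<and>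
      length R \<le> 2 * card B"
    if "R = [] \<or> hop_path h B X R" "distinct R" "set R \<subseteq> B \<union> Q" "Q \<subseteq> X"
      "B = (set R \<inter> B) \<union> D \<union> U" "set R \<inter> D = {}" "set R \<inter> U = {}" "D \<inter> U = {}"
      "card Q + card U \<le> card B" "card D < s"
      "\<And>v z w. v \<in> D \<Longrightarrow> z \<in> X - Q \<Longrightarrow> w \<in> U \<Longrightarrow> \<not> h (pos v) v z w"
    for R D U Q pos
    using that
  \<comment> \<open>A hop moves one vertex from \<open>U\<close> to the path, a failure removes one
    vertex of \<open>B\<close> from the path; the weight 2 on \<open>U\<close> makes both decrease
    the measure.\<close>
  proof (induction "2 * card U + card (set R \<inter> B)" arbitrary: R D U Q pos rule: less_induct)
    case less
    note pr = less.prems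
    have sub: "D \<subseteq> B" "U \<subseteq> B" using pr(5) by blast+
    have finDU: "finite D" "finite U" "finite Q" using sub fin pr(4) finite_subset by blast+
    show ?case
    proof (cases "card U \<le> s")
      case True
      have left: "card (B - set R') \<le> 2 * s" if "set R \<subseteq> set R'" for R'
      proof -
        have "B - set R' \<subseteq> D \<union> U" using pr(5) that by blast
        then have "card (B - set R') \<le> card (D \<union> U)" using finDU by (intro card_mono) auto
        also have "\<dots> \<le> card D + card U" by (rule card_Un_le)
        finally show ?thesis using True pr(10) by linarith
      qed
      show ?thesis
      proof (cases "R = []")
        case True
        obtain b where b: "b \<in> B" using B by blast
        have "card B \<ge> 1" using b fin by (auto simp: Suc_le_eq card_gt_0_iff)
        then show ?thesis
          using left[of "[b]"] True b by (intro exI[of _ "[b]"]) (auto intro: hop_path.single)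
      next
        case False
        have "length R = card (set R)" using pr(2) by (simp add: distinct_card)
        also have "\<dots> \<le> card (B \<union> Q)" using pr(3) fin finDU by (intro card_mono) auto
        also have "\<dots> \<le> card B + card Q" by (rule card_Un_le)
        also have "\<dots> \<le> 2 * card B" using pr(9) by simp
        finally have "length R \<le> 2 * card B" .
        then show ?thesis using False pr(1-4) left[of R] by (intro exI[of _ R]) auto
      qed
    next
      case bigU: False
      show ?thesis
      proof (cases "R = []")
        case True
        obtain u where u: "u \<in> U" using bigU by (cases "U = {}") auto
        have c: "card (U - {u}) = card U - 1" "card U \<ge> 1" using u finDU by (auto simp: Suc_le_eq card_gt_0_iff)
        have uB: "set [u] \<inter> B = {u}" using u sub by auto
        show ?thesis
        proof (rule less.hyps[of "U - {u}" "[u]" Q D pos])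
          show "2 * card (U - {u}) + card (set [u] \<inter> B) < 2 * card U + card (set R \<inter> B)"
            using c uB True by simp
          show "[u] = [] \<or> hop_path h B X [u]" using u sub by (auto intro: hop_path.single)
          show "B = set [u] \<inter> B \<union> D \<union> (U - {u})" using pr(5) True u by auto
          show "card Q + card (U - {u}) \<le> card B" using pr(9) c by simp
        qed (use pr u sub in auto)
      next
        case False
        then have hp: "hop_path h B X R" using pr(1) by blast
        note ends = hop_path_ends[OF hp]
        define v where "v = last R"
        have v: "v \<in> B" "v \<in> set R" using ends by (auto simp: v_def)
        show ?thesis
        proof (cases "\<exists>z\<in>X - Q. \<exists>w\<in>U. h (length R - 1) v z w")
          case True
          then obtain z w where zw: "z \<in> X" "z \<notin> Q" "w \<in> U" "h (length R - 1) v z w" by blast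
          have c: "card (U - {w}) = card U - 1" "card U \<ge> 1" using zw finDU by (auto simp: Suc_le_eq card_gt_0_iff)
          have zn: "z \<notin> set R" "z \<notin> B" "w \<notin> set R" "w \<in> B" "z \<noteq> w" using zw pr(3,7) BX sub by auto
          have "set (R @ [z, w]) \<inter> B = insert w (set R \<inter> B)" using zn by auto
          then have cR: "card (set (R @ [z, w]) \<inter> B) = Suc (card (set R \<inter> B))" using zn by simp
          show ?thesis
          proof (rule less.hyps[of "U - {w}" "R @ [z, w]" "insert z Q" D pos])
            show "2 * card (U - {w}) + card (set (R @ [z, w]) \<inter> B) < 2 * card U + card (set R \<inter> B)"
              using c cR by simp
            show "R @ [z, w] = [] \<or> hop_path h B X (R @ [z, w])"
              using hp zw zn by (auto intro: hop_path.hop simp: v_def)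
            show "distinct (R @ [z, w])" using pr(2) zn by auto
            show "set (R @ [z, w]) \<subseteq> B \<union> insert z Q" using pr(3) zn by auto
            show "B = set (R @ [z, w]) \<inter> B \<union> D \<union> (U - {w})" using pr(5) zn zw by auto
            show "set (R @ [z, w]) \<inter> D = {}" using pr(6,8) zn zw sub by auto
            \<comment> \<open>Middle vertices are never reused, even after backtracking; each is
              paid for by the vertex that leaves \<open>U\<close> for good.\<close>
            show "card (insert z Q) + card (U - {w}) \<le> card B"
              using pr(9) c zw finDU by simp
          qed (use pr zw zn in auto)
        next
          case dead: False
          \<comment> \<open>\<open>v\<close> has failed only for the colours at its present
            position. That position is recorded, since the path may later shrink and regrow; this is
            why the density hypothesis allows an arbitrary position for each discarded
            vertex.\<close>
          define pos' where "pos' = pos(v := length R - 1)"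
          have vD: "v \<notin> D" using v pr(6) by blast
          have dd: "\<not> h (pos' x) x z w" if "x \<in> insert v D" "z \<in> X - Q" "w \<in> U" for x z w
            using that dead pr(11) vD by (cases "x = v") (auto simp: pos'_def)
          have "card (insert v D) \<noteq> s"
          proof
            assume "card (insert v D) = s"
            moreover have "insert v D \<subseteq> B" "insert v D \<inter> U = {}" using v sub pr(7,8) by auto
            moreover have "card Q \<le> card B" using pr(9) by simp
            ultimately obtain x z w where "x \<in> insert v D" "z \<in> X - Q" "w \<in> U" "h (pos' x) x z w"
              using dense[of "insert v D" U Q pos'] sub bigU pr(4) by auto
            then show False using dd by blast
          qed
          then have cD: "card (insert v D) < s" using pr(10) vD finDU by simp
          obtain R' where R': "R' = [] \<or> hop_path h B X R'" "set R' \<subseteq> set R" "distinct R'"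
            "set R \<inter> B = insert v (set R' \<inter> B)" "v \<notin> set R'"
            using hp
          proof cases
            case (single b)
            then show thesis using that[of "[]"] by (auto simp: v_def)
          next
            case (hop R'' z w)
            then show thesis using that[of R''] pr(2) BX by (auto simp: v_def)
          qed
          show ?thesis
          proof (rule less.hyps[of U R' Q "insert v D" pos'])
            show "2 * card U + card (set R' \<inter> B) < 2 * card U + card (set R \<inter> B)"
              using R' by simp
            show "B = set R' \<inter> B \<union> insert v D \<union> U" using pr(5) R'(4) by blast
            show "\<not> h (pos' x) x z w" if "x \<in> insert v D" "z \<in> X - Q" "w \<in> U" for x z w
              by (rule dd[OF that])
          qed (use pr R' v cD in auto)
        qed
      qed
    qed
  qed
  from this[of "[]" "{}" "{}" B] s fin show ?thesis by auto
qed

section \<open>Assembling the rigid path through \<open>B\<close>\<close>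

context reservoir begin

text \<open>Decreasing rank keeps the agents intact: when \<open>w\<close> is reached, the cap drops
  to \<open>lev w\<close>, and no agent of rank at most \<open>lev w\<close> uses
  \<open>w\<close>.\<close>

lemma cover_list:
  assumes "walk_state f j us par" "sorted_wrt (\<lambda>x y. lev y \<le> lev x) ws"
    "\<And>w. w \<in> set ws \<Longrightarrow> w \<in> V \<and> 1 \<le> lev w \<and> lev w \<le> j" "1 \<le> j" "\<And>i. f i \<in> C"
    "length us + length ws * (2 * l + 1) + 4 * 2 ^ l \<le> Q"
  shows "\<exists>vs par' j'. walk_state f j' (us @ vs) par' \<and> 1 \<le> j' \<and> j' \<le> j \<and> set ws \<subseteq> set (us @ vs) \<and>
    set vs \<subseteq> set ws \<union> Z \<and> length vs \<le> length ws * (2 * l + 1)"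
  using assms
proof (induction ws arbitrary: us par j)
  case Nil
  then show ?case by (intro exI[of _ "[]"] exI[of _ par] exI[of _ j]) auto
next
  case (Cons w ws)
  show ?case
  \<comment> \<open>An earlier connecting path may already have passed through \<open>w\<close>, as
    \<open>Z\<close> may contain vertices of \<open>ws\<close>.\<close>
  proof (cases "w \<in> set us")
    case True
    have "\<exists>vs par' j'. walk_state f j' (us @ vs) par' \<and> 1 \<le> j' \<and> j' \<le> j \<and> set ws \<subseteq> set (us @ vs) \<and>
      set vs \<subseteq> set ws \<union> Z \<and> length vs \<le> length ws * (2 * l + 1)"
      using Cons.prems by (intro Cons.IH) auto
    then obtain vs par' j' where "walk_state f j' (us @ vs) par'" "1 \<le> j'" "j' \<le> j"
      "set ws \<subseteq> set (us @ vs)" "set vs \<subseteq> set ws \<union> Z" "length vs \<le> length ws * (2 * l + 1)" by blast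
    then show ?thesis using True by (intro exI[of _ vs] exI[of _ par'] exI[of _ j']) auto
  next
    case False
    have w: "w \<in> V" "1 \<le> lev w" "lev w \<le> j" using Cons.prems(3) by auto
    have Nw: "w \<notin> N a" if "a \<in> agents (lev w)" for a
    proof
      assume "w \<in> N a"
      moreover obtain u c where "a = (u, c)" by (cases a)
      ultimately show False using N_lev[of w u c] that w(2) by (auto simp: agents_def)
    qed
    have room: "length us + 4 * 2 ^ l \<le> Q" using Cons.prems(6) by simp
    obtain mid par1 where m: "length mid = 2 * l" "set mid \<subseteq> Z"
      "walk_state f (lev w) (us @ mid @ [w]) par1"
      by (rule connect[where F = "{}", OF Cons.prems(1) w(1) False w(3,3) order.refl Nw Cons.prems(5) room])
        auto
    have "\<exists>vs par' j'. walk_state f j' ((us @ mid @ [w]) @ vs) par' \<and> 1 \<le> j' \<and> j' \<le> lev w \<and>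
      set ws \<subseteq> set ((us @ mid @ [w]) @ vs) \<and>
      set vs \<subseteq> set ws \<union> Z \<and> length vs \<le> length ws * (2 * l + 1)"
      using Cons.prems w m by (intro Cons.IH[of "lev w" "us @ mid @ [w]" par1]) auto
    then obtain vs par' j' where *: "walk_state f j' ((us @ mid @ [w]) @ vs) par'" "1 \<le> j'" "j' \<le> lev w"
      "set ws \<subseteq> set ((us @ mid @ [w]) @ vs)" "set vs \<subseteq> set ws \<union> Z" "length vs \<le> length ws * (2 * l + 1)"
      by blast
    then show ?thesis using w m
      by (intro exI[of _ "mid @ [w] @ vs"] exI[of _ par'] exI[of _ j']) auto
  qed
qed

text \<open>Vertices of \<open>B\<close> of rank at least 2 are reached one by one. Those of rank 1
  are of no use to the agents that remain and are swept up by the search through \<open>X\<close>;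
  its at most \<open>2 * s\<close> leftovers are again reached one by one. This makes up to
  \<open>3 * s\<close> single connections and a few between the phases, each adding
  \<open>2 * l + 1\<close> vertices, while the search uses at most \<open>2 * card B\<close>. The
  vertex \<open>x1\<close> is a stopover of rank 0 at which the cap drops to 1.\<close>

theorem rigid_path:
  assumes ext: "extendable N 5 (2 * s) (V \<times> C) Map.empty"
    and B: "B \<subseteq> V" "\<And>u. u \<in> B \<Longrightarrow> 1 \<le> lev u" "card {u \<in> B. 2 \<le> lev u} \<le> s"
    and X: "X \<subseteq> V" "X \<inter> Z = {}" "\<And>x. x \<in> X \<Longrightarrow> lev x = 0"
    and x: "{x0, x1, x2} \<subseteq> V - Z - X" "x0 \<noteq> x1" "x0 \<noteq> x2" "x1 \<noteq> x2" "lev x0 = 0" "lev x1 = 0" "lev x2 = 0"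
    and f: "\<And>i. f i \<in> C"
    and dense: "\<And>D U P g g'. D \<subseteq> V - X \<Longrightarrow> U \<subseteq> V - X \<Longrightarrow> D \<inter> U = {} \<Longrightarrow> card D = s \<Longrightarrow> s \<le> card U \<Longrightarrow>
      P \<subseteq> X \<Longrightarrow> card P \<le> card B \<Longrightarrow> (\<And>v. g v \<in> C \<and> g' v \<in> C) \<Longrightarrow>
      \<exists>v\<in>D. \<exists>z\<in>X - P. \<exists>w\<in>U. (g v, {v, z}) \<in> S \<and> (g' v, {z, w}) \<in> S"
    and room: "(3 * s + 4) * (2 * l + 1) + 2 * card B + 1 + 4 * 2 ^ l \<le> Q"
  obtains us where "distinct us" "us \<noteq> []" "hd us = x0" "last us = x2" "coloured_path S f us"
    "B \<subseteq> set us" "set us \<subseteq> B \<union> X \<union> Z \<union> {x0, x1, x2}"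
proof -
  have fB: "finite B" "finite X" using B X fin finite_subset by auto
  have notN: "y \<notin> N a" if "y \<notin> Z" for y a using that NZ by blast
  have BX: "B \<inter> X = {}" using B(2) X(3) by fastforce
  have xB: "x0 \<notin> B" "x1 \<notin> B" "x2 \<notin> B" using x B(2) by fastforce+
  define j0 where "j0 = Suc (\<Sum>u\<in>V. lev u)"
  have j0: "lev u \<le> j0" if "u \<in> V" for u
    using member_le_sum[of u V lev] that fin unfolding j0_def by simp
  have st1: "walk_state f j0 [x0] Map.empty"
    using x notN j0 extendable_mono[OF ext, of "agents j0"]
    by (auto simp: walk_state_def agents_def)
  obtain xs where xs: "set xs = {u \<in> B. 2 \<le> lev u}" "distinct xs"
    using finite_distinct_list[of "{u \<in> B. 2 \<le> lev u}"] fB by auto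
  define ws where "ws = rev (sort_key lev xs)"
  have ws: "set ws = {u \<in> B. 2 \<le> lev u}" "sorted_wrt (\<lambda>x y. lev y \<le> lev x) ws" "length ws \<le> s"
    using xs B(3) sorted_sort_key[of lev xs]
    by (auto simp: ws_def sorted_map sorted_wrt_rev distinct_card[symmetric])
  define L where "L = 2 * l + 1"
  have room': "3 * (s * L) + 4 * L + 2 * card B + 1 + 4 * 2 ^ l \<le> Q"
    using room by (simp add: L_def algebra_simps)
  have wsL: "length ws * L \<le> s * L" using ws(3) by simp
  have "\<exists>vs par' j'. walk_state f j' ([x0] @ vs) par' \<and> 1 \<le> j' \<and> j' \<le> j0 \<and> set ws \<subseteq> set ([x0] @ vs) \<and>
    set vs \<subseteq> set ws \<union> Z \<and> length vs \<le> length ws * (2 * l + 1)"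
  proof (rule cover_list[OF st1 ws(2)])
    show "length [x0] + length ws * (2 * l + 1) + 4 * 2 ^ l \<le> Q"
      using room' wsL unfolding L_def[symmetric] list.size by linarith
  qed (use ws(1) B(1) j0 f in \<open>auto simp: j0_def\<close>)
  then obtain vs2 par2 j2 where st2: "walk_state f j2 ([x0] @ vs2) par2" "1 \<le> j2"
    "set ws \<subseteq> set ([x0] @ vs2)" "set vs2 \<subseteq> set ws \<union> Z" "length vs2 \<le> length ws * L"
    unfolding L_def by blast
  have x1: "x1 \<in> V" "x1 \<notin> set ([x0] @ vs2)" "lev x1 \<le> j2" "lev x1 \<le> 1"
    using x xB st2(4) ws(1) by auto
  have r2: "length ([x0] @ vs2) + 4 * 2 ^ l \<le> Q"
    using st2(5) room' wsL unfolding length_append list.size by linarith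
  obtain mid2 par3 where m2: "length mid2 = 2 * l" "set mid2 \<subseteq> Z"
    "walk_state f 1 (([x0] @ vs2) @ mid2 @ [x1]) par3"
    by (rule connect[where F = "{}" and j' = 1, OF st2(1) x1(1,2,3) st2(2) x1(4) _ f r2])
      (use x notN in auto)
  define us3 where "us3 = ([x0] @ vs2) @ mid2 @ [x1]"
  have st3: "walk_state f 1 us3 par3" using m2 by (simp add: us3_def)
  have us3: "set us3 \<subseteq> B \<union> Z \<union> {x0, x1}" "last us3 = x1" "hd us3 = x0"
    "us3 \<noteq> []" "set ws \<subseteq> set us3"
    using st2(3,4) ws(1) m2 by (auto simp: us3_def)
  have us3_len: "length us3 \<le> 1 + s * L + L"
    using st2(5) m2(1) wsL unfolding us3_def length_append list.size L_def by linarith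
  have x2us3: "x2 \<notin> set us3" using us3(1) x xB by auto
  define B' where "B' = B - set us3"
  have levB': "lev u = 1" if "u \<in> B'" for u
    using that B(2)[of u] us3(5) ws(1) by (fastforce simp: B'_def)
  have B'N: "u \<notin> N a" if u: "u \<in> B' \<union> X" and a: "a \<in> agents 1" for u a
  proof
    assume uN: "u \<in> N a"
    then have "u \<in> B'" using u NZ X(2) by blast
    moreover obtain v c where "a = (v, c)" by (cases a)
    ultimately show False using N_lev[of u v c] uN a levB'[of u] by (auto simp: agents_def)
  qed
  have "\<exists>us par. walk_state f 1 us par \<and> hd us = x0 \<and> B \<subseteq> set us \<and> set us \<subseteq> B \<union> X \<union> Z \<union> {x0, x1} \<and>
     length us + 4 * 2 ^ l \<le> Q"
  proof (cases "B' = {}")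
    case True
    then show ?thesis using st3 us3 room' us3_len by (intro exI[of _ us3] exI[of _ par3]) (auto simp: B'_def)
  next
    case False
    \<comment> \<open>The search is run before its path is attached, so colours must be read at the
      final positions: after \<open>us3\<close> and the \<open>2 * l\<close> inner vertices of the
      connection still to be made.\<close>
    define k where "k = length us3 + 2 * l"
    let ?h = "\<lambda>i v z w. (f (k + i), {v, z}) \<in> S \<and> (f (k + Suc i), {z, w}) \<in> S"
    have B'B: "B' \<subseteq> B" "card B' \<le> card B" using fB by (auto simp: B'_def intro: card_mono)
    have "\<exists>R. hop_path ?h B' X R \<and> distinct R \<and> set R \<subseteq> B' \<union> X \<and> card (B' - set R) \<le> 2 * s \<and>
        length R \<le> 2 * card B'"
    proof (rule depth_first_search)
      show "finite B'" "finite X" "B' \<inter> X = {}" "B' \<noteq> {}" "1 \<le> s"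
        using fB BX False s_pos by (auto simp: B'_def)
      fix D U P and pos :: "'v \<Rightarrow> nat"
      assume *: "D \<subseteq> B'" "U \<subseteq> B'" "D \<inter> U = {}" "card D = s" "s \<le> card U" "P \<subseteq> X" "card P \<le> card B'"
      have DU: "D \<subseteq> V - X" "U \<subseteq> V - X" "card P \<le> card B" using * B(1) BX B'B by auto
      show "\<exists>v\<in>D. \<exists>z\<in>X - P. \<exists>w\<in>U. (f (k + pos v), {v, z}) \<in> S \<and> (f (k + Suc (pos v)), {z, w}) \<in> S"
        using dense[OF DU(1,2) *(3,4,5,6) DU(3), of "\<lambda>v. f (k + pos v)" "\<lambda>v. f (k + Suc (pos v))"] f by blast
    qed
    then obtain R where R: "hop_path ?h B' X R" "distinct R" "set R \<subseteq> B' \<union> X"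
      "card (B' - set R) \<le> 2 * s" "length R \<le> 2 * card B'" by blast
    note ends = hop_path_ends[OF R(1)]
    have Rpath: "coloured_path S (\<lambda>i. f (k + i)) R"
      using R(1) by (intro hop_path_coloured[of "\<lambda>i. f (k + i)" S B' X R]) simp
    have Rdisj: "set R \<inter> set us3 = {}" using R(3) us3(1) X(2) x BX by (auto simp: B'_def)
    define b where "b = hd R"
    have b: "b \<in> V" "b \<notin> set us3" "lev b \<le> 1"
      using ends B(1) levB' by (auto simp: b_def B'_def)
    have bN: "\<And>a. a \<in> agents 1 \<Longrightarrow> b \<notin> N a" using ends B'N by (auto simp: b_def)
    have r3: "length us3 + 4 * 2 ^ l \<le> Q" using us3_len room' by linarith
    have RV: "set R \<subseteq> V" "\<And>y a. y \<in> set R \<Longrightarrow> a \<in> agents 1 \<Longrightarrow> y \<notin> N a"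
      using R(3) B(1) X(1) B'N by (auto simp: B'_def)
    \<comment> \<open>The vertices of \<open>R\<close> have rank 1 or lie outside \<open>Z\<close>,
      so the remaining agents cannot reach them; declaring \<open>set R\<close> occupied keeps the
      connection off the path it leads to.\<close>
    obtain mid par4 where m4: "length mid = 2 * l" "set mid \<subseteq> Z" "set mid \<inter> set R = {}"
      "walk_state f 1 (us3 @ mid @ [b]) par4"
      by (rule connect[where F = "set R", OF st3 b(1,2,3) order.refl b(3) bN f r3 RV]) auto
    define us5 where "us5 = us3 @ mid @ R"
    have Rb: "R = b # tl R" using ends by (simp add: b_def)
    have d4: "distinct (us3 @ mid @ [b])" "coloured_path S f (us3 @ mid @ [b])"
      "dom par4 \<subseteq> set (us3 @ mid @ [b])"
      "\<And>w u c. par4 w = Some (u, c) \<Longrightarrow> u \<in> set (us3 @ mid @ [b]) \<and> w \<in> N (u, c)"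
      "\<And>w a. w \<in> set (us3 @ mid @ [b]) - dom par4 \<Longrightarrow> a \<in> agents 1 \<Longrightarrow> w \<notin> N a"
      "\<And>c. card (children par4 b c) \<le> 1" "extendable N 5 (2 * s) (agents 1) par4"
      using m4(4) by (auto simp: walk_state_def)
    have sub4: "set (us3 @ mid @ [b]) \<subseteq> set us5" using Rb by (auto simp: us5_def b_def ends)
    have st5: "walk_state f 1 us5 par4"
      unfolding walk_state_def
    proof (intro conjI)
      show "us5 \<noteq> []" "distinct us5" using us3(4) d4(1) R(2) Rdisj m4(3) by (auto simp: us5_def)
      show "set us5 \<subseteq> V" using m4(2) ZV RV(1) st3 by (auto simp: us5_def walk_state_def)
      have "coloured_path S f ((us3 @ mid) @ [b])" using d4(2) by simp
      then have "coloured_path S f (us3 @ mid)" "(f (length (us3 @ mid) - 1), {last (us3 @ mid), b}) \<in> S"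
        using us3(4) by (subst (asm) coloured_path_append, simp)+
      then have "coloured_path S f ((us3 @ mid) @ R)"
        using Rpath m4(1) ends by (subst coloured_path_append) (simp add: k_def b_def)
      then show "coloured_path S f us5" by (simp add: us5_def)
      show "dom par4 \<subseteq> set us5" using d4(3) sub4 by blast
      show "extendable N 5 (2 * s) (agents 1) par4" by (rule d4(7))
      show "\<forall>w u c. par4 w = Some (u, c) \<longrightarrow> u \<in> set us5 \<and> w \<in> N (u, c)" using d4(4) sub4 by blast
      show "\<forall>w\<in>set us5 - dom par4. \<forall>a\<in>agents 1. w \<notin> N a"
        using d4(5) RV(2) by (auto simp: us5_def)
      have last5: "last us5 = last R" using ends by (simp add: us5_def)
      show "\<forall>c. card (children par4 (last us5) c) \<le> 1"
      proof
        fix c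
        show "card (children par4 (last us5) c) \<le> 1"
        proof (cases "last R = b")
          case True
          then show ?thesis using d4(6) last5 by simp
        next
          case False
          then have "last R \<notin> set (us3 @ mid @ [b])"
            using ends Rdisj m4(3) by (auto dest!: last_in_set)
          then have "children par4 (last us5) c = {}" using d4(4) last5 by auto
          then show ?thesis by (simp only: card.empty)
        qed
      qed
      show "lev (last us5) \<le> 1" using last5 ends levB' by auto
    qed
    obtain ys where ys: "set ys = B' - set R" "distinct ys"
      using finite_distinct_list[of "B' - set R"] fB by (auto simp: B'_def)
    have lys: "length ys \<le> 2 * s" using ys R(4) by (simp add: distinct_card[symmetric])
    then have lysL: "length ys * L \<le> 2 * (s * L)" using mult_le_mono1[of "length ys" "2 * s" L] by simp
    have len5: "length us5 \<le> 1 + s * L + L + L + 2 * card B"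
      using us3_len m4(1) R(5) B'B(2) unfolding us5_def length_append L_def by linarith
    have "\<exists>vs par' j'. walk_state f j' (us5 @ vs) par' \<and> 1 \<le> j' \<and> j' \<le> 1 \<and> set ys \<subseteq> set (us5 @ vs) \<and>
      set vs \<subseteq> set ys \<union> Z \<and> length vs \<le> length ys * (2 * l + 1)"
    proof (rule cover_list[OF st5])
      show "sorted_wrt (\<lambda>x y. lev y \<le> lev x) ys"
        by (rule sorted_wrt_mono_rel[of _ "\<lambda>x y. True"]) (use ys levB' in auto)
      show "length us5 + length ys * (2 * l + 1) + 4 * 2 ^ l \<le> Q"
        using lysL len5 room' unfolding L_def[symmetric] by linarith
    qed (use ys levB' B(1) f in \<open>auto simp: B'_def\<close>)
    then obtain vs par' where st6: "walk_state f 1 (us5 @ vs) par'" "set ys \<subseteq> set (us5 @ vs)"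
      "set vs \<subseteq> set ys \<union> Z" "length vs \<le> length ys * L" unfolding L_def by (metis le_antisym)
    have "B \<subseteq> set (us5 @ vs)" using st6(2) ys(1) by (auto simp: B'_def us5_def)
    moreover have "set (us5 @ vs) \<subseteq> B \<union> X \<union> Z \<union> {x0, x1}"
      using st6(3) ys(1) us3(1) m4(2) R(3) by (auto simp: us5_def B'_def)
    moreover have "length (us5 @ vs) + 4 * 2 ^ l \<le> Q"
      using st6(4) lysL len5 room' unfolding length_append by linarith
    ultimately show ?thesis using st6(1) us3(3,4)
      by (intro exI[of _ "us5 @ vs"] exI[of _ par']) (auto simp: us5_def)
  qed
  then obtain us6 par6 where st6: "walk_state f 1 us6 par6" "hd us6 = x0" "B \<subseteq> set us6"
    "set us6 \<subseteq> B \<union> X \<union> Z \<union> {x0, x1}" "length us6 + 4 * 2 ^ l \<le> Q" by blast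
  have x2: "x2 \<in> V" "x2 \<notin> set us6" "lev x2 \<le> 1" using x xB st6(4) by auto
  obtain mid par7 where m7: "set mid \<subseteq> Z" "walk_state f 1 (us6 @ mid @ [x2]) par7"
    by (rule connect[where F = "{}", OF st6(1) x2(1,2,3) order.refl x2(3) _ f st6(5)])
      (use x notN in auto)
  have "us6 \<noteq> []" using st6(1) by (simp add: walk_state_def)
  then show thesis
    using that[of "us6 @ mid @ [x2]"] m7 st6(2-4) by (auto simp: walk_state_def)
qed

end

section \<open>Rotations and boosters\<close>

definition path_edges :: "'v list \<Rightarrow> 'v set set" where
  "path_edges p = {{p ! i, p ! Suc i} | i. Suc i < length p}"

lemma path_edges_simps [simp]:
  "path_edges [] = {}" "path_edges [x] = {}"
  "path_edges (x # y # zs) = insert {x, y} (path_edges (y # zs))"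
proof -
  show "path_edges (x # y # zs) = insert {x, y} (path_edges (y # zs))"
  proof
    show "path_edges (x # y # zs) \<subseteq> insert {x, y} (path_edges (y # zs))"
    proof
      fix e assume "e \<in> path_edges (x # y # zs)"
      then obtain i where i: "e = {(x # y # zs) ! i, (x # y # zs) ! Suc i}" "Suc i < length (x # y # zs)"
        unfolding path_edges_def by blast
      then show "e \<in> insert {x, y} (path_edges (y # zs))"
        by (cases i) (auto simp: path_edges_def)
    qed
    show "insert {x, y} (path_edges (y # zs)) \<subseteq> path_edges (x # y # zs)"
    proof
      fix e assume "e \<in> insert {x, y} (path_edges (y # zs))"
      then consider "e = {x, y}" | i where "e = {(y # zs) ! i, (y # zs) ! Suc i}" "Suc i < length (y # zs)"
        unfolding path_edges_def by blast
      then show "e \<in> path_edges (x # y # zs)"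
      proof cases
        case 1
        then show ?thesis unfolding path_edges_def by (intro CollectI exI[of _ 0]) auto
      next
        case (2 i)
        then show ?thesis unfolding path_edges_def by (intro CollectI exI[of _ "Suc i"]) auto
      qed
    qed
  qed
qed (auto simp: path_edges_def)

lemma path_edges_append:
  "path_edges (xs @ x # ys) = path_edges (xs @ [x]) \<union> path_edges (x # ys)"
proof (induction xs)
  case (Cons a xs)
  then show ?case by (cases xs) auto
qed auto

lemma path_edges_Cons: "ys \<noteq> [] \<Longrightarrow> path_edges (x # ys) = insert {x, hd ys} (path_edges ys)"
  by (cases ys) auto

lemma path_edges_snoc: "xs \<noteq> [] \<Longrightarrow> path_edges (xs @ [y]) = insert {last xs, y} (path_edges xs)"
  by (induction xs) (auto simp: path_edges_Cons)

lemma path_edges_join: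
  assumes "xs \<noteq> []" "ys \<noteq> []"
  shows "path_edges (xs @ ys) = insert {last xs, hd ys} (path_edges xs \<union> path_edges ys)"
proof -
  obtain y ys' where "ys = y # ys'" using assms(2) by (cases ys) auto
  then show ?thesis using assms(1) path_edges_append[of xs y ys'] by (simp add: path_edges_snoc)
qed

lemma path_edges_rev: "path_edges (rev p) = path_edges p"
proof (induction p)
  case (Cons x p)
  then show ?case by (cases "p = []") (auto simp: path_edges_snoc path_edges_Cons last_rev insert_commute)
qed auto

lemma path_edges_subset: "e \<in> path_edges p \<Longrightarrow> e \<subseteq> set p"
  by (auto simp: path_edges_def)

text \<open>The virtual edge \<open>{a, b}\<close> stands for the rigid coloured path, which rotations must not break.\<close>

definition virtual_path :: "'v set set \<Rightarrow> 'v set \<Rightarrow> 'v \<Rightarrow> 'v \<Rightarrow> 'v list \<Rightarrow> bool" where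
  "virtual_path \<Gamma> W a b p \<longleftrightarrow> distinct p \<and> set p \<subseteq> W \<and>
     path_edges p \<subseteq> insert {a, b} \<Gamma> \<and> {a, b} \<in> path_edges p"

inductive rotation :: "'v set set \<Rightarrow> 'v set \<Rightarrow> 'v list \<Rightarrow> 'v list \<Rightarrow> bool"
  for \<Gamma> :: "'v set set" and f :: "'v set" and p :: "'v list" where
  base: "rotation \<Gamma> f p p"
| step: "rotation \<Gamma> f p (xs @ u # w # ys) \<Longrightarrow> {u, last (w # ys)} \<in> \<Gamma> \<Longrightarrow> {u, w} \<noteq> f \<Longrightarrow>
    rotation \<Gamma> f p (xs @ u # rev (w # ys))"

definition rot_ends :: "'v set set \<Rightarrow> 'v set \<Rightarrow> 'v list \<Rightarrow> 'v set" where
  "rot_ends \<Gamma> f p = {last q | q. rotation \<Gamma> f p q}"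

lemma rot_ends_step:
  assumes "rotation \<Gamma> f p (xs @ u # w # ys)" "{u, last (w # ys)} \<in> \<Gamma>" "{u, w} \<noteq> f"
  shows "w \<in> rot_ends \<Gamma> f p"
proof -
  have "last (xs @ u # rev (w # ys)) = w" by simp
  then show ?thesis using rotation.step[OF assms] unfolding rot_ends_def by (metis (mono_tags, lifting) mem_Collect_eq)
qed

lemma path_edges_rotate:
  "path_edges (xs @ u # rev (w # ys)) =
     path_edges (xs @ [u]) \<union> insert {u, last (w # ys)} (path_edges (w # ys))"
proof -
  have "path_edges (u # rev (w # ys)) = insert {u, last (w # ys)} (path_edges (w # ys))"
    by (subst path_edges_Cons) (auto simp: path_edges_rev hd_rev simp del: rev.simps)
  then show ?thesis by (subst path_edges_append) simp
qed

text \<open>A rotation destroys the single edge \<open>{u, w}\<close>, and \<open>w\<close> is the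
  new end. So every edge of \<open>p\<close> lost along the way contains an end, which is what
  Posa's argument needs.\<close>

lemma rotation_invariant:
  assumes "rotation \<Gamma> {a, b} p q" "virtual_path \<Gamma> W a b p" "p \<noteq> []"
  shows "virtual_path \<Gamma> W a b q \<and> set q = set p \<and> length q = length p \<and> hd q = hd p \<and>
     (\<forall>e\<in>path_edges p - path_edges q. e \<inter> rot_ends \<Gamma> {a, b} p \<noteq> {})"
  using assms(1)
proof induction
  case base
  then show ?case using assms by auto
next
  case (step xs u w ys)
  let ?q = "xs @ u # w # ys" and ?q' = "xs @ u # rev (w # ys)"
  have pe: "path_edges ?q = path_edges (xs @ [u]) \<union> insert {u, w} (path_edges (w # ys))"
    by (subst path_edges_append) simp
  note pe' = path_edges_rotate[of xs u w ys]
  have wE: "w \<in> rot_ends \<Gamma> {a, b} p"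
    using rot_ends_step[OF step.hyps] .
  have IH: "virtual_path \<Gamma> W a b ?q" "set ?q = set p" "length ?q = length p" "hd ?q = hd p"
    "\<And>e. e \<in> path_edges p \<Longrightarrow> e \<notin> path_edges ?q \<Longrightarrow> e \<inter> rot_ends \<Gamma> {a, b} p \<noteq> {}"
    using step.IH by blast+
  have "virtual_path \<Gamma> W a b ?q'"
    using IH(1) step.hyps(2,3) unfolding virtual_path_def pe pe' by auto
  moreover have "e \<inter> rot_ends \<Gamma> {a, b} p \<noteq> {}" if "e \<in> path_edges p - path_edges ?q'" for e
  proof (cases "e = {u, w}")
    case True
    then show ?thesis using wE by blast
  next
    case False
    then have "e \<notin> path_edges ?q" using that unfolding pe pe' by auto
    then show ?thesis using IH(5) that by blast
  qed
  moreover have "hd ?q' = hd p" using IH(4) by (cases xs) auto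
  moreover have "set ?q' = set p" "length ?q' = length p" using IH(2,3) by auto
  ultimately show ?case by blast
qed

lemma finite_path_edges_nbrs:
  assumes "distinct p"
  shows "card {y. \<exists>e\<in>E. {y, e} \<in> path_edges p} \<le> 2 * card (E \<inter> set p)"
    "finite {y. \<exists>e\<in>E. {y, e} \<in> path_edges p}"
proof -
  let ?I = "{i. i < length p \<and> p ! i \<in> E}"
  let ?Y = "{y. \<exists>e\<in>E. {y, e} \<in> path_edges p}"
  have sub: "?Y \<subseteq> (\<lambda>i. p ! (i - 1)) ` ?I \<union> (\<lambda>i. p ! Suc i) ` ?I"
  proof
    fix y assume "y \<in> ?Y"
    then obtain e i where e: "e \<in> E" "{y, e} = {p ! i, p ! Suc i}" "Suc i < length p"
      by (auto simp: path_edges_def)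
    then consider "y = p ! i" "e = p ! Suc i" | "y = p ! Suc i" "e = p ! i"
      by (auto simp: doubleton_eq_iff)
    then show "y \<in> (\<lambda>i. p ! (i - 1)) ` ?I \<union> (\<lambda>i. p ! Suc i) ` ?I"
    proof cases
      case 1
      then have "y = p ! (Suc i - 1)" "Suc i \<in> ?I" using e by auto
      then show ?thesis by blast
    next
      case 2
      then show ?thesis using e by auto
    qed
  qed
  have fI: "finite ?I" by simp
  have "card ?I = card ((!) p ` ?I)"
    using assms by (intro card_image[symmetric]) (auto simp: inj_on_def nth_eq_iff_index_eq)
  also have "(!) p ` ?I = E \<inter> set p" by (auto simp: in_set_conv_nth)
  finally have cI: "card ?I = card (E \<inter> set p)" .
  have "card ?Y \<le> card ((\<lambda>i. p ! (i - 1)) ` ?I \<union> (\<lambda>i. p ! Suc i) ` ?I)"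
    using sub fI by (intro card_mono) auto
  also have "\<dots> \<le> card ((\<lambda>i. p ! (i - 1)) ` ?I) + card ((\<lambda>i. p ! Suc i) ` ?I)" by (rule card_Un_le)
  also have "\<dots> \<le> card ?I + card ?I" by (intro add_mono card_image_le fI)
  finally show "card ?Y \<le> 2 * card (E \<inter> set p)" using cI by simp
  show "finite ?Y" using sub fI by (meson finite_UnI finite_imageI finite_subset)
qed

text \<open>Posa's lemma, with \<open>a\<close> and \<open>b\<close> as exceptions because the
  virtual edge may not be broken. The successor \<open>w\<close> of \<open>y\<close> on
  \<open>q\<close> becomes an end. If an edge of \<open>p\<close> at \<open>y\<close> is lost in
  \<open>q\<close>, it contains an end; otherwise the neighbours of \<open>y\<close> on
  \<open>p\<close> survive on \<open>q\<close>, and one of them is \<open>w\<close>.\<close>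

lemma rot_ends_nbrs:
  assumes p: "virtual_path \<Gamma> W a b p" "p \<noteq> []"
    and longest: "\<And>q. virtual_path \<Gamma> W a b q \<Longrightarrow> length q \<le> length p"
    and y: "y \<in> W" "y \<notin> rot_ends \<Gamma> {a, b} p" "e \<in> rot_ends \<Gamma> {a, b} p" "{y, e} \<in> \<Gamma>"
  shows "y \<in> {a, b} \<or> (\<exists>e\<in>rot_ends \<Gamma> {a, b} p. {y, e} \<in> path_edges p)"
proof -
  let ?E = "rot_ends \<Gamma> {a, b} p"
  obtain q where q: "rotation \<Gamma> {a, b} p q" "e = last q" using y by (auto simp: rot_ends_def)
  note inv = rotation_invariant[OF q(1) p]
  have broken: "\<forall>e\<in>path_edges p - path_edges q. e \<inter> ?E \<noteq> {}"
    and seq: "set q = set p" and hdq: "hd q = hd p" and qne: "q \<noteq> []" and lq: "length q = length p"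
    using inv p(2) by auto
  have vq: "virtual_path \<Gamma> W a b q" using inv by simp
  have "y \<in> set q"
  proof (rule ccontr)
    assume "y \<notin> set q"
    then have "virtual_path \<Gamma> W a b (q @ [y])"
      using vq y q(2) qne by (auto simp: virtual_path_def path_edges_snoc insert_commute)
    then show False using longest[of "q @ [y]"] lq by simp
  qed
  then obtain xs zs where xs: "q = xs @ y # zs" by (meson split_list)
  have "zs \<noteq> []" using xs q y(2,3) by auto
  then obtain w ys where ys: "q = xs @ y # w # ys" using xs by (cases zs) auto
  show ?thesis
  proof (cases "{y, w} = {a, b}")
    case True
    then show ?thesis by (auto simp: doubleton_eq_iff)
  next
    case False
    have wE: "w \<in> ?E"
      using q y ys False by (intro rot_ends_step[of \<Gamma> "{a, b}" p xs y w ys]) auto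
    have dq: "distinct q" "distinct p" using vq p by (auto simp: virtual_path_def)
    have qe: "path_edges q = path_edges (xs @ [y]) \<union> insert {y, w} (path_edges (w # ys))"
      unfolding ys by (subst path_edges_append) simp
    have nbr: "x = w \<or> (xs \<noteq> [] \<and> x = last xs)" if "{y, x} \<in> path_edges q" for x
    proof -
      have "{y, x} \<notin> path_edges (w # ys)" using dq(1) path_edges_subset[of "{y, x}" "w # ys"] unfolding ys by auto
      moreover have "{y, x} \<notin> path_edges xs" using dq(1) path_edges_subset[of "{y, x}" "xs"] unfolding ys by auto
      ultimately show ?thesis
        using that unfolding qe by (cases "xs = []") (auto simp: path_edges_snoc doubleton_eq_iff)
    qed
    show ?thesis
    proof (cases "\<exists>x. {y, x} \<in> path_edges p \<and> {y, x} \<notin> path_edges q")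
      case True
      then obtain x where x: "{y, x} \<in> path_edges p" "{y, x} \<notin> path_edges q" by blast
      then have "{y, x} \<inter> ?E \<noteq> {}" using broken by blast
      then have "x \<in> ?E" using y(2) by blast
      then show ?thesis using x by blast
    next
      case nobreak: False
      have "last p \<in> ?E" using rotation.base unfolding rot_ends_def by blast
      then have "y \<noteq> last p" using y(2) by blast
      moreover obtain xs' zs' where "p = xs' @ y # zs'" using \<open>y \<in> set q\<close> seq by (metis split_list)
      ultimately have "p = xs' @ y # zs'" "zs' \<noteq> []" by auto
      then obtain w' ys' where p': "p = xs' @ y # w' # ys'" by (cases zs') auto
      have pe: "path_edges p = path_edges (xs' @ [y]) \<union> insert {y, w'} (path_edges (w' # ys'))"
        unfolding p' by (subst path_edges_append) simp
      have 1: "{y, w'} \<in> path_edges q" using nobreak pe by auto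
      show ?thesis
      proof (cases "w' = w")
        case True
        then show ?thesis using wE pe by auto
      next
        case ne: False
        with nbr[OF 1] have w': "xs \<noteq> []" "w' = last xs" by auto
        \<comment> \<open>\<open>y\<close> is not the head of \<open>q\<close>, and rotations fix
          the head, so \<open>y\<close> also has a predecessor on \<open>p\<close>.\<close>
        have "xs' \<noteq> []"
        proof
          assume "xs' = []"
          then have "hd p = y" using p' by simp
          then have "hd q = y" using hdq by simp
          then show False using w' dq(1) unfolding ys by (cases xs) auto
        qed
        then have pred: "{y, last xs'} \<in> path_edges p"
          unfolding pe by (auto simp: path_edges_snoc insert_commute)
        then have "{y, last xs'} \<in> path_edges q" using nobreak by auto
        from nbr[OF this] have "last xs' = w \<or> last xs' = w'" using w' by auto
        moreover have "last xs' \<noteq> w'" using dq(2) \<open>xs' \<noteq> []\<close> last_in_set[of xs'] unfolding p' by auto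
        ultimately show ?thesis using wE pred by auto
      qed
    qed
  qed
qed

section \<open>Boosters: their number and their use\<close>

definition longest_path :: "'v set set \<Rightarrow> 'v set \<Rightarrow> 'v \<Rightarrow> 'v \<Rightarrow> 'v list \<Rightarrow> bool" where
  "longest_path \<Gamma> W a b p \<longleftrightarrow> virtual_path \<Gamma> W a b p \<and>
     (\<forall>q. virtual_path \<Gamma> W a b q \<longrightarrow> length q \<le> length p)"

definition boosters :: "'v set set \<Rightarrow> 'v set \<Rightarrow> 'v \<Rightarrow> 'v \<Rightarrow> 'v set set" where
  "boosters \<Gamma> W a b = {{hd p, last p} | p. longest_path \<Gamma> W a b p}"

text \<open>The bound \<open>2 * card S + 3\<close> exceeds by one what Posa's lemma admits:
  \<open>2 * card S\<close> path neighbours and the two ends of the virtual edge.\<close>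

definition expands :: "'v set set \<Rightarrow> 'v set \<Rightarrow> nat \<Rightarrow> bool" where
  "expands \<Gamma> W t \<longleftrightarrow> (\<forall>S\<subseteq>W. S \<noteq> {} \<longrightarrow> card S \<le> t \<longrightarrow>
     2 * card S + 3 \<le> card {y \<in> W - S. \<exists>x\<in>S. {y, x} \<in> \<Gamma>})"

lemma virtual_path_nonempty: "virtual_path \<Gamma> W a b p \<Longrightarrow> p \<noteq> []"
  by (auto simp: virtual_path_def)

lemma virtual_path_length_ge:
  assumes "virtual_path \<Gamma> W a b p"
  shows "length p \<ge> 2"
proof (rule ccontr)
  assume "\<not> ?thesis"
  then have "path_edges p = {}" by (auto simp: path_edges_def)
  then show False using assms by (simp add: virtual_path_def)
qed

lemma virtual_path_ends_neq:
  assumes "virtual_path \<Gamma> W a b p"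
  shows "hd p \<noteq> last p"
proof -
  obtain x y zs where "p = x # y # zs"
    using virtual_path_length_ge[OF assms] by (metis Suc_le_length_iff numeral_2_eq_2)
  moreover have "distinct p" using assms by (simp add: virtual_path_def)
  ultimately show ?thesis by auto
qed

lemma virtual_path_rev: "virtual_path \<Gamma> W a b (rev p) = virtual_path \<Gamma> W a b p"
  by (simp add: virtual_path_def path_edges_rev)

lemma longest_path_rotation:
  assumes "longest_path \<Gamma> W a b p" "rotation \<Gamma> {a, b} p q"
  shows "longest_path \<Gamma> W a b q" "hd q = hd p"
proof -
  have vp: "virtual_path \<Gamma> W a b p" using assms(1) by (simp add: longest_path_def)
  show "longest_path \<Gamma> W a b q" "hd q = hd p"
    using rotation_invariant[OF assms(2) vp virtual_path_nonempty[OF vp]] assms(1)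
    by (auto simp: longest_path_def)
qed

lemma rot_ends_large:
  assumes p: "longest_path \<Gamma> W a b p" and W: "finite W" and ex: "expands \<Gamma> W t"
  shows "t < card (rot_ends \<Gamma> {a, b} p)" "rot_ends \<Gamma> {a, b} p \<subseteq> W" "finite (rot_ends \<Gamma> {a, b} p)"
proof -
  let ?E = "rot_ends \<Gamma> {a, b} p"
  have vp: "virtual_path \<Gamma> W a b p" "p \<noteq> []" "\<And>q. virtual_path \<Gamma> W a b q \<Longrightarrow> length q \<le> length p"
    using p virtual_path_nonempty[of \<Gamma> W a b p] by (simp_all add: longest_path_def)
  have "last q \<in> W" if "rotation \<Gamma> {a, b} p q" for q
  proof -
    have "virtual_path \<Gamma> W a b q"
      using longest_path_rotation[OF p that] by (simp add: longest_path_def)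
    then have "last q \<in> set q" "set q \<subseteq> W" using virtual_path_nonempty[of \<Gamma> W a b q] by (auto simp: virtual_path_def)
    then show ?thesis by blast
  qed
  then show sub: "?E \<subseteq> W" by (auto simp: rot_ends_def)
  then show fin: "finite ?E" using W finite_subset by blast
  have ne: "?E \<noteq> {}" using rotation.base unfolding rot_ends_def by blast
  show "t < card ?E"
  proof (rule ccontr)
    assume "\<not> t < card ?E"
    then have "2 * card ?E + 3 \<le> card {y \<in> W - ?E. \<exists>x\<in>?E. {y, x} \<in> \<Gamma>}"
      using ex sub ne unfolding expands_def by (meson not_less)
    also have "\<dots> \<le> card ({a, b} \<union> {y. \<exists>e\<in>?E. {y, e} \<in> path_edges p})"
    proof (rule card_mono)
      show "{y \<in> W - ?E. \<exists>x\<in>?E. {y, x} \<in> \<Gamma>} \<subseteq> {a, b} \<union> {y. \<exists>e\<in>?E. {y, e} \<in> path_edges p}"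
        using rot_ends_nbrs[OF vp] by blast
      show "finite ({a, b} \<union> {y. \<exists>e\<in>?E. {y, e} \<in> path_edges p})"
        using finite_path_edges_nbrs(2)[of p ?E] vp(1) by (auto simp: virtual_path_def)
    qed
    also have "\<dots> \<le> card {a, b} + card {y. \<exists>e\<in>?E. {y, e} \<in> path_edges p}" by (rule card_Un_le)
    also have "card {a, b} \<le> 2" by (simp add: card_insert_if)
    also have "card {y. \<exists>e\<in>?E. {y, e} \<in> path_edges p} \<le> 2 * card (?E \<inter> set p)"
      using vp(1) by (intro finite_path_edges_nbrs(1)) (simp add: virtual_path_def)
    also have "card (?E \<inter> set p) \<le> card ?E" using fin by (intro card_mono) auto
    finally show False by simp
  qed
qed

lemma longest_path_exists:
  assumes "finite W" "a \<in> W" "b \<in> W" "a \<noteq> b"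
  obtains p where "longest_path \<Gamma> W a b p"
proof -
  have "virtual_path \<Gamma> W a b [a, b]" using assms by (auto simp: virtual_path_def)
  moreover have "\<forall>q. virtual_path \<Gamma> W a b q \<longrightarrow> length q < card W + 1"
  proof (intro allI impI)
    fix q assume "virtual_path \<Gamma> W a b q"
    then have "length q = card (set q)" "set q \<subseteq> W" by (auto simp: virtual_path_def distinct_card)
    then show "length q < card W + 1" using card_mono[OF assms(1), of "set q"] by simp
  qed
  ultimately obtain p where "virtual_path \<Gamma> W a b p" "\<forall>q. virtual_path \<Gamma> W a b q \<longrightarrow> length q \<le> length p"
    using ex_has_greatest_nat[of "virtual_path \<Gamma> W a b" "[a, b]" length "card W + 1"] by blast
  then show ?thesis using that by (auto simp: longest_path_def)
qed

lemma boosters_subset: "boosters \<Gamma> W a b \<subseteq> {e. e \<subseteq> W \<and> card e = 2}"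
proof
  fix e assume "e \<in> boosters \<Gamma> W a b"
  then obtain p where p: "e = {hd p, last p}" "virtual_path \<Gamma> W a b p"
    by (auto simp: boosters_def longest_path_def)
  then have "hd p \<in> W" "last p \<in> W" using virtual_path_nonempty[OF p(2)]
    by (auto simp: virtual_path_def subset_iff)
  then show "e \<in> {e. e \<subseteq> W \<and> card e = 2}" using p virtual_path_ends_neq[OF p(2)] by auto
qed

text \<open>For each of the more than \<open>t\<close> ends \<open>e\<close> of \<open>p\<close>
  there is a longest path starting in \<open>e\<close>, which in turn has more than \<open>t\<close>
  ends. Every ordered pair found in this way is a booster together with one of its two elements,
  whence the factor 2.\<close>

lemma boosters_card:
  assumes W: "finite W" "a \<in> W" "b \<in> W" "a \<noteq> b" and ex: "expands \<Gamma> W t"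
  shows "t * t \<le> 2 * card (boosters \<Gamma> W a b)"
proof -
  let ?B = "boosters \<Gamma> W a b"
  obtain p where p: "longest_path \<Gamma> W a b p" using longest_path_exists[OF W] .
  let ?E = "rot_ends \<Gamma> {a, b} p"
  have "\<exists>q. longest_path \<Gamma> W a b q \<and> hd q = e" if e: "e \<in> ?E" for e
  proof -
    obtain q where q: "rotation \<Gamma> {a, b} p q" "e = last q" using e unfolding rot_ends_def by blast
    then have "longest_path \<Gamma> W a b (rev q)"
      using longest_path_rotation(1)[OF p q(1)] by (simp add: longest_path_def virtual_path_rev)
    then show ?thesis using q
      by (intro exI[of _ "rev q"]) (auto simp: hd_rev longest_path_def)
  qed
  then obtain Q where Q: "\<And>e. e \<in> ?E \<Longrightarrow> longest_path \<Gamma> W a b (Q e) \<and> hd (Q e) = e" by metis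
  let ?P = "SIGMA e:?E. rot_ends \<Gamma> {a, b} (Q e)"
  have finE: "finite ?E" "\<And>e. e \<in> ?E \<Longrightarrow> finite (rot_ends \<Gamma> {a, b} (Q e))"
    using rot_ends_large[OF p W(1) ex] rot_ends_large[OF _ W(1) ex] Q by auto
  have finB: "finite ?B"
    by (rule finite_subset[of _ "Pow W"]) (use boosters_subset[of \<Gamma> W a b] W(1) in auto)
  have B2: "card e = 2" if "e \<in> ?B" for e using that boosters_subset[of \<Gamma> W a b] by auto
  have "t * t \<le> card ?E * t" using rot_ends_large(1)[OF p W(1) ex] by simp
  also have "\<dots> = (\<Sum>e\<in>?E. t)" by simp
  also have "\<dots> \<le> (\<Sum>e\<in>?E. card (rot_ends \<Gamma> {a, b} (Q e)))"
    using rot_ends_large(1)[OF _ W(1) ex] Q by (intro sum_mono less_imp_le) auto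
  also have "\<dots> = card ?P" using finE by simp
  also have "\<dots> \<le> card (SIGMA e:?B. e)"
  proof (rule card_inj_on_le)
    show "inj_on (\<lambda>(e, f). ({e, f}, e)) ?P" by (auto simp: inj_on_def doubleton_eq_iff)
    show "(\<lambda>(e, f). ({e, f}, e)) ` ?P \<subseteq> (SIGMA e:?B. e)"
    proof clarsimp
      fix e f assume e: "e \<in> ?E" and f: "f \<in> rot_ends \<Gamma> {a, b} (Q e)"
      then obtain q where q: "rotation \<Gamma> {a, b} (Q e) q" "f = last q" by (auto simp: rot_ends_def)
      have "longest_path \<Gamma> W a b q" "hd q = e"
        using longest_path_rotation[OF _ q(1), of W] Q[OF e] by auto
      then show "{e, f} \<in> ?B" using q(2) unfolding boosters_def by blast
    qed
    show "finite (SIGMA e:?B. e)"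
      using finB B2 by (intro finite_SigmaI) (auto intro: card_ge_0_finite)
  qed
  also have "\<dots> = (\<Sum>e\<in>?B. card e)" using finB B2 by (intro card_SigmaI) (auto intro: card_ge_0_finite)
  also have "\<dots> = 2 * card ?B" using B2 by simp
  finally show ?thesis .
qed

definition spanning_path :: "'v set set \<Rightarrow> 'v set \<Rightarrow> 'v \<Rightarrow> 'v \<Rightarrow> bool" where
  "spanning_path \<Gamma> W a b \<longleftrightarrow>
     (\<exists>p. distinct p \<and> set p = W \<and> p \<noteq> [] \<and> hd p = a \<and> last p = b \<and> path_edges p \<subseteq> \<Gamma>)"

lemma path_edges_split:
  assumes "e \<in> path_edges p"
  obtains xs x y ys where "p = xs @ x # y # ys" "e = {x, y}"
proof -
  obtain i where i: "e = {p ! i, p ! Suc i}" "Suc i < length p" using assms by (auto simp: path_edges_def)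
  have "p = take i p @ p ! i # p ! Suc i # drop (Suc (Suc i)) p"
    using i(2) by (metis Cons_nth_drop_Suc Suc_lessD append_take_drop_id)
  then show ?thesis using that i(1) by blast
qed

lemma edges_forget:
  "f \<notin> P \<Longrightarrow> d \<and> s \<and> P1 \<union> insert h P2 \<subseteq> insert f G \<and> m \<Longrightarrow> P \<subseteq> P1 \<union> P2 \<Longrightarrow> P \<subseteq> G"
  by auto

text \<open>Closing the path gives a cycle through the virtual edge; removing that edge leaves a
  spanning path of real edges with ends \<open>a\<close> and \<open>b\<close>.\<close>

lemma spanning_path_of_cycle:
  assumes p: "virtual_path \<Gamma> W a b p" "set p = W" "{hd p, last p} \<in> \<Gamma>" and ab: "a \<noteq> b"
  shows "spanning_path \<Gamma> W b a"
proof -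
  obtain xs x y ys where sp: "p = xs @ x # y # ys" "{a, b} = {x, y}"
    using p(1) path_edges_split[of "{a, b}" p] unfolding virtual_path_def by metis
  let ?q = "(y # ys) @ (xs @ [x])"
  have d: "distinct p" using p by (simp add: virtual_path_def)
  have pe: "path_edges p = path_edges (xs @ [x]) \<union> insert {x, y} (path_edges (y # ys))"
    unfolding sp by (subst path_edges_append) simp
  have "{a, b} \<notin> path_edges (y # ys)" "{a, b} \<notin> path_edges (xs @ [x])"
    using d path_edges_subset[of "{x, y}" "y # ys"] path_edges_subset[of "{x, y}" "xs @ [x]"]
    unfolding sp(2) unfolding sp(1) by auto
  then have "path_edges (y # ys) \<subseteq> \<Gamma>" "path_edges (xs @ [x]) \<subseteq> \<Gamma>"
    using edges_forget[OF _ p(1)[unfolded virtual_path_def pe]] by simp_all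
  moreover have "{last (y # ys), hd (xs @ [x])} \<in> \<Gamma>"
    using p(3) unfolding sp(1) by (cases xs) (simp_all add: insert_commute)
  moreover have "path_edges ?q = insert {last (y # ys), hd (xs @ [x])}
      (path_edges (y # ys) \<union> path_edges (xs @ [x]))"
    by (rule path_edges_join) simp_all
  ultimately have q: "path_edges ?q \<subseteq> \<Gamma>" by (simp only: insert_subset Un_subset_iff simp_thms)
  have q2: "distinct ?q" "set ?q = W" "?q \<noteq> []" "hd ?q = y" "last ?q = x"
    using d p(2) unfolding sp(1) by auto
  show ?thesis
  proof (cases "y = b")
    case True
    then have "x = a" using sp(2) ab by (auto simp: doubleton_eq_iff)
    then show ?thesis using q q2 True unfolding spanning_path_def by (intro exI[of _ ?q]) simp
  next
    case False
    then have "x = b" "y = a" using sp(2) ab by (auto simp: doubleton_eq_iff)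
    then show ?thesis
      using q q2 unfolding spanning_path_def
      by (intro exI[of _ "rev ?q"]) (simp add: path_edges_rev hd_rev last_rev del: rev_append rev.simps append_Cons)
  qed
qed

lemma edges_attach:
  "P \<subseteq> insert f G \<Longrightarrow> f \<in> P \<Longrightarrow> e \<in> G \<Longrightarrow>
    insert e P \<subseteq> insert f (insert g G) \<and> f \<in> insert e P"
  by auto

lemma edges_reopen:
  "P \<union> insert h Q \<subseteq> insert f G \<Longrightarrow> f \<in> P \<union> insert h Q \<Longrightarrow> h \<noteq> f \<Longrightarrow> c \<in> insert g G \<Longrightarrow>
    e \<in> G \<Longrightarrow> insert c (Q \<union> insert e P) \<subseteq> insert f (insert g G) \<and> f \<in> insert c (Q \<union> insert e P)"
  by auto

lemma edges_reopen_virtual: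
  "P \<union> insert h Q \<subseteq> insert f G \<Longrightarrow> h = f \<Longrightarrow> c \<in> insert g G \<Longrightarrow> e \<in> G \<Longrightarrow> P' \<subseteq> P \<Longrightarrow>
    insert e (insert h (insert c (Q \<union> P'))) \<subseteq> insert f (insert g G) \<and>
    f \<in> insert e (insert h (insert c (Q \<union> P')))"
  by auto

text \<open>The booster closes \<open>p\<close> to a cycle. If the cycle misses a vertex,
  connectivity attaches one at some \<open>x\<close>, and opening the cycle next to \<open>x\<close>
  gives a longer path. It is opened between \<open>x\<close> and its successor, unless that edge is
  virtual; then between \<open>x\<close> and its predecessor.\<close>

lemma booster_step:
  assumes p: "longest_path \<Gamma> W a b p" and ab: "a \<noteq> b"
    and conn: "\<And>S. S \<subseteq> W \<Longrightarrow> S \<noteq> {} \<Longrightarrow> S \<noteq> W \<Longrightarrow> \<exists>x\<in>S. \<exists>y\<in>W - S. {x, y} \<in> \<Gamma>"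
  shows "spanning_path (insert {hd p, last p} \<Gamma>) W b a \<or>
    (\<exists>q. virtual_path (insert {hd p, last p} \<Gamma>) W a b q \<and> length p < length q)"
proof -
  let ?G = "insert {hd p, last p} \<Gamma>"
  have vp: "virtual_path \<Gamma> W a b p" using p by (simp add: longest_path_def)
  then have vp': "virtual_path ?G W a b p" by (auto simp: virtual_path_def)
  have d: "distinct p" "set p \<subseteq> W" "path_edges p \<subseteq> insert {a, b} \<Gamma>" "{a, b} \<in> path_edges p"
    using vp by (auto simp: virtual_path_def)
  have ne: "p \<noteq> []" using vp by (rule virtual_path_nonempty)
  show ?thesis
  proof (cases "set p = W")
    case True
    then show ?thesis using spanning_path_of_cycle[OF vp' True _ ab] by blast
  next
    case False
    then obtain x y where xy: "x \<in> set p" "y \<in> W" "y \<notin> set p" "{x, y} \<in> \<Gamma>"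
      using conn[of "set p"] d ne by auto
    then obtain xs ys where sp: "p = xs @ x # ys" by (meson split_list)
    have "\<exists>q. virtual_path ?G W a b q \<and> length p < length q"
    proof (cases "ys = []")
      case True
      then have "path_edges (p @ [y]) = insert {x, y} (path_edges p)"
        using path_edges_snoc[OF ne, of y] sp True by simp
      then have "path_edges (p @ [y]) \<subseteq> insert {a, b} ?G" "{a, b} \<in> path_edges (p @ [y])"
        using edges_attach[OF d(3,4) xy(4)] by simp_all
      moreover have "distinct (p @ [y])" "set (p @ [y]) \<subseteq> W" using d xy by auto
      ultimately have "virtual_path ?G W a b (p @ [y])" unfolding virtual_path_def by blast
      then show ?thesis by (intro exI[of _ "p @ [y]"]) simp
    next
      case ysne: False
      have pe: "path_edges p = path_edges (xs @ [x]) \<union> insert {x, hd ys} (path_edges ys)"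
        unfolding sp using ysne by (subst path_edges_append) (simp add: path_edges_Cons)
      have cl: "{last ys, hd (xs @ [x])} \<in> ?G"
        using ysne unfolding sp by (cases xs) (simp_all add: insert_commute)
      show ?thesis
      proof (cases "{x, hd ys} = {a, b}")
        case False
        let ?q = "ys @ ((xs @ [x]) @ [y])"
        have "path_edges ((xs @ [x]) @ [y]) = insert {x, y} (path_edges (xs @ [x]))"
          by (rule trans[OF path_edges_snoc]) simp_all
        moreover have "hd ((xs @ [x]) @ [y]) = hd (xs @ [x])" by (cases xs) simp_all
        ultimately have eq: "path_edges ?q =
            insert {last ys, hd (xs @ [x])} (path_edges ys \<union> insert {x, y} (path_edges (xs @ [x])))"
          using ysne by (subst path_edges_join) simp_all
        have "path_edges ?q \<subseteq> insert {a, b} ?G" "{a, b} \<in> path_edges ?q"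
          using edges_reopen[OF d(3)[unfolded pe] d(4)[unfolded pe] False cl xy(4)] unfolding eq by simp_all
        moreover have "distinct ?q" "set ?q \<subseteq> W" using d(1,2) xy unfolding sp by auto
        ultimately have "virtual_path ?G W a b ?q" unfolding virtual_path_def by blast
        then show ?thesis by (intro exI[of _ ?q]) (simp add: sp)
      next
        case True
        let ?q = "y # x # ys @ xs"
        have "path_edges ?q \<subseteq> insert {a, b} ?G \<and> {a, b} \<in> path_edges ?q"
        proof (cases "xs = []")
          case True
          then have "path_edges ?q = insert {y, x} (path_edges p)" using sp by simp
          then have "path_edges ?q = insert {x, y} (path_edges p)" by (simp add: insert_commute)
          then show ?thesis using edges_attach[OF d(3,4) xy(4)] by simp
        next
          case xsne: False
          have eq: "path_edges ?q =
            insert {x, y} (insert {x, hd ys} (insert {last ys, hd xs} (path_edges ys \<union> path_edges xs)))"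
            using ysne xsne by (simp add: path_edges_Cons path_edges_join insert_commute)
          have "{last ys, hd xs} \<in> ?G" using cl xsne by simp
          moreover have "path_edges xs \<subseteq> path_edges (xs @ [x])"
            using xsne by (auto simp: path_edges_snoc)
          ultimately show ?thesis
            using edges_reopen_virtual[OF d(3)[unfolded pe] True _ xy(4)] unfolding eq by simp
        qed
        moreover have "distinct ?q" "set ?q \<subseteq> W" using d(1,2) xy unfolding sp by auto
        ultimately have "virtual_path ?G W a b ?q" unfolding virtual_path_def by blast
        then show ?thesis by (intro exI[of _ ?q]) (simp add: sp)
      qed
    qed
    then show ?thesis by blast
  qed
qed

lemma expands_mono: "expands \<Gamma> W t \<Longrightarrow> finite W \<Longrightarrow> \<Gamma> \<subseteq> \<Gamma>' \<Longrightarrow> expands \<Gamma>' W t"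
  unfolding expands_def
proof (intro allI impI)
  fix S assume *: "\<forall>S\<subseteq>W. S \<noteq> {} \<longrightarrow> card S \<le> t \<longrightarrow> 2 * card S + 3 \<le> card {y \<in> W - S. \<exists>x\<in>S. {y, x} \<in> \<Gamma>}"
    and S: "S \<subseteq> W" "S \<noteq> {}" "card S \<le> t" and fin: "finite W" and sub: "\<Gamma> \<subseteq> \<Gamma>'"
  have "card {y \<in> W - S. \<exists>x\<in>S. {y, x} \<in> \<Gamma>} \<le> card {y \<in> W - S. \<exists>x\<in>S. {y, x} \<in> \<Gamma>'}"
    using fin sub by (intro card_mono) auto
  then show "2 * card S + 3 \<le> card {y \<in> W - S. \<exists>x\<in>S. {y, x} \<in> \<Gamma>'}"
    using * S by (meson le_trans)
qed

text \<open>Each booster lengthens the longest path, so at most \<open>card W\<close> of them are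
  used. The hypothesis \<open>hit\<close> speaks of all small sets \<open>A\<close> rather than of
  one sequence of choices, so that a union bound over \<open>A\<close> can supply it.\<close>

theorem spanning_path_of_boosters:
  assumes W: "finite W" "a \<in> W" "b \<in> W" "a \<noteq> b" and ex: "expands \<Gamma> W t"
    and conn: "\<And>S. S \<subseteq> W \<Longrightarrow> S \<noteq> {} \<Longrightarrow> S \<noteq> W \<Longrightarrow> \<exists>x\<in>S. \<exists>y\<in>W - S. {x, y} \<in> \<Gamma>"
    and hit: "\<And>A. A \<subseteq> \<Delta> \<Longrightarrow> finite A \<Longrightarrow> card A \<le> card W \<Longrightarrow>
      t * t \<le> 2 * card (boosters (\<Gamma> \<union> A) W a b) \<Longrightarrow> \<Delta> \<inter> boosters (\<Gamma> \<union> A) W a b \<noteq> {}"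
  shows "spanning_path (\<Gamma> \<union> \<Delta>) W b a"
proof (rule ccontr)
  assume no: "\<not> ?thesis"
  have mono: "spanning_path (\<Gamma> \<union> \<Delta>) W b a" if "spanning_path (\<Gamma> \<union> A) W b a" "A \<subseteq> \<Delta>" for A
    using that unfolding spanning_path_def by blast
  \<comment> \<open>After \<open>k\<close> boosters the path has at least \<open>k + 2\<close>
    vertices, starting from the virtual edge alone; for \<open>k = card W\<close> this is
    absurd.\<close>
  have "\<exists>A. A \<subseteq> \<Delta> \<and> finite A \<and> card A \<le> k \<and> (\<exists>q. virtual_path (\<Gamma> \<union> A) W a b q \<and> k + 2 \<le> length q)"
    if "k \<le> card W" for k
    using that
  proof (induction k)
    case 0
    have "virtual_path (\<Gamma> \<union> {}) W a b [a, b]" using W by (auto simp: virtual_path_def)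
    then show ?case by (intro exI[of _ "{}"] conjI exI[of _ "[a, b]"]) auto
  next
    case (Suc k)
    then obtain A q where A: "A \<subseteq> \<Delta>" "finite A" "card A \<le> k"
      "virtual_path (\<Gamma> \<union> A) W a b q" "k + 2 \<le> length q" by auto
    have ex': "expands (\<Gamma> \<union> A) W t" using ex W(1) by (rule expands_mono) simp
    have "\<Delta> \<inter> boosters (\<Gamma> \<union> A) W a b \<noteq> {}"
      using A Suc.prems by (intro hit boosters_card[OF W ex']) auto
    then obtain p where p: "longest_path (\<Gamma> \<union> A) W a b p" "{hd p, last p} \<in> \<Delta>"
      by (auto simp: boosters_def)
    let ?A = "insert {hd p, last p} A"
    have A': "?A \<subseteq> \<Delta>" "finite ?A" "card ?A \<le> Suc k" "\<Gamma> \<union> ?A = insert {hd p, last p} (\<Gamma> \<union> A)"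
      using A p by (auto simp: card_insert_if)
    have "\<exists>x\<in>S. \<exists>y\<in>W - S. {x, y} \<in> \<Gamma> \<union> A" if "S \<subseteq> W" "S \<noteq> {}" "S \<noteq> W" for S
      using conn[OF that] by blast
    then have "spanning_path (\<Gamma> \<union> ?A) W b a \<or>
        (\<exists>q'. virtual_path (\<Gamma> \<union> ?A) W a b q' \<and> length p < length q')"
      unfolding A'(4) by (rule booster_step[OF p(1) W(4)])
    moreover have "\<not> spanning_path (\<Gamma> \<union> ?A) W b a" using no mono[of ?A] A'(1) by blast
    ultimately obtain q' where q': "virtual_path (\<Gamma> \<union> ?A) W a b q'" "length p < length q'" by blast
    moreover have "length q \<le> length p" using A p by (simp add: longest_path_def)
    ultimately show ?case using A' A(5) by (intro exI[of _ ?A] conjI exI[of _ q']) auto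
  qed
  from this[of "card W"] obtain A q where q: "virtual_path (\<Gamma> \<union> A) W a b q" "card W + 2 \<le> length q" by auto
  then have "length q = card (set q)" "set q \<subseteq> W" by (auto simp: virtual_path_def distinct_card)
  then show False using card_mono[OF W(1), of "set q"] q(2) by simp
qed

section \<open>From pseudorandomness to a rigid path with an expanding remainder\<close>

text \<open>All of \<open>B\<close> must have positive rank, so that agents of rank at most 1 never
  use it. The agents with too few neighbours outside \<open>B\<close> are collected in a set
  \<open>W\<close> of fewer than \<open>s\<close> agents; their vertices get rank at least 2 by
  means of \<open>rank_blocked\<close>, and the rest of \<open>B\<close> gets rank 1. The surplus of
  7 over 5 is what \<open>rank_blocked\<close> consumes.\<close>

lemma rank_exists:
  fixes N :: "'v \<times> 'c \<Rightarrow> 'v set"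
  assumes fin: "finite A" "\<And>a. a \<in> A \<Longrightarrow> finite (N a)" "finite B"
    and ex: "\<And>U. U \<subseteq> A \<Longrightarrow> card U \<le> 2 * s \<Longrightarrow> 7 * card U \<le> card (\<Union>a\<in>U. N a)"
    and big: "\<And>U. U \<subseteq> A \<Longrightarrow> s \<le> card U \<Longrightarrow> card U \<le> 2 * s \<Longrightarrow>
      12 * s + card B < card (\<Union>a\<in>U. N a)"
    and s: "1 \<le> s"
  obtains lev :: "'v \<Rightarrow> nat" where "\<forall>u\<in>B. 1 \<le> lev u" "finite {u. 1 \<le> lev u}"
    "card {u. 1 \<le> lev u} \<le> card B + s" "card {u. 2 \<le> lev u} \<le> s"
    "\<forall>U\<subseteq>A. card U \<le> 2 * s \<longrightarrow>
       5 * card U \<le> card (\<Union>a\<in>U. {y \<in> N a. lev y = 0 \<or> lev y < lev (fst a)})"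
proof -
  have fA: "finite U" if "U \<subseteq> A" for U using that fin(1) finite_subset by blast
  have fN: "finite (\<Union>a\<in>U. N a)" if "U \<subseteq> A" for U using that fA fin(2) by blast
  define bad where "bad U \<longleftrightarrow> U \<subseteq> A \<and> card U \<le> 2 * s \<and>
    card ((\<Union>a\<in>U. N a) - (B \<union> fst ` U)) \<le> 5 * card U" for U
  have "bad {}" by (simp add: bad_def)
  moreover have "\<forall>U. bad U \<longrightarrow> card U < 2 * s + 1" by (auto simp: bad_def)
  ultimately obtain W where W: "bad W" "\<And>U. bad U \<Longrightarrow> card U \<le> card W"
    using ex_has_greatest_nat[of bad "{}" card "2 * s + 1"] by blast
  have WA: "W \<subseteq> A" using W by (simp add: bad_def)
  let ?T = "B \<union> fst ` W"
  \<comment> \<open>A bad set of at most \<open>2 * s\<close> agents sees at most 10 s vertices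
    outside \<open>?T\<close>, \<open>card B\<close> vertices of \<open>B\<close> and 2 s vertices
    of its own agents; this is the bound in \<open>big\<close>.\<close>
  have small: "card W < s"
  proof (rule ccontr)
    assume "\<not> card W < s"
    then have "12 * s + card B < card (\<Union>a\<in>W. N a)" using W big[of W] by (simp add: bad_def)
    also have "\<dots> \<le> card (((\<Union>a\<in>W. N a) - ?T) \<union> ?T)"
      using fN[OF WA] fA[OF WA] fin by (intro card_mono) auto
    also have "\<dots> \<le> card ((\<Union>a\<in>W. N a) - ?T) + card ?T" by (rule card_Un_le)
    also have "card ?T \<le> card B + card (fst ` W)" by (rule card_Un_le)
    also have "card (fst ` W) \<le> card W" using fA[OF WA] by (rule card_image_le)
    finally show False using W(1) by (simp add: bad_def)
  qed
  have "\<exists>lev :: 'v \<Rightarrow> nat. (\<forall>u. 0 < lev u \<longleftrightarrow> u \<in> fst ` W) \<and>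
     (\<forall>U\<subseteq>W. 5 * card U \<le> card (\<Union>a\<in>U. {y \<in> N a. lev y < lev (fst a)}))"
  proof (rule rank_blocked[OF fA[OF WA]])
    show "finite (N a)" if "a \<in> W" for a using that WA fin(2) by blast
    show "(5 + 2) * card U \<le> card (\<Union>a\<in>U. N a)" if "U \<subseteq> W" for U
      using ex[of U] that WA small card_mono[OF fA[OF WA] that] by simp
  qed
  then obtain lev' :: "'v \<Rightarrow> nat" where lev': "\<And>u. 0 < lev' u \<longleftrightarrow> u \<in> fst ` W"
     "\<And>U. U \<subseteq> W \<Longrightarrow> 5 * card U \<le> card (\<Union>a\<in>U. {y \<in> N a. lev' y < lev' (fst a)})" by blast
  define lev where "lev u = (if u \<in> ?T then Suc (lev' u) else 0)" for u
  have lev1: "{u. 1 \<le> lev u} = ?T" by (auto simp: lev_def)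
  have lev2: "{u. 2 \<le> lev u} = fst ` W" using lev'(1) by (auto simp: lev_def Suc_le_eq numeral_2_eq_2)
  have cT: "card ?T \<le> card B + card W"
    using card_Un_le[of B "fst ` W"] card_image_le[OF fA[OF WA], of fst] by linarith
  have main: "5 * card U \<le> card (\<Union>a\<in>U. {y \<in> N a. lev y = 0 \<or> lev y < lev (fst a)})" (is "_ \<le> card ?K")
    if U: "U \<subseteq> A" "card U \<le> 2 * s" for U
  proof (cases "s \<le> card U")
    case True
    have "card (\<Union>a\<in>U. N a) \<le> card (?K \<union> ?T)"
      using fN[OF U(1)] fA[OF WA] fin
      by (intro card_mono) (auto simp: lev_def intro: finite_subset[OF _ fN[OF U(1)]])
    also have "\<dots> \<le> card ?K + card ?T" by (rule card_Un_le)
    finally show ?thesis using big[OF U(1) True U(2)] cT small U(2) by linarith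
  next
    case False
    define U1 where "U1 = U - W"
    define U2 where "U2 = U \<inter> W"
    have UU: "U1 \<subseteq> A" "U2 \<subseteq> A" "U1 \<inter> U2 = {}" "U = U1 \<union> U2" "U1 \<inter> W = {}" "U2 \<subseteq> W"
      using U by (auto simp: U1_def U2_def)
    let ?K1 = "(\<Union>a\<in>U1. N a) - ?T - (\<Union>a\<in>W. N a)"
    let ?K2 = "\<Union>a\<in>U2. {y \<in> N a. lev' y < lev' (fst a)}"
    have k1: "5 * card U1 \<le> card ?K1"
    proof (rule ccontr)
      assume *: "\<not> ?thesis"
      have c: "card (W \<union> U1) = card W + card U1"
        using UU fA[OF WA] fA[OF UU(1)] by (simp add: card_Un_disjoint Int_commute)
      have "card U1 \<le> card U" using UU fA[OF U(1)] by (intro card_mono) auto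
      then have c2: "card (W \<union> U1) \<le> 2 * s" using c small False by linarith
      have "card ((\<Union>a\<in>W \<union> U1. N a) - (B \<union> fst ` (W \<union> U1))) \<le> card (((\<Union>a\<in>W. N a) - ?T) \<union> ?K1)"
        using fN[OF WA] fN[OF UU(1)] by (intro card_mono) auto
      also have "\<dots> \<le> card ((\<Union>a\<in>W. N a) - ?T) + card ?K1" by (rule card_Un_le)
      also have "\<dots> \<le> 5 * card W + 5 * card U1" using * W(1) by (simp add: bad_def)
      finally have "bad (W \<union> U1)" using WA UU c c2 by (simp add: bad_def)
      then have "card (W \<union> U1) \<le> card W" by (rule W)
      then show False using c * by simp
    qed
    have k2: "5 * card U2 \<le> card ?K2" using lev'(2) UU by blast
    have fK: "finite ?K1" "finite ?K2"
      using fN UU by (auto intro: finite_subset[OF _ fN[OF UU(2)]])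
    have "?K1 \<inter> ?K2 = {}" using UU by auto
    then have "card (?K1 \<union> ?K2) = card ?K1 + card ?K2" using fK by (simp add: card_Un_disjoint)
    moreover have "card U = card U1 + card U2"
      using UU fA by (simp add: card_Un_disjoint)
    moreover have "?K1 \<union> ?K2 \<subseteq> ?K"
    proof (intro Un_least subsetI)
      fix y assume "y \<in> ?K1"
      then obtain a where a: "a \<in> U1" "y \<in> N a" "y \<notin> ?T" by blast
      then have "lev y = 0" by (simp add: lev_def)
      then show "y \<in> ?K" using a UU by blast
    next
      fix y assume "y \<in> ?K2"
      then obtain a where a: "a \<in> U2" "y \<in> N a" "lev' y < lev' (fst a)" by blast
      then have "lev y < lev (fst a)" using UU by (auto simp: lev_def)
      then show "y \<in> ?K" using a UU by blast
    qed
    then have "card (?K1 \<union> ?K2) \<le> card ?K"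
      using fN[OF U(1)] by (intro card_mono) (auto intro: finite_subset[OF _ fN[OF U(1)]])
    ultimately show ?thesis using k1 k2 by linarith
  qed
  show thesis
  proof (rule that[of lev])
    show "\<forall>u\<in>B. 1 \<le> lev u" using lev1 by blast
    show "finite {u. 1 \<le> lev u}" unfolding lev1 using fin fA[OF WA] by simp
    show "card {u. 1 \<le> lev u} \<le> card B + s" unfolding lev1 using cT small by linarith
    have "card (fst ` W) \<le> card W" using fA[OF WA] by (rule card_image_le)
    then show "card {u. 2 \<le> lev u} \<le> s" unfolding lev2 using small by linarith
  qed (use main in blast)
qed

definition graph_joined :: "'v set set \<Rightarrow> 'v set \<Rightarrow> nat \<Rightarrow> bool" where
  "graph_joined \<Gamma> V t \<longleftrightarrow> (\<forall>P Q. P \<subseteq> V \<longrightarrow> Q \<subseteq> V \<longrightarrow> P \<inter> Q = {} \<longrightarrow> card P = t \<longrightarrow> card Q = t \<longrightarrow>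
     (\<exists>x\<in>P. \<exists>y\<in>Q. {y, x} \<in> \<Gamma>))"

lemma graph_joinedD:
  assumes "graph_joined \<Gamma> V t" "finite V" "P \<subseteq> V" "Q \<subseteq> V" "P \<inter> Q = {}" "t \<le> card P" "t \<le> card Q"
  shows "\<exists>x\<in>P. \<exists>y\<in>Q. {y, x} \<in> \<Gamma>"
proof -
  obtain P' where P': "P' \<subseteq> P" "card P' = t" using obtain_subset_with_card_n[OF assms(6)] by metis
  obtain Q' where Q': "Q' \<subseteq> Q" "card Q' = t" using obtain_subset_with_card_n[OF assms(7)] by metis
  have "P' \<subseteq> V" "Q' \<subseteq> V" "P' \<inter> Q' = {}" using P'(1) Q'(1) assms(3-5) by auto
  then have "\<exists>x\<in>P'. \<exists>y\<in>Q'. {y, x} \<in> \<Gamma>"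
    using assms(1) P'(2) Q'(2) unfolding graph_joined_def by simp
  then show ?thesis using P'(1) Q'(1) by blast
qed

text \<open>A maximal non-expanding set \<open>B\<close> is small, because joinedness forbids a set
  of \<open>t\<close> vertices to miss most of \<open>Y\<close>; and a non-expanding set outside
  \<open>B\<close> could be added to it. Expansion is measured in \<open>Y\<close> alone, the part
  which the rigid path will leave almost untouched, whereas \<open>X\<close> and \<open>Z\<close>
  may lose many vertices.\<close>

lemma nonexpanding_core:
  assumes j: "graph_joined \<Gamma> V t" and V: "finite V" "Y \<subseteq> V" "20 * t \<le> card Y" and t: "1 \<le> t"
  obtains B where "B \<subseteq> V" "card B < t"
    "\<forall>S\<subseteq>V - B. S \<noteq> {} \<longrightarrow> card S \<le> t \<longrightarrow>
       6 * card S < card {y \<in> Y - B - S. \<exists>x\<in>S. {y, x} \<in> \<Gamma>}"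
proof -
  define nb where "nb S = {y \<in> Y. \<exists>x\<in>S. {y, x} \<in> \<Gamma>}" for S
  have fnb: "finite (nb S)" for S
    by (rule finite_subset[OF _ finite_subset[OF V(2,1)]]) (auto simp: nb_def)
  \<comment> \<open>The cap \<open>2 * t\<close> leaves room to add a set of size \<open>t\<close>
    once \<open>card B < t\<close> is known.\<close>
  define bad where "bad B \<longleftrightarrow> B \<subseteq> V \<and> card B \<le> 2 * t \<and> card (nb B - B) \<le> 6 * card B" for B
  have "bad {}" by (simp add: bad_def nb_def)
  moreover have "\<forall>U. bad U \<longrightarrow> card U < 2 * t + 1" by (auto simp: bad_def)
  ultimately obtain B where B: "bad B" "\<And>U. bad U \<Longrightarrow> card U \<le> card B"
    using ex_has_greatest_nat[of bad "{}" card "2 * t + 1"] by blast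
  have BV: "B \<subseteq> V" "finite B" using B V finite_subset by (auto simp: bad_def)
  have Bt: "card B < t"
  proof (rule ccontr)
    assume big: "\<not> card B < t"
    let ?Q = "Y - (nb B \<union> B)"
    have "card Y \<le> card (?Q \<union> ((nb B - B) \<union> B))"
      using V BV fnb finite_subset[OF V(2,1)] by (intro card_mono) auto
    also have "\<dots> \<le> card ?Q + (card (nb B - B) + card B)"
      by (meson add_left_mono card_Un_le le_trans)
    finally have "t \<le> card ?Q" using B(1) V(3) by (simp add: bad_def)
    then have "\<exists>x\<in>B. \<exists>y\<in>?Q. {y, x} \<in> \<Gamma>"
      using big BV V by (intro graph_joinedD[OF j]) auto
    then show False by (auto simp: nb_def)
  qed
  have "6 * card S < card {y \<in> Y - B - S. \<exists>x\<in>S. {y, x} \<in> \<Gamma>}"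
    if S: "S \<subseteq> V - B" "S \<noteq> {}" "card S \<le> t" for S
  proof (rule ccontr)
    assume *: "\<not> ?thesis"
    have fS: "finite S" using S V finite_subset by blast
    have c: "card (B \<union> S) = card B + card S" using S BV fS by (intro card_Un_disjoint) auto
    let ?K = "{y \<in> Y - B - S. \<exists>x\<in>S. {y, x} \<in> \<Gamma>}"
    have "finite ?K" using V finite_subset[OF V(2,1)] by auto
    then have "card (nb (B \<union> S) - (B \<union> S)) \<le> card ((nb B - B) \<union> ?K)"
      using fnb by (intro card_mono) (auto simp: nb_def)
    also have "\<dots> \<le> card (nb B - B) + card ?K" by (rule card_Un_le)
    also have "\<dots> \<le> 6 * card (B \<union> S)" using * B(1) c by (simp add: bad_def)
    finally have "bad (B \<union> S)" using BV S c Bt by (auto simp: bad_def)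
    then have "card (B \<union> S) \<le> card B" by (rule B)
    then show False using c S fS by simp
  qed
  then show thesis using that BV Bt by blast
qed

text \<open>The rigid path takes the positions from 0 on, where its colours were prescribed. The
  spanning path leads back from \<open>b\<close> to \<open>a\<close> by joker edges, which fit every
  position.\<close>

lemma cycle_of_paths:
  assumes us: "distinct us" "us \<noteq> []" "hd us = a" "last us = b" "a \<noteq> b" "coloured_path S f us"
    and us_V: "set us \<subseteq> V" and span: "spanning_path \<Gamma> (V - set us \<union> {a, b}) b a"
  obtains vs where "distinct vs" "set vs = V"
    "\<And>i. i < length vs \<Longrightarrow> {vs ! i, vs ! (Suc i mod length vs)} \<in> \<Gamma> \<or>
       (f i, {vs ! i, vs ! (Suc i mod length vs)}) \<in> S"
proof -
  obtain p where p: "distinct p" "set p = V - set us \<union> {a, b}" "p \<noteq> []" "hd p = b" "last p = a"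
    "path_edges p \<subseteq> \<Gamma>" using span unfolding spanning_path_def by blast
  obtain p1 where p1: "p = b # p1" using p(3,4) by (cases p) auto
  have "p1 \<noteq> []" using p1 p(5) us(5) by auto
  then obtain p2 where p2: "p = b # p2 @ [a]" using p(5) p1 by (cases p1 rule: rev_cases) auto
  define vs where "vs = us @ p2"
  have ab: "a \<in> set us" "b \<in> set us" using us by auto
  have setp2: "set p2 = V - set us"
  proof -
    have "set p2 = set p - {a, b}" using p(1) us(5) unfolding p2 by auto
    then show ?thesis using p(2) ab by blast
  qed
  have "distinct p2" using p(1) unfolding p2 by simp
  then have "distinct vs" "set vs = V" using us(1) us_V setp2 by (auto simp: vs_def)
  moreover have "{vs ! i, vs ! (Suc i mod length vs)} \<in> \<Gamma> \<or>
       (f i, {vs ! i, vs ! (Suc i mod length vs)}) \<in> S" if i: "i < length vs" for i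
  proof -
    \<comment> \<open>Repeating \<open>a\<close> at the end turns the cyclic successor into the
      ordinary one.\<close>
    let ?q = "vs @ [a]"
    have vs0: "vs ! 0 = a" using us(2,3) by (simp add: vs_def nth_append hd_conv_nth)
    have q1: "vs ! (Suc i mod length vs) = ?q ! Suc i"
    proof (cases "Suc i = length vs")
      case True
      then show ?thesis using vs0 by (simp add: nth_append)
    next
      case False
      then have "Suc i < length vs" using i by simp
      then show ?thesis by (simp add: nth_append)
    qed
    have q0: "vs ! i = ?q ! i" using i by (simp add: nth_append)
    show ?thesis
    proof (cases "Suc i < length us")
      case True
      then have "?q ! i = us ! i" "?q ! Suc i = us ! Suc i" by (auto simp: vs_def nth_append)
      then show ?thesis using True us(6) q0 q1 by (simp add: coloured_path_def)
    next
      case False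
      define k where "k = Suc i - length us"
      have us': "us = butlast us @ [b]" using us(2,4) by (metis append_butlast_last_id)
      have "?q = butlast us @ [b] @ p2 @ [a]"
        unfolding vs_def by (subst us') simp
      then have q: "?q = butlast us @ p" by (simp add: p2)
      have "1 \<le> length us" using us(2) by (cases us) auto
      then have ik: "i = length (butlast us) + k" "Suc k < length p"
        using False i unfolding k_def vs_def p2 by auto
      have "?q ! i = p ! k" "?q ! Suc i = p ! Suc k" unfolding q ik(1) by (auto simp: nth_append)
      moreover have "{p ! k, p ! Suc k} \<in> path_edges p" using ik(2) by (auto simp: path_edges_def)
      ultimately show ?thesis using p(6) q0 q1 by auto
    qed
  qed
  ultimately show thesis by (rule that)
qed

section \<open>Pseudorandomness of coloured edges\<close>

definition coloured_nbrs :: "('c \<times> 'v set) set \<Rightarrow> 'v \<times> 'c \<Rightarrow> 'v set" where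
  "coloured_nbrs S a = {y. (snd a, {fst a, y}) \<in> S}"

definition coloured_expansion :: "('c \<times> 'v set) set \<Rightarrow> 'v set \<Rightarrow> 'c set \<Rightarrow> 'v set \<Rightarrow> nat \<Rightarrow> bool" where
  "coloured_expansion S V C Z s \<longleftrightarrow> (\<forall>U. U \<subseteq> V \<times> C \<longrightarrow> card U \<le> 2 * s \<longrightarrow>
     7 * card U \<le> card ((\<Union>a\<in>U. coloured_nbrs S a) \<inter> Z))"

text \<open>Only the side \<open>U\<close> carries colours, and a vertex may occur there with
  several. A union bound pays (n^2)^s for \<open>U\<close>, which is exp(O(n)) for \<open>s\<close>
  of order n / ln n, and at most 2^n for the plain vertex set \<open>T\<close>.\<close>

definition coloured_joined :: "('c \<times> 'v set) set \<Rightarrow> 'v set \<Rightarrow> 'c set \<Rightarrow> nat \<Rightarrow> nat \<Rightarrow> bool" where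
  "coloured_joined S V C s t \<longleftrightarrow> (\<forall>U T. U \<subseteq> V \<times> C \<longrightarrow> T \<subseteq> V \<longrightarrow> fst ` U \<inter> T = {} \<longrightarrow>
     card U = s \<longrightarrow> card T = t \<longrightarrow> (\<exists>a\<in>U. \<exists>y\<in>T. y \<in> coloured_nbrs S a))"

text \<open>Both colours of a hop are functions of its first vertex, since the search prescribes
  them by position. The two steps use different sets \<open>S\<close> and \<open>S'\<close>, so that
  the second can be exposed before the first.\<close>

definition two_step_joined ::
    "('c \<times> 'v set) set \<Rightarrow> ('c \<times> 'v set) set \<Rightarrow> 'v set \<Rightarrow> 'c set \<Rightarrow> nat \<Rightarrow> nat \<Rightarrow> bool" where
  "two_step_joined S S' V C s r \<longleftrightarrow> (\<forall>D U T g g'. D \<subseteq> V \<longrightarrow> U \<subseteq> V \<longrightarrow> T \<subseteq> V \<longrightarrow>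
     D \<inter> U = {} \<longrightarrow> D \<inter> T = {} \<longrightarrow> U \<inter> T = {} \<longrightarrow> card D = s \<longrightarrow> card U = s \<longrightarrow> card T = r \<longrightarrow>
     (\<forall>v. g v \<in> C \<and> g' v \<in> C) \<longrightarrow>
     (\<exists>v\<in>D. \<exists>z\<in>T. \<exists>w\<in>U. (g v, {v, z}) \<in> S \<and> (g' v, {z, w}) \<in> S'))"

lemma coloured_joinedD:
  assumes "coloured_joined S V C s t" "U \<subseteq> V \<times> C" "T \<subseteq> V" "fst ` U \<inter> T = {}" "s \<le> card U" "t \<le> card T"
  shows "\<exists>a\<in>U. \<exists>y\<in>T. y \<in> coloured_nbrs S a"
proof -
  obtain U' where U': "U' \<subseteq> U" "card U' = s" using obtain_subset_with_card_n[OF assms(5)] by metis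
  obtain T' where T': "T' \<subseteq> T" "card T' = t" using obtain_subset_with_card_n[OF assms(6)] by metis
  have "U' \<subseteq> V \<times> C" "T' \<subseteq> V" using U'(1) T'(1) assms(2,3) by auto
  moreover have "fst ` U' \<inter> T' = {}" using image_mono[OF U'(1), of fst] T'(1) assms(4) by blast
  ultimately have "\<exists>a\<in>U'. \<exists>y\<in>T'. y \<in> coloured_nbrs S a"
    using assms(1) U'(2) T'(2) unfolding coloured_joined_def by simp
  then show ?thesis using U'(1) T'(1) by blast
qed

text \<open>Passing to exactly \<open>s\<close> agents bounds by \<open>s\<close> the vertices
  excluded as belonging to agents; fewer than \<open>t\<close> other vertices of \<open>Z\<close>
  can be non-neighbours.\<close>

lemma coloured_joined_nbrs:
  assumes j: "coloured_joined S V C s t" and fin: "finite V" and U: "U \<subseteq> V \<times> C" "s \<le> card U" and Z: "Z \<subseteq> V"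
    and s: "1 \<le> s"
  shows "card Z \<le> card ((\<Union>a\<in>U. coloured_nbrs S a) \<inter> Z) + s + t"
proof -
  obtain U' where U': "U' \<subseteq> U" "card U' = s" using obtain_subset_with_card_n[OF U(2)] by metis
  have fU': "finite U'" using U' s by (auto intro: card_ge_0_finite)
  have fZ: "finite Z" using Z fin finite_subset by blast
  let ?T = "Z - fst ` U' - (\<Union>a\<in>U. coloured_nbrs S a)"
  have "card ?T < t"
  proof (rule ccontr)
    assume "\<not> card ?T < t"
    then have "\<exists>a\<in>U'. \<exists>y\<in>?T. y \<in> coloured_nbrs S a"
      using U U' Z by (intro coloured_joinedD[OF j]) auto
    then show False using U' by blast
  qed
  have "card Z \<le> card (?T \<union> (fst ` U' \<union> ((\<Union>a\<in>U. coloured_nbrs S a) \<inter> Z)))"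
    using fZ fU' by (intro card_mono) auto
  also have "\<dots> \<le> card ?T + (card (fst ` U') + card ((\<Union>a\<in>U. coloured_nbrs S a) \<inter> Z))"
    by (meson add_left_mono card_Un_le le_trans)
  finally show ?thesis using \<open>card ?T < t\<close> card_image_le[OF fU', of fst] U'(2) by linarith
qed

text \<open>A cut with a small side is crossed by expansion, a cut with two large sides by
  joinedness.\<close>

lemma spanning_structure_connected:
  assumes j: "graph_joined \<Gamma> V t" and V: "finite V" "W \<subseteq> V" and ex: "expands \<Gamma> W t"
    and S: "S \<subseteq> W" "S \<noteq> {}" "S \<noteq> W"
  shows "\<exists>x\<in>S. \<exists>y\<in>W - S. {x, y} \<in> \<Gamma>"
proof -
  have nb: "\<exists>y\<in>W - S'. \<exists>x\<in>S'. {y, x} \<in> \<Gamma>" if S': "S' \<subseteq> W" "S' \<noteq> {}" "card S' \<le> t" for S'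
  proof -
    have "2 * card S' + 3 \<le> card {y \<in> W - S'. \<exists>x\<in>S'. {y, x} \<in> \<Gamma>}"
      using ex S' unfolding expands_def by simp
    then have "card {y \<in> W - S'. \<exists>x\<in>S'. {y, x} \<in> \<Gamma>} \<noteq> 0" by linarith
    then have "{y \<in> W - S'. \<exists>x\<in>S'. {y, x} \<in> \<Gamma>} \<noteq> {}" by (metis card.empty)
    then show ?thesis by blast
  qed
  consider "card S \<le> t" | "card (W - S) \<le> t" | "t \<le> card S" "t \<le> card (W - S)" by linarith
  then show ?thesis
  proof cases
    case 1
    then obtain y x where "y \<in> W - S" "x \<in> S" "{y, x} \<in> \<Gamma>" using nb[of S] S by blast
    moreover from this have "{x, y} \<in> \<Gamma>" by (simp add: insert_commute)
    ultimately show ?thesis by blast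
  next
    case 2
    have "\<exists>y\<in>W - (W - S). \<exists>x\<in>W - S. {y, x} \<in> \<Gamma>" using 2 S by (intro nb) auto
    then show ?thesis by blast
  next
    case 3
    have "\<exists>x\<in>S. \<exists>y\<in>W - S. {y, x} \<in> \<Gamma>"
      using 3 S V by (intro graph_joinedD[OF j]) auto
    then obtain y x where "y \<in> W - S" "x \<in> S" "{y, x} \<in> \<Gamma>" by blast
    moreover from this have "{x, y} \<in> \<Gamma>" by (simp add: insert_commute)
    ultimately show ?thesis by blast
  qed
qed

text \<open>\<open>X\<close> serves the search, \<open>Z\<close> the trees and \<open>Y\<close> the
  expansion of what is left; the ends and the stopover are taken from \<open>Y\<close>. All single
  connections together fit into \<open>t\<close> vertices, so the budget \<open>Q\<close> is about
  \<open>11 * t\<close>, against the \<open>30 * t\<close> vertices of the reservoir.\<close>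

theorem rigid_structure:
  fixes V :: "'v set" and C :: "'c set"
  assumes fin: "finite V" "finite C"
    and parts: "X \<subseteq> V" "Z \<subseteq> V" "Y \<subseteq> V" "X \<inter> Z = {}" "X \<inter> Y = {}" "Y \<inter> Z = {}"
    and sizes: "30 * t \<le> card X" "30 * t \<le> card Z" "30 * t \<le> card Y"
    and params: "1 \<le> s" "s \<le> t" "2 \<le> t" "1 \<le> l" "t \<le> 2 ^ l" "2 ^ l \<le> 2 * t"
      "(3 * s + 4) * (2 * l + 1) \<le> t"
    and S: "coloured_expansion S V C Z s" "coloured_joined S V C s t" "two_step_joined S S' V C s t"
    and G: "graph_joined \<Gamma> V t"
    and f: "\<And>i. f i \<in> C"
  obtains us a b where "distinct us" "us \<noteq> []" "hd us = a" "last us = b" "a \<noteq> b"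
    "coloured_path (S \<union> S') f us" "set us \<subseteq> V" "expands \<Gamma> (V - set us \<union> {a, b}) t"
proof -
  obtain B where B: "B \<subseteq> V" "card B < t"
    "\<forall>P\<subseteq>V - B. P \<noteq> {} \<longrightarrow> card P \<le> t \<longrightarrow>
       6 * card P < card {y \<in> Y - B - P. \<exists>x\<in>P. {y, x} \<in> \<Gamma>}"
    by (rule nonexpanding_core[OF G fin(1) parts(3)]) (use sizes params in auto)
  have fB: "finite B" using B fin finite_subset by blast
  let ?N = "\<lambda>a. coloured_nbrs S a \<inter> Z"
  have UN: "(\<Union>a\<in>U. ?N a) = (\<Union>a\<in>U. coloured_nbrs S a) \<inter> Z" for U by auto
  have fZ: "finite Z" "finite X" "finite Y" using parts(1-3) fin(1) by (meson finite_subset)+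
  have big: "card Z \<le> card (\<Union>a\<in>U. ?N a) + s + t" if "U \<subseteq> V \<times> C" "s \<le> card U" for U
    unfolding UN using coloured_joined_nbrs[OF S(2) fin(1) that parts(2) params(1)] .
  obtain lev :: "'v \<Rightarrow> nat" where lev0: "\<forall>u\<in>B. 1 \<le> lev u" "finite {u. 1 \<le> lev u}"
    "card {u. 1 \<le> lev u} \<le> card B + s" "card {u. 2 \<le> lev u} \<le> s"
    "\<forall>U\<subseteq>V \<times> C. card U \<le> 2 * s \<longrightarrow>
       5 * card U \<le> card (\<Union>a\<in>U. {y \<in> ?N a. lev y = 0 \<or> lev y < lev (fst a)})"
  proof (rule rank_exists[of "V \<times> C" ?N B s])
    show "finite (V \<times> C)" "finite B" "1 \<le> s" using fin fB params by auto
    show "finite (?N a)" for a using fZ by simp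
    show "7 * card U \<le> card (\<Union>a\<in>U. ?N a)" if "U \<subseteq> V \<times> C" "card U \<le> 2 * s" for U
      unfolding UN using S(1) that unfolding coloured_expansion_def by blast
    show "12 * s + card B < card (\<Union>a\<in>U. ?N a)" if "U \<subseteq> V \<times> C" "s \<le> card U" for U
      using big[OF that] sizes(2) params B(2) by linarith
  qed
  have lev: "\<And>u. u \<in> B \<Longrightarrow> 1 \<le> lev u" "finite {u. 1 \<le> lev u}"
    "card {u. 1 \<le> lev u} \<le> card B + s" "card {u. 2 \<le> lev u} \<le> s"
    using lev0(1-4) by auto
  let ?N' = "\<lambda>a. {y \<in> ?N a. lev y = 0 \<or> lev y < lev (fst a)}"
  define Q where "Q = (3 * s + 4) * (2 * l + 1) + 2 * card B + 1 + 4 * 2 ^ l"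
  have Qt: "Q \<le> 11 * t + 1" using params B(2) by (simp add: Q_def)
  interpret reservoir "S \<union> S'" V Z C ?N' lev s Q l
  proof
    show "finite V" "finite C" "Z \<subseteq> V" "1 \<le> s" "1 \<le> l" using fin parts params by auto
    show "?N' a \<subseteq> Z" for a by blast
    show "(c, {u, w}) \<in> S \<union> S'" if "w \<in> ?N' (u, c)" for w u c
      using that by (auto simp: coloured_nbrs_def)
    show "lev w = 0 \<or> lev w < lev u" if "w \<in> ?N' (u, c)" for w u c using that by auto
    show "2 * s * 5 + Q < card (\<Union>a\<in>U. ?N' a)" if "U \<subseteq> V \<times> C" "s \<le> card U" for U
    proof -
      have "card (\<Union>a\<in>U. ?N a) \<le> card ((\<Union>a\<in>U. ?N' a) \<union> {u. 1 \<le> lev u})"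
        using lev(2) fZ by (intro card_mono) (auto intro: finite_subset[of _ Z])
      also have "\<dots> \<le> card (\<Union>a\<in>U. ?N' a) + card {u. 1 \<le> lev u}" by (rule card_Un_le)
      finally show ?thesis using big[OF that] Qt sizes(2) params B(2) lev(3) by linarith
    qed
    show "\<exists>x\<in>P. \<exists>y\<in>P'. (c, {x, y}) \<in> S \<union> S'"
      if P: "P \<subseteq> V" "P' \<subseteq> V" "P \<inter> P' = {}" "card P = 2 ^ l" "card P' = 2 ^ l" "c \<in> C" for P P' c
    proof -
      have "card (P \<times> {c}) = 2 ^ l" using P(4) by (simp add: card_cartesian_product)
      then have "\<exists>a\<in>P \<times> {c}. \<exists>y\<in>P'. y \<in> coloured_nbrs S a"
        using P params by (intro coloured_joinedD[OF S(2)]) auto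
      then show ?thesis by (auto simp: coloured_nbrs_def)
    qed
  qed
  have ext: "extendable ?N' 5 (2 * s) (V \<times> C) Map.empty"
    unfolding extendable_def avail_def using lev0(5) by simp
  let ?S0 = "{u. 1 \<le> lev u}"
  have "3 \<le> card (Y - ?S0)"
    using diff_card_le_card_Diff[OF lev(2), of Y] lev(3) B(2) params sizes(3) by linarith
  then obtain T where T: "T \<subseteq> Y - ?S0" "card T = 3" using obtain_subset_with_card_n by metis
  then obtain x0 x1 x2 where xs: "T = {x0, x1, x2}" "x0 \<noteq> x1" "x0 \<noteq> x2" "x1 \<noteq> x2"
    by (metis card_3_iff)
  define X' where "X' = X - ?S0"
  have X'c: "28 * t \<le> card X'"
    using diff_card_le_card_Diff[OF lev(2), of X] lev(3) B(2) params sizes(1) unfolding X'_def by linarith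
  obtain us where us: "distinct us" "us \<noteq> []" "hd us = x0" "last us = x2" "coloured_path (S \<union> S') f us"
    "B \<subseteq> set us" "set us \<subseteq> B \<union> X' \<union> Z \<union> {x0, x1, x2}"
  proof (rule rigid_path[OF ext B(1) lev(1), of X' x0 x1 x2 f])
    show "card {u \<in> B. 2 \<le> lev u} \<le> s"
      using card_mono[OF finite_subset[OF _ lev(2)], of "{u. 2 \<le> lev u}" "{u \<in> B. 2 \<le> lev u}"] lev(4) by fastforce
    show "X' \<subseteq> V" "X' \<inter> Z = {}" "\<And>x. x \<in> X' \<Longrightarrow> lev x = 0" using parts by (auto simp: X'_def)
    show "{x0, x1, x2} \<subseteq> V - Z - X'" using T xs parts by (auto simp: X'_def)
    show "x0 \<noteq> x1" "x0 \<noteq> x2" "x1 \<noteq> x2" "lev x0 = 0" "lev x1 = 0" "lev x2 = 0" using T xs by auto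
    show "f i \<in> C" for i by (rule f)
    show "(3 * s + 4) * (2 * l + 1) + 2 * card B + 1 + 4 * 2 ^ l \<le> Q" by (simp add: Q_def)
    fix D U P and g g' :: "'v \<Rightarrow> 'c"
    assume *: "D \<subseteq> V - X'" "U \<subseteq> V - X'" "D \<inter> U = {}" "card D = s" "s \<le> card U" "P \<subseteq> X'"
      "card P \<le> card B" "\<And>v. g v \<in> C \<and> g' v \<in> C"
    obtain U' where U': "U' \<subseteq> U" "card U' = s" using obtain_subset_with_card_n[OF *(5)] by metis
    have "finite P" using *(6) fZ(2) by (auto simp: X'_def intro: finite_subset)
    then have "t \<le> card (X' - P)"
      using diff_card_le_card_Diff[of P X'] *(7) B(2) X'c by linarith
    then obtain T' where T': "T' \<subseteq> X' - P" "card T' = t" using obtain_subset_with_card_n by metis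
    have "D \<subseteq> V" "U' \<subseteq> V" "T' \<subseteq> V" "D \<inter> U' = {}" "D \<inter> T' = {}" "U' \<inter> T' = {}"
      using *(1,2,3) U'(1) T'(1) parts(1) by (auto simp: X'_def)
    then have "\<exists>v\<in>D. \<exists>z\<in>T'. \<exists>w\<in>U'. (g v, {v, z}) \<in> S \<and> (g' v, {z, w}) \<in> S'"
      using S(3) *(4,8) U'(2) T'(2) unfolding two_step_joined_def by simp
    then show "\<exists>v\<in>D. \<exists>z\<in>X' - P. \<exists>w\<in>U. (g v, {v, z}) \<in> S \<union> S' \<and> (g' v, {z, w}) \<in> S \<union> S'"
      using U'(1) T'(1) by blast
  qed
  have usV: "set us \<subseteq> V" using us(7) B(1) parts T xs by (auto simp: X'_def)
  have xB: "x0 \<notin> B" "x2 \<notin> B" using T xs lev(1) by force+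
  let ?W = "V - set us \<union> {x0, x2}"
  have "expands \<Gamma> ?W t"
    unfolding expands_def
  proof (intro allI impI)
    fix P assume P: "P \<subseteq> ?W" "P \<noteq> {}" "card P \<le> t"
    have "{x0, x2} \<subseteq> V" using T xs parts by auto
    then have "P \<subseteq> V - B" using P(1) us(6) xB by auto
    then have "6 * card P < card {y \<in> Y - B - P. \<exists>x\<in>P. {y, x} \<in> \<Gamma>}" using P(2,3) B(3) by simp
    \<comment> \<open>The rigid path meets \<open>Y - B\<close> at most in \<open>x0\<close>,
      \<open>x1\<close>, \<open>x2\<close>, and its ends \<open>x0\<close> and \<open>x2\<close>
      still belong to the remainder; only \<open>x1\<close> is lost.\<close>
    also have "\<dots> \<le> card (insert x1 {y \<in> ?W - P. \<exists>x\<in>P. {y, x} \<in> \<Gamma>})"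
    proof (rule card_mono)
      show "finite (insert x1 {y \<in> ?W - P. \<exists>x\<in>P. {y, x} \<in> \<Gamma>})" using fin(1) by simp
      show "{y \<in> Y - B - P. \<exists>x\<in>P. {y, x} \<in> \<Gamma>} \<subseteq> insert x1 {y \<in> ?W - P. \<exists>x\<in>P. {y, x} \<in> \<Gamma>}"
        using us(7) parts by (auto simp: X'_def)
    qed
    also have "\<dots> \<le> Suc (card {y \<in> ?W - P. \<exists>x\<in>P. {y, x} \<in> \<Gamma>})"
      using fin(1) by (simp add: card_insert_if)
    finally have "6 * card P \<le> card {y \<in> ?W - P. \<exists>x\<in>P. {y, x} \<in> \<Gamma>}" by simp
    moreover have "1 \<le> card P"
    proof -
      have "finite P" using \<open>P \<subseteq> V - B\<close> fin(1) by (meson finite_Diff finite_subset)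
      then show ?thesis using P(2) by (simp add: Suc_le_eq card_gt_0_iff)
    qed
    ultimately show "2 * card P + 3 \<le> card {y \<in> ?W - P. \<exists>x\<in>P. {y, x} \<in> \<Gamma>}" by linarith
  qed
  then show thesis using that[of us x0 x2] us xs usV by blast
qed

section \<open>Random subsets and McDiarmid's coupling\<close>

text \<open>The ground set is arbitrary: edges give the graph of jokers, (colour, edge) pairs give
  the whole tuple of graphs.\<close>

definition random_subset :: "'b set \<Rightarrow> real \<Rightarrow> 'b set pmf" where
  "random_subset T q =
     map_pmf (\<lambda>present. {t \<in> T. present t}) (Pi_pmf T False (\<lambda>_. bernoulli_pmf q))"

lemma random_subset_empty [simp]: "random_subset {} q = return_pmf {}"
  by (simp add: random_subset_def)

lemma random_subset_insert:
  assumes "finite T" "t \<notin> T"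
  shows "random_subset (insert t T) q =
    bernoulli_pmf q \<bind> (\<lambda>b. map_pmf (\<lambda>S. if b then insert t S else S) (random_subset T q))"
proof -
  have *: "{ta. (ta = t \<longrightarrow> b) \<and> (ta \<noteq> t \<longrightarrow> ta \<in> T \<and> f ta)} =
      (if b then insert t {x \<in> T. f x} else {x \<in> T. f x})" for f b
    using assms by auto
  show ?thesis
    unfolding random_subset_def Pi_pmf_insert[OF assms] map_pmf_comp pair_pmf_def map_bind_pmf
    by (simp add: map_pmf_def[symmetric] map_pmf_comp bind_return_pmf bind_assoc_pmf * map_bind_pmf bind_map_pmf)
qed

lemma set_random_subset: "finite T \<Longrightarrow> S \<in> set_pmf (random_subset T q) \<Longrightarrow> S \<subseteq> T"
  by (auto simp: random_subset_def)

lemma random_subset_Un_disjoint: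
  assumes "finite B" "finite A" "A \<inter> B = {}"
  shows "random_subset (A \<union> B) q =
    random_subset A q \<bind> (\<lambda>S. map_pmf (\<lambda>S'. S \<union> S') (random_subset B q))"
  using assms(2,3)
proof (induction A)
  case empty
  then show ?case by (simp add: bind_return_pmf map_pmf_idI)
next
  case (insert a A)
  have "random_subset (insert a A \<union> B) q =
    bernoulli_pmf q \<bind> (\<lambda>b. map_pmf (\<lambda>S. if b then insert a S else S) (random_subset (A \<union> B) q))"
    using insert assms(1) random_subset_insert[of "A \<union> B" a] by simp
  also have "\<dots> = random_subset (insert a A) q \<bind> (\<lambda>S. map_pmf (\<lambda>S'. S \<union> S') (random_subset B q))"
    using insert assms(1)
    by (simp add: random_subset_insert map_bind_pmf bind_assoc_pmf bind_map_pmf map_pmf_comp)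
       (intro bind_pmf_cong refl map_pmf_cong, auto)
  finally show ?case .
qed

lemma bernoulli_or:
  assumes "q \<in> {0..1}" "r \<in> {0..1}"
  shows "bernoulli_pmf (q + r - q * r) =
    bernoulli_pmf q \<bind> (\<lambda>a. map_pmf (\<lambda>b. a \<or> b) (bernoulli_pmf r))"
proof -
  have "0 \<le> (1 - q) * (1 - r)" "0 \<le> q + r * (1 - q)" using assms by auto
  then have *: "q + r - q * r \<in> {0..1}" by (auto simp: algebra_simps)
  show ?thesis
  proof (rule pmf_eqI)
    fix b
    show "pmf (bernoulli_pmf (q + r - q * r)) b = pmf (bernoulli_pmf q \<bind> (\<lambda>a. map_pmf (\<lambda>b. a \<or> b) (bernoulli_pmf r))) b"
      using * assms by (cases b) (simp_all add: pmf_bind map_pmf_def pmf_bernoulli_True pmf_bernoulli_False algebra_simps)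
  qed
qed

text \<open>Exposure in two rounds: an element is missing from the union with probability (1 - q)(1
  - r).\<close>

lemma random_subset_union:
  assumes "finite T" "q \<in> {0..1}" "r \<in> {0..1}"
  shows "random_subset T (q + r - q * r) =
    random_subset T q \<bind> (\<lambda>S. map_pmf (\<lambda>S'. S \<union> S') (random_subset T r))"
  using assms(1)
proof (induction T)
  case empty
  then show ?case by (simp add: bind_return_pmf)
next
  case (insert t T)
  have "random_subset (insert t T) (q + r - q * r) =
     bernoulli_pmf q \<bind> (\<lambda>a. bernoulli_pmf r \<bind> (\<lambda>b.
       random_subset T q \<bind> (\<lambda>S. random_subset T r \<bind> (\<lambda>S'.
          return_pmf (if a \<or> b then insert t (S \<union> S') else S \<union> S')))))"
    using insert assms
    by (simp add: random_subset_insert bernoulli_or map_bind_pmf bind_assoc_pmf bind_map_pmf map_pmf_comp)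
       (simp add: map_pmf_def bind_assoc_pmf bind_return_pmf)
  also have "\<dots> = bernoulli_pmf q \<bind> (\<lambda>a. random_subset T q \<bind> (\<lambda>S.
       bernoulli_pmf r \<bind> (\<lambda>b. random_subset T r \<bind> (\<lambda>S'.
          return_pmf ((if a then insert t S else S) \<union> (if b then insert t S' else S'))))))"
    by (subst (2) bind_commute_pmf) (intro bind_pmf_cong refl, auto)
  also have "\<dots> = random_subset (insert t T) q \<bind> (\<lambda>S. map_pmf (\<lambda>S'. S \<union> S') (random_subset (insert t T) r))"
    using insert
    by (simp add: random_subset_insert map_bind_pmf bind_assoc_pmf bind_map_pmf map_pmf_comp)
       (simp add: map_pmf_def bind_assoc_pmf bind_return_pmf)
  finally show ?case .
qed

lemma prob_random_subset_disjoint: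
  fixes q :: real
  assumes "finite T" "U \<subseteq> T" "q \<in> {0..1}"
  shows "measure_pmf.prob (random_subset T q) {S. S \<inter> U = {}} = (1 - q) ^ card U"
proof -
  have fU: "finite U" using assms finite_subset by blast
  have "measure_pmf.prob (random_subset T q) {S. S \<inter> U = {}} =
    measure_pmf.prob (Pi_pmf T False (\<lambda>_. bernoulli_pmf q)) (Pi T (\<lambda>t. if t \<in> U then {False} else UNIV))"
    unfolding random_subset_def measure_map_pmf
    by (intro arg_cong[where f = "measure_pmf.prob _"]) (use assms in \<open>auto simp: Pi_def split: if_splits\<close>)
  also have "\<dots> = (\<Prod>t\<in>T. measure_pmf.prob (bernoulli_pmf q) (if t \<in> U then {False} else UNIV))"
    by (rule measure_Pi_pmf_Pi[OF assms(1)])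
  also have "\<dots> = (\<Prod>t\<in>T. if t \<in> U then 1 - q else 1)"
    using assms(3) by (intro prod.cong) (auto simp: measure_pmf_single)
  also have "\<dots> = (\<Prod>t\<in>U. 1 - q)"
    by (subst prod.inter_restrict[symmetric]) (use assms in \<open>auto simp: Int_absorb1\<close>)
  finally show ?thesis by simp
qed

lemma prob_union_bound:
  fixes b :: real
  assumes "finite I" "\<And>i. i \<in> I \<Longrightarrow> measure_pmf.prob p (X i) \<le> b"
  shows "measure_pmf.prob p (\<Union>i\<in>I. X i) \<le> card I * b"
proof -
  have "measure_pmf.prob p (\<Union>i\<in>I. X i) \<le> (\<Sum>i\<in>I. measure_pmf.prob p (X i))"
    by (rule measure_pmf.finite_measure_subadditive_finite) (use assms in auto)
  also have "\<dots> \<le> (\<Sum>i\<in>I. b)" using assms by (intro sum_mono) auto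
  finally show ?thesis by simp
qed

lemma prob_bind_pmf:
  "measure_pmf.prob (bind_pmf p f) X = measure_pmf.expectation p (\<lambda>x. measure_pmf.prob (f x) X)"
  unfolding measure_pmf_bind
  by (rule measure_pmf.measure_bind[where N = "count_space UNIV"])
     (auto simp: measure_subprob intro!: measurable_count_space)

lemma prob_bind_mono:
  assumes "\<And>x. x \<in> set_pmf p \<Longrightarrow> measure_pmf.prob (f x) X \<le> measure_pmf.prob (g x) Y"
  shows "measure_pmf.prob (bind_pmf p f) X \<le> measure_pmf.prob (bind_pmf p g) Y"
  unfolding prob_bind_pmf
  by (intro integral_mono_AE measure_pmf.integrable_const_bound[where B = 1])
     (use assms in \<open>auto simp: AE_measure_pmf_iff\<close>)

lemma prob_bind_le:
  assumes "\<And>x. x \<in> set_pmf p \<Longrightarrow> x \<notin> B \<Longrightarrow> measure_pmf.prob (f x) X \<le> b" "0 \<le> b"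
  shows "measure_pmf.prob (bind_pmf p f) X \<le> measure_pmf.prob p B + b"
proof -
  have "measure_pmf.prob (bind_pmf p f) X \<le> measure_pmf.expectation p (\<lambda>x. indicator B x + b)"
    unfolding prob_bind_pmf
  proof (intro integral_mono_AE)
    show "AE x in measure_pmf p. measure_pmf.prob (f x) X \<le> indicator B x + b"
      using assms by (auto simp: AE_measure_pmf_iff indicator_def intro: order.trans[OF measure_pmf.prob_le_1])
  qed (use assms in \<open>auto intro!: measure_pmf.integrable_const_bound[where B = 1] Bochner_Integration.integrable_add\<close>)
  also have "\<dots> = measure_pmf.prob p B + b"
    by (subst Bochner_Integration.integral_add)
       (auto intro!: measure_pmf.integrable_const_bound[where B = 1])
  finally show ?thesis .
qed

lemma prob_mono_support:
  assumes "\<And>x. x \<in> set_pmf p \<Longrightarrow> x \<in> X \<Longrightarrow> x \<in> Y"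
  shows "measure_pmf.prob p X \<le> measure_pmf.prob p Y"
  using assms by (intro measure_pmf.finite_measure_mono_AE) (auto simp: AE_measure_pmf_iff)

lemma prob_random_subset_mem:
  assumes "finite T" "t \<in> T" "q \<in> {0..1}"
  shows "measure_pmf.prob (random_subset T q) {S. t \<in> S} = q"
proof -
  have "{S. t \<in> S} = UNIV - {S. S \<inter> {t} = {}}" by auto
  then show ?thesis
    using prob_random_subset_disjoint[of T "{t}" q] assms
      measure_pmf.prob_compl[of "{S. S \<inter> {t} = {}}" "random_subset T q"] by simp
qed

text \<open>McDiarmid's coupling: since a set in \<open>\<F>\<close> uses an element of \<open>E\<close> in at most one
  colour, decoupling the colours of one element at a time can only help.\<close>

lemma prob_coupled_le:
  fixes \<F> :: "('c \<times> 'e) set set"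
  assumes "finite C" "finite E" "q \<in> {0..1}"
    and "\<And>F. F \<in> \<F> \<Longrightarrow> F \<subseteq> C \<times> E \<and> inj_on snd F"
  shows "measure_pmf.prob (random_subset E q) {S. \<exists>F\<in>\<F>. snd ` F \<subseteq> S} \<le>
    measure_pmf.prob (random_subset (C \<times> E) q) {S. \<exists>F\<in>\<F>. F \<subseteq> S}"
  using assms(2,4)
proof (induction E arbitrary: \<F>)
  case empty
  then have "\<F> \<subseteq> {{}}" by auto
  then show ?case by (auto simp: measure_return_pmf indicator_def)
next
  case (insert e E)
  let ?R = "random_subset"
  \<comment> \<open>\<open>red\<close> forgets what the witnesses require of \<open>e\<close>. It is
    applied to the whole family if \<open>e\<close> is present, and only to the witnesses avoiding
    \<open>e\<close> otherwise.\<close>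
  define red where "red \<G> = (\<lambda>F. F - UNIV \<times> {e}) ` (\<G> :: ('c \<times> 'e) set set)" for \<G>
  define \<F>b where "\<F>b b = (if b then \<F> else {F \<in> \<F>. e \<notin> snd ` F})" for b
  define X where "X b S \<longleftrightarrow> (\<exists>F\<in>red (\<F>b b). F \<subseteq> S)" for b S
  have IH: "measure_pmf.prob (?R E q) {S. \<exists>F\<in>red (\<F>b b). snd ` F \<subseteq> S} \<le>
      measure_pmf.prob (?R (C \<times> E) q) {S. X b S}" for b
    unfolding X_def
  proof (rule insert.IH)
    fix F assume "F \<in> red (\<F>b b)"
    then obtain F' where "F' \<in> \<F>" "F = F' - UNIV \<times> {e}" by (auto simp: red_def \<F>b_def split: if_splits)
    then show "F \<subseteq> C \<times> E \<and> inj_on snd F"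
      using insert.prems[of F'] by (auto intro: inj_on_subset)
  qed
  have "measure_pmf.prob (?R (insert e E) q) {S. \<exists>F\<in>\<F>. snd ` F \<subseteq> S} =
    measure_pmf.prob (bernoulli_pmf q \<bind> (\<lambda>b. map_pmf (\<lambda>S. if b then insert e S else S) (?R E q)))
      {S. \<exists>F\<in>\<F>. snd ` F \<subseteq> S}"
    using insert by (simp add: random_subset_insert)
  also have "\<dots> \<le> measure_pmf.prob (bernoulli_pmf q \<bind> (\<lambda>b. map_pmf (X b) (?R (C \<times> E) q))) {True}"
  proof (rule prob_bind_mono)
    fix b :: bool
    have "measure_pmf.prob (map_pmf (\<lambda>S. if b then insert e S else S) (?R E q)) {S. \<exists>F\<in>\<F>. snd ` F \<subseteq> S}
       \<le> measure_pmf.prob (?R E q) {S. \<exists>F\<in>red (\<F>b b). snd ` F \<subseteq> S}"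
    proof (unfold measure_map_pmf, rule prob_mono_support)
      fix S assume S: "S \<in> set_pmf (?R E q)"
        "S \<in> (\<lambda>S. if b then insert e S else S) -` {S. \<exists>F\<in>\<F>. snd ` F \<subseteq> S}"
      then obtain F where F: "F \<in> \<F>" "snd ` F \<subseteq> (if b then insert e S else S)" by auto
      have "e \<notin> S" using S insert.hyps set_random_subset by blast
      then have "F \<in> \<F>b b" "snd ` (F - UNIV \<times> {e}) \<subseteq> S"
        using F by (auto simp: \<F>b_def split: if_splits)
      then show "S \<in> {S. \<exists>F\<in>red (\<F>b b). snd ` F \<subseteq> S}" by (auto simp: red_def)
    qed
    also note IH
    also have "measure_pmf.prob (?R (C \<times> E) q) {S. X b S} =
      measure_pmf.prob (map_pmf (X b) (?R (C \<times> E) q)) {True}"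
      by (simp add: vimage_def)
    finally show "measure_pmf.prob (map_pmf (\<lambda>S. if b then insert e S else S) (?R E q))
      {S. \<exists>F\<in>\<F>. snd ` F \<subseteq> S} \<le> measure_pmf.prob (map_pmf (X b) (?R (C \<times> E) q)) {True}" .
  qed
  also have "bernoulli_pmf q \<bind> (\<lambda>b. map_pmf (X b) (?R (C \<times> E) q)) =
    ?R (C \<times> E) q \<bind> (\<lambda>S. map_pmf (\<lambda>b. X b S) (bernoulli_pmf q))"
    unfolding map_pmf_def by (rule bind_commute_pmf)
  also have "measure_pmf.prob (?R (C \<times> E) q \<bind> (\<lambda>S. map_pmf (\<lambda>b. X b S) (bernoulli_pmf q))) {True} \<le>
    measure_pmf.prob (?R (C \<times> E) q \<bind> (\<lambda>S. map_pmf (\<lambda>S'. S \<union> S') (?R (C \<times> {e}) q)))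
      {S. \<exists>F\<in>\<F>. F \<subseteq> S}"
  proof (rule prob_bind_mono, unfold measure_map_pmf)
    fix S assume S: "S \<in> set_pmf (?R (C \<times> E) q)"
    show "measure_pmf.prob (bernoulli_pmf q) ((\<lambda>b. X b S) -` {True}) \<le>
      measure_pmf.prob (?R (C \<times> {e}) q) ((\<lambda>S'. S \<union> S') -` {S. \<exists>F\<in>\<F>. F \<subseteq> S})"
    proof (cases "\<exists>F\<in>\<F>. F \<subseteq> S")
      case True
      then have "(\<lambda>S'. S \<union> S') -` {S. \<exists>F\<in>\<F>. F \<subseteq> S} = UNIV" by auto
      then show ?thesis by simp
    next
      case False
      have nF: "\<not> X False S"
      proof
        assume "X False S"
        then obtain F where F: "F \<in> \<F>" "e \<notin> snd ` F" "F - UNIV \<times> {e} \<subseteq> S"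
          by (auto simp: X_def red_def \<F>b_def)
        then have "F - UNIV \<times> {e} = F" by (auto simp: image_iff)
        then show False using F False by auto
      qed
      \<comment> \<open>The other elements are now fixed and contain no witness. If the presence of
        \<open>e\<close> would complete one, that witness needs \<open>e\<close> in a single colour
        \<open>c\<close>, and in the decoupled model the pair \<open>(c, e)\<close> alone appears
        with the same probability \<open>q\<close>.\<close>
      show ?thesis
      proof (cases "X True S")
        case False
        then have "\<not> X b S" for b using nF by (cases b) auto
        then have "(\<lambda>b. X b S) -` {True} = {}" by auto
        then show ?thesis by simp
      next
        case True
        then obtain F where F: "F \<in> \<F>" "F - UNIV \<times> {e} \<subseteq> S" by (auto simp: X_def red_def \<F>b_def)
        then have "\<not> F \<subseteq> S" using False by blast
        then obtain c where c: "(c, e) \<in> F" using F by auto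
        have "X b S \<Longrightarrow> b" for b using nF by (cases b) auto
        then have "(\<lambda>b. X b S) -` {True} \<subseteq> {True}" by auto
        then have "measure_pmf.prob (bernoulli_pmf q) ((\<lambda>b. X b S) -` {True}) \<le>
            measure_pmf.prob (bernoulli_pmf q) {True}"
          by (intro measure_pmf.finite_measure_mono) auto
        also have "\<dots> = q" using assms by (simp add: measure_pmf_single)
        also have "q = measure_pmf.prob (?R (C \<times> {e}) q) {S'. (c, e) \<in> S'}"
          using assms c F insert.prems[of F] by (subst prob_random_subset_mem) auto
        also have "\<dots> \<le> measure_pmf.prob (?R (C \<times> {e}) q) ((\<lambda>S'. S \<union> S') -` {S. \<exists>F\<in>\<F>. F \<subseteq> S})"
        proof (rule prob_mono_support)
          fix S' assume "S' \<in> {S'. (c, e) \<in> S'}"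
          moreover have "x = c" if "(x, e) \<in> F" for x
            using inj_onD[OF conjunct2[OF insert.prems[OF F(1)]], of "(x, e)" "(c, e)"] that c by simp
          ultimately have "F \<subseteq> S \<union> S'" using F by auto
          then show "S' \<in> (\<lambda>S'. S \<union> S') -` {S. \<exists>F\<in>\<F>. F \<subseteq> S}" using F by auto
        qed
        finally show ?thesis .
      qed
    qed
  qed
  also have "?R (C \<times> E) q \<bind> (\<lambda>S. map_pmf (\<lambda>S'. S \<union> S') (?R (C \<times> {e}) q)) = ?R (C \<times> insert e E) q"
  proof -
    have "C \<times> insert e E = C \<times> E \<union> C \<times> {e}" by auto
    then show ?thesis
      using insert assms(1) by (subst random_subset_Un_disjoint[symmetric]) auto
  qed
  finally show ?case .
qed

text \<open>The missing density is added as an independent second round, whose probability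
  \<open>r\<close> solves \<open>q + r - q * r = p\<close>.\<close>

lemma prob_random_subset_mono:
  assumes "finite T" "0 \<le> q" "q \<le> p" "p \<le> 1" and up: "\<And>S S'. S \<in> X \<Longrightarrow> S \<subseteq> S' \<Longrightarrow> S' \<in> X"
  shows "measure_pmf.prob (random_subset T q) X \<le> measure_pmf.prob (random_subset T p) X"
proof (cases "q = 1")
  case True
  then show ?thesis using assms by simp
next
  case False
  define r where "r = (p - q) / (1 - q)"
  have "r * (1 - q) = p - q" using False by (simp add: r_def)
  then have "q + r - q * r = p" by (simp add: algebra_simps)
  moreover have "r \<in> {0..1}" using assms False by (auto simp: r_def divide_le_eq)
  ultimately have r: "r \<in> {0..1}" "q + r - q * r = p" by auto
  have "measure_pmf.prob (random_subset T q \<bind> return_pmf) X \<le>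
    measure_pmf.prob (random_subset T q \<bind> (\<lambda>S. map_pmf (\<lambda>S'. S \<union> S') (random_subset T r))) X"
  proof (rule prob_bind_mono)
    fix S
    have "S \<in> X \<Longrightarrow> (\<lambda>S'. S \<union> S') -` X = UNIV" using up by blast
    then show "measure_pmf.prob (return_pmf S) X \<le> measure_pmf.prob (map_pmf (\<lambda>S'. S \<union> S') (random_subset T r)) X"
      by (auto simp: measure_return_pmf indicator_def)
  qed
  then show ?thesis
    using random_subset_union[of T q r] assms r by (simp add: bind_return_pmf')
qed

section \<open>Union bounds\<close>

text \<open>The common form of the union bounds below: every failure is witnessed by a set of at
  least \<open>M\<close> elements, from a family fixed in advance, that the random set
  misses.\<close>

lemma prob_union_no_edge:
  fixes q K :: real
  assumes T: "finite T" "finite I" "q \<in> {0..1}" and K: "real (card I) \<le> K"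
    and F: "\<And>i. i \<in> I \<Longrightarrow> F i \<subseteq> T \<and> M \<le> card (F i)"
    and bad: "\<And>S. S \<subseteq> T \<Longrightarrow> bad S \<Longrightarrow> \<exists>i\<in>I. S \<inter> F i = {}"
  shows "measure_pmf.prob (random_subset T q) {S. bad S} \<le> K * (1 - q) ^ M"
proof -
  have "measure_pmf.prob (random_subset T q) {S. bad S} \<le>
    measure_pmf.prob (random_subset T q) (\<Union>i\<in>I. {S. S \<inter> F i = {}})"
    using bad set_random_subset[OF T(1)] by (intro prob_mono_support) blast
  also have "\<dots> \<le> card I * (1 - q) ^ M"
  proof (rule prob_union_bound[OF T(2)])
    fix i assume "i \<in> I"
    then have "measure_pmf.prob (random_subset T q) {S. S \<inter> F i = {}} = (1 - q) ^ card (F i)"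
      using F T by (intro prob_random_subset_disjoint) auto
    also have "\<dots> \<le> (1 - q) ^ M" using F[OF \<open>i \<in> I\<close>] T(3) by (intro power_decreasing) auto
    finally show "measure_pmf.prob (random_subset T q) {S. S \<inter> F i = {}} \<le> (1 - q) ^ M" .
  qed
  also have "\<dots> \<le> K * (1 - q) ^ M" using K T(3) by (intro mult_right_mono) auto
  finally show ?thesis .
qed

lemma card_subsets_le:
  assumes "finite A"
  shows "card {U. U \<subseteq> A \<and> card U = k} \<le> card A ^ k"
proof (cases "k \<le> card A")
  case True
  then show ?thesis using n_subsets[OF assms, of k] binomial_le_pow[of k "card A"] by simp
next
  case False
  then show ?thesis using n_subsets[OF assms, of k] by (simp add: binomial_eq_0)
qed

lemma card_small_subsets_le:
  assumes "finite A"
  shows "card {U. U \<subseteq> A \<and> card U \<le> k} \<le> Suc (card A) ^ k"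
proof (induction k)
  case 0
  have "{U. U \<subseteq> A \<and> card U \<le> 0} = {{}}"
    using finite_subset[OF _ assms] by auto
  then show ?case by simp
next
  case (Suc k)
  let ?X = "{U. U \<subseteq> A \<and> card U \<le> k}" and ?Y = "{U. U \<subseteq> A \<and> card U \<le> Suc k}"
  let ?O = "insert None (Some ` A)"
  have fX: "finite ?X" using assms by (auto intro: finite_subset[of _ "Pow A"])
  have "?Y \<subseteq> (\<lambda>(U, x). case x of None \<Rightarrow> U | Some e \<Rightarrow> insert e U) ` (?X \<times> ?O)"
  proof
    fix U assume U: "U \<in> ?Y"
    show "U \<in> (\<lambda>(U, x). case x of None \<Rightarrow> U | Some e \<Rightarrow> insert e U) ` (?X \<times> ?O)"
    proof (cases "U = {}")
      case True
      then show ?thesis by (intro image_eqI[of _ _ "({}, None)"]) auto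
    next
      case False
      then obtain e where e: "e \<in> U" by blast
      have "finite U" using U assms finite_subset by auto
      then have "card (U - {e}) \<le> k" using U e by (auto simp: card_Diff_singleton)
      then show ?thesis using U e by (intro image_eqI[of _ _ "(U - {e}, Some e)"]) auto
    qed
  qed
  moreover have fin: "finite (?X \<times> ?O)" using fX assms by simp
  ultimately have "card ?Y \<le> card ((\<lambda>(U, x). case x of None \<Rightarrow> U | Some e \<Rightarrow> insert e U) ` (?X \<times> ?O))"
    by (intro card_mono finite_imageI)
  also have "\<dots> \<le> card (?X \<times> ?O)" by (rule card_image_le[OF fin])
  also have "\<dots> = card ?X * Suc (card A)"
    using assms by (simp add: card_cartesian_product card_image)
  also have "\<dots> \<le> Suc (card A) ^ k * Suc (card A)" using Suc.IH by (intro mult_right_mono) auto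
  finally show ?case by (simp add: mult.commute)
qed

definition star_pairs :: "('v \<times> 'c) set \<Rightarrow> 'v set \<Rightarrow> ('c \<times> 'v set) set" where
  "star_pairs U T = (\<lambda>(a, y). (snd a, {fst a, y})) ` (U \<times> T)"

lemma star_pairs_subset:
  assumes "U \<subseteq> V \<times> C" "T \<subseteq> V" "fst ` U \<inter> T = {}"
  shows "star_pairs U T \<subseteq> C \<times> complete_edges V"
proof
  fix x assume "x \<in> star_pairs U T"
  then obtain u c y where "(u, c) \<in> U" "y \<in> T" "x = (c, {u, y})" by (auto simp: star_pairs_def)
  moreover from this have "u \<noteq> y" using assms(3) by force
  ultimately show "x \<in> C \<times> complete_edges V" using assms by (auto simp: complete_edges_def)
qed

text \<open>Disjointness prevents an edge from being counted from both of its ends.\<close>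

lemma card_star_pairs:
  assumes "fst ` U \<inter> T = {}"
  shows "card (star_pairs U T) = card U * card T"
proof -
  have "inj_on (\<lambda>(a, y). (snd a, {fst a, y})) (U \<times> T)"
  proof (rule inj_onI, clarsimp)
    fix u c y u' y' assume *: "(u, c) \<in> U" "y \<in> T" "(u', c) \<in> U" "y' \<in> T" "{u, y} = {u', y'}"
    then have "u \<notin> T" "u' \<notin> T" using assms by force+
    then show "u = u' \<and> y = y'" using * by (auto simp: doubleton_eq_iff)
  qed
  then show ?thesis by (simp add: star_pairs_def card_image card_cartesian_product)
qed

lemma star_pairs_disjoint_iff:
  "S \<inter> star_pairs U T = {} \<longleftrightarrow> (\<forall>a\<in>U. \<forall>y\<in>T. y \<notin> coloured_nbrs S a)"
  by (auto simp: star_pairs_def coloured_nbrs_def)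

lemma finite_complete_edges: "finite V \<Longrightarrow> finite (complete_edges V)"
  by (auto simp: complete_edges_def intro: finite_subset[of _ "Pow V"])

lemma card_complete_edges:
  assumes "finite V"
  shows "card (complete_edges V) \<le> card V ^ 2"
  using card_subsets_le[OF assms, of 2] by (simp add: complete_edges_def)

locale coloured_setup =
  fixes V :: "'v set" and C :: "'c set" and n :: nat
  assumes fin: "finite V" "finite C" and cards: "card V = n" "card C = n"
begin

abbreviation "pairs \<equiv> C \<times> complete_edges V"

lemma fin_pairs: "finite pairs" using fin finite_complete_edges by blast

lemma card_agent_sets: "card {U. U \<subseteq> V \<times> C \<and> card U = k} \<le> (n * n) ^ k"
  using card_subsets_le[of "V \<times> C" k] fin cards by (simp add: card_cartesian_product)

lemma finite_agent_sets: "finite {U. U \<subseteq> V \<times> C \<and> P U}"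
  using fin by (auto intro: finite_subset[of _ "Pow (V \<times> C)"])

lemma prob_not_coloured_joined:
  fixes q :: real
  assumes q: "q \<in> {0..1}"
  shows "measure_pmf.prob (random_subset pairs q) {S. \<not> coloured_joined S V C s h} \<le>
    (n * n) ^ s * 2 ^ n * (1 - q) ^ (s * h)"
proof -
  let ?I = "{(U, T). U \<subseteq> V \<times> C \<and> card U = s \<and> T \<subseteq> V \<and> card T = h \<and> fst ` U \<inter> T = {}}"
  have sub: "?I \<subseteq> {U. U \<subseteq> V \<times> C \<and> card U = s} \<times> Pow V" by auto
  have fI: "finite ({U. U \<subseteq> V \<times> C \<and> card U = s} \<times> Pow V)" using finite_agent_sets fin by auto
  have "card ?I \<le> card ({U. U \<subseteq> V \<times> C \<and> card U = s} \<times> Pow V)" by (rule card_mono[OF fI sub])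
  also have "\<dots> \<le> (n * n) ^ s * 2 ^ n"
    unfolding card_cartesian_product using card_agent_sets[of s] fin cards
    by (intro mult_mono) (auto simp: card_Pow)
  finally have K: "real (card ?I) \<le> real ((n * n) ^ s * 2 ^ n)" by (rule of_nat_mono)
  have "measure_pmf.prob (random_subset pairs q) {S. \<not> coloured_joined S V C s h} \<le>
    real ((n * n) ^ s * 2 ^ n) * (1 - q) ^ (s * h)"
  proof (rule prob_union_no_edge[where I = ?I and F = "\<lambda>(U, T). star_pairs U T",
        OF fin_pairs finite_subset[OF sub fI] q K])
    fix i assume "i \<in> ?I"
    then show "(case i of (U, T) \<Rightarrow> star_pairs U T) \<subseteq> pairs \<and>
        s * h \<le> card (case i of (U, T) \<Rightarrow> star_pairs U T)"
      using star_pairs_subset[of "fst i" V C "snd i"] card_star_pairs[of "fst i" "snd i"] by auto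
  next
    fix S assume "\<not> coloured_joined S V C s h"
    then obtain U T where UT: "U \<subseteq> V \<times> C" "T \<subseteq> V" "fst ` U \<inter> T = {}" "card U = s" "card T = h"
      "\<not> (\<exists>a\<in>U. \<exists>y\<in>T. y \<in> coloured_nbrs S a)" unfolding coloured_joined_def by blast
    then have "S \<inter> star_pairs U T = {}" by (simp add: star_pairs_disjoint_iff)
    then show "\<exists>i\<in>?I. S \<inter> (case i of (U, T) \<Rightarrow> star_pairs U T) = {}"
      using UT(1-5) by (intro bexI[of _ "(U, T)"]) simp_all
  qed
  then show ?thesis by simp
qed

text \<open>Failure for \<open>u\<close> agents confines their neighbours in \<open>Z\<close> to a
  set \<open>W\<close> of \<open>7 * u\<close> vertices. There are at most n^(2u) n^(7u) choices,
  and at least \<open>r * u\<close> pairs are missed, since \<open>W\<close> and the vertices of the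
  agents cover at most \<open>8 * u \<le> 16 * s\<close> vertices of \<open>Z\<close>.\<close>

lemma prob_not_expanding:
  fixes q :: real
  assumes q: "q \<in> {0..1}" and Z: "Z \<subseteq> V" "r + 16 * s \<le> card Z"
  shows "measure_pmf.prob (random_subset pairs q) {S. \<not> coloured_expansion S V C Z s} \<le>
    (\<Sum>u=1..2 * s. (real n ^ 9 * (1 - q) ^ r) ^ u)"
proof -
  have fZ: "finite Z" using Z fin finite_subset by blast
  define bad where "bad u S \<longleftrightarrow> (\<exists>U\<subseteq>V \<times> C. card U = u \<and>
    card ((\<Union>a\<in>U. coloured_nbrs S a) \<inter> Z) < 7 * u)" for u S
  have "measure_pmf.prob (random_subset pairs q) {S. bad u S} \<le> real (n ^ (9 * u)) * (1 - q) ^ (r * u)"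
    if u: "1 \<le> u" "u \<le> 2 * s" for u
  proof -
    let ?A = "{U. U \<subseteq> V \<times> C \<and> card U = u} \<times> {W. W \<subseteq> V \<and> card W = 7 * u}"
    let ?I = "{i \<in> ?A. snd i \<subseteq> Z}"
    let ?T = "\<lambda>i. Z - snd i - fst ` fst i"
    have fA: "finite ?A" using finite_agent_sets fin by (intro finite_cartesian_product) auto
    have "card ?I \<le> card ?A" using fA by (intro card_mono) auto
    also have "\<dots> \<le> (n * n) ^ u * n ^ (7 * u)"
      unfolding card_cartesian_product
      using card_agent_sets[of u] card_subsets_le[OF fin(1), of "7 * u"] cards
      by (intro mult_mono) auto
    also have "\<dots> = n ^ (9 * u)" by (simp add: power_mult_distrib power_add[symmetric] power_mult[symmetric])
    finally have K: "real (card ?I) \<le> real (n ^ (9 * u))" by (rule of_nat_mono)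
    show ?thesis
    proof (rule prob_union_no_edge[where I = ?I and F = "\<lambda>i. star_pairs (fst i) (?T i)",
          OF fin_pairs _ q K])
      show "finite ?I" using fA by simp
      fix i assume i: "i \<in> ?I"
      obtain U W where iUW: "i = (U, W)" by (cases i)
      then have UW: "U \<subseteq> V \<times> C" "card U = u" "W \<subseteq> Z" "card W = 7 * u" using i by auto
      have fU: "finite U" using UW(1) fin finite_subset by (metis finite_cartesian_product)
      have fW: "finite W" using UW(3) fZ finite_subset by blast
      have "card Z - card W - card (fst ` U) \<le> card (Z - W - fst ` U)"
        using diff_card_le_card_Diff[OF fW, of Z] diff_card_le_card_Diff[of "fst ` U" "Z - W"] fU by simp
      moreover have "card (fst ` U) \<le> u" using card_image_le[OF fU, of fst] UW(2) by simp
      ultimately have "r \<le> card (Z - W - fst ` U)" using Z(2) u UW(4) by linarith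
      then have "r * u \<le> card U * card (Z - W - fst ` U)" using UW(2) by (simp add: mult.commute)
      moreover have d: "fst ` U \<inter> (Z - W - fst ` U) = {}" by blast
      ultimately have "r * u \<le> card (star_pairs U (Z - W - fst ` U))"
        using card_star_pairs[OF d] by simp
      moreover have "star_pairs U (Z - W - fst ` U) \<subseteq> pairs"
        using UW Z(1) d by (intro star_pairs_subset) auto
      ultimately show "star_pairs (fst i) (?T i) \<subseteq> pairs \<and> r * u \<le> card (star_pairs (fst i) (?T i))"
        using iUW by simp
    next
      fix S assume "bad u S"
      then obtain U where U: "U \<subseteq> V \<times> C" "card U = u"
        "card ((\<Union>a\<in>U. coloured_nbrs S a) \<inter> Z) < 7 * u" by (auto simp: bad_def)
      have "7 * u \<le> card Z" using u Z(2) by linarith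
      then obtain W where W: "(\<Union>a\<in>U. coloured_nbrs S a) \<inter> Z \<subseteq> W" "W \<subseteq> Z" "card W = 7 * u"
        using exists_subset_between[of "(\<Union>a\<in>U. coloured_nbrs S a) \<inter> Z" "7 * u" Z] U(3) fZ by auto
      then have "S \<inter> star_pairs U (Z - W - fst ` U) = {}"
        unfolding star_pairs_disjoint_iff by blast
      moreover have "(U, W) \<in> ?I" using U W Z(1) by auto
      ultimately show "\<exists>i\<in>?I. S \<inter> star_pairs (fst i) (?T i) = {}"
        by (intro bexI[of _ "(U, W)"]) simp_all
    qed
  qed
  then have b: "measure_pmf.prob (random_subset pairs q) {S. bad u S} \<le> (real n ^ 9 * (1 - q) ^ r) ^ u"
    if "u \<in> {1..2 * s}" for u
    using that by (simp add: power_mult power_mult_distrib)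
  have "measure_pmf.prob (random_subset pairs q) {S. \<not> coloured_expansion S V C Z s} \<le>
    measure_pmf.prob (random_subset pairs q) (\<Union>u\<in>{1..2 * s}. {S. bad u S})"
  proof (rule measure_pmf.finite_measure_mono)
    show "{S. \<not> coloured_expansion S V C Z s} \<subseteq> (\<Union>u\<in>{1..2 * s}. {S. bad u S})"
    proof
      fix S assume "S \<in> {S. \<not> coloured_expansion S V C Z s}"
      then obtain U where U: "U \<subseteq> V \<times> C" "card U \<le> 2 * s"
        "card ((\<Union>a\<in>U. coloured_nbrs S a) \<inter> Z) < 7 * card U"
        by (auto simp: coloured_expansion_def not_le)
      then have "card U \<in> {1..2 * s}" by (cases "card U") auto
      moreover have "bad (card U) S" using U unfolding bad_def by blast
      ultimately show "S \<in> (\<Union>u\<in>{1..2 * s}. {S. bad u S})" by blast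
    qed
  qed auto
  also have "\<dots> \<le> (\<Sum>u=1..2 * s. measure_pmf.prob (random_subset pairs q) {S. bad u S})"
    by (rule measure_pmf.finite_measure_subadditive_finite) auto
  also have "\<dots> \<le> (\<Sum>u=1..2 * s. (real n ^ 9 * (1 - q) ^ r) ^ u)"
    using b by (intro sum_mono) auto
  finally show ?thesis .
qed

text \<open>With \<open>S'\<close> fixed, joinedness at scale \<open>h\<close> gives every
  \<open>v\<close> at least \<open>h\<close> of the \<open>2 * h\<close> middle vertices with a
  second step into \<open>U\<close> in the colour chosen by \<open>v\<close>. Without two-step
  connections \<open>S\<close> then misses \<open>s * h\<close> pairs.\<close>

lemma prob_not_two_step_joined:
  fixes q :: real
  assumes q: "q \<in> {0..1}" and S': "coloured_joined S' V C s h" and s: "1 \<le> s"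
  shows "measure_pmf.prob (random_subset pairs q) {S. \<not> two_step_joined S S' V C s (2 * h)} \<le>
    (n * n) ^ (2 * s) * 4 ^ n * (1 - q) ^ (s * h)"
proof -
  let ?A = "{U. U \<subseteq> V \<times> C \<and> card U = s}"
  let ?J = "?A \<times> ?A \<times> Pow V \<times> Pow V"
  define F :: "('v \<times> 'c) set \<times> ('v \<times> 'c) set \<times> 'v set \<times> 'v set \<Rightarrow> ('c \<times> 'v set) set"
    where "F = (\<lambda>(A, A', U, T). {(c, {v, z}) | v c c' w z.
    (v, c) \<in> A \<and> (v, c') \<in> A' \<and> z \<in> T \<and> w \<in> U \<and> (c', {z, w}) \<in> S'})"
  let ?I = "{i \<in> ?J. F i \<subseteq> pairs \<and> s * h \<le> card (F i)}"
  have fA: "finite ?A" by (rule finite_agent_sets)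
  have fJ: "finite ?J" using fA fin by blast
  have "card ?I \<le> card ?J" using fJ by (intro card_mono) auto
  also have "\<dots> \<le> (n * n) ^ s * ((n * n) ^ s * (2 ^ n * 2 ^ n))"
    unfolding card_cartesian_product using card_agent_sets[of s] fin cards
    by (intro mult_mono) (auto simp: card_Pow)
  also have "\<dots> = (n * n) ^ (2 * s) * 4 ^ n"
    by (simp add: mult_2 power_add power_mult_distrib[symmetric])
  finally have K: "real (card ?I) \<le> real ((n * n) ^ (2 * s) * 4 ^ n)" by (rule of_nat_mono)
  have "measure_pmf.prob (random_subset pairs q) {S. \<not> two_step_joined S S' V C s (2 * h)} \<le>
    real ((n * n) ^ (2 * s) * 4 ^ n) * (1 - q) ^ (s * h)"
  proof (rule prob_union_no_edge[where I = ?I and F = F, OF fin_pairs _ q K])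
    show "finite ?I" using fJ by simp
    show "F i \<subseteq> pairs \<and> s * h \<le> card (F i)" if "i \<in> ?I" for i using that by blast
    fix S assume "\<not> two_step_joined S S' V C s (2 * h)"
    then obtain D U T g g' where D0: "D \<subseteq> V \<and> U \<subseteq> V \<and> T \<subseteq> V \<and>
        D \<inter> U = {} \<and> D \<inter> T = {} \<and> U \<inter> T = {} \<and> card D = s \<and> card U = s \<and> card T = 2 * h \<and>
        (\<forall>v. g v \<in> C \<and> g' v \<in> C) \<and>
        \<not> (\<exists>v\<in>D. \<exists>z\<in>T. \<exists>w\<in>U. (g v, {v, z}) \<in> S \<and> (g' v, {z, w}) \<in> S')"
      unfolding two_step_joined_def not_all not_imp by (elim exE) (rule that)
    have D: "D \<subseteq> V" "U \<subseteq> V" "T \<subseteq> V" "D \<inter> U = {}" "D \<inter> T = {}" "U \<inter> T = {}"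
      "card D = s" "card U = s" "card T = 2 * h" "\<And>v. g v \<in> C" "\<And>v. g' v \<in> C"
      and no: "\<not> (\<exists>v\<in>D. \<exists>z\<in>T. \<exists>w\<in>U. (g v, {v, z}) \<in> S \<and> (g' v, {z, w}) \<in> S')"
      using D0 by simp_all
    \<comment> \<open>The colour functions enter only through their graphs over \<open>D\<close>,
      which are sets of \<open>s\<close> agents; this makes them countable in the union
      bound.\<close>
    define A where "A = (\<lambda>v. (v, g v)) ` D"
    define A' where "A' = (\<lambda>v. (v, g' v)) ` D"
    define Tv where "Tv v = {z \<in> T. \<exists>w\<in>U. (g' v, {z, w}) \<in> S'}" for v
    have fD: "finite D" "finite T" using D fin finite_subset by auto
    have cA: "A \<in> ?A" "A' \<in> ?A"
      using D by (auto simp: A_def A'_def card_image inj_on_def)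
    have Feq: "F (A, A', U, T) = (\<lambda>(v, z). (g v, {v, z})) ` (SIGMA v:D. Tv v)"
      by (force simp: F_def A_def A'_def Tv_def)
    have "inj_on (\<lambda>(v, z). (g v, {v, z})) (SIGMA v:D. Tv v)"
    proof (rule inj_onI, clarsimp)
      fix v z v' z' assume *: "v \<in> D" "z \<in> Tv v" "v' \<in> D" "z' \<in> Tv v'" "{v, z} = {v', z'}"
      then have "z \<noteq> v'" "z' \<noteq> v" using D(5) by (auto simp: Tv_def)
      then show "v = v' \<and> z = z'" using *(5) by (auto simp: doubleton_eq_iff)
    qed
    then have "card (F (A, A', U, T)) = (\<Sum>v\<in>D. card (Tv v))"
      using fD by (simp add: Feq card_image Tv_def)
    moreover have "h \<le> card (Tv v)" if "v \<in> D" for v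
    proof (rule ccontr)
      assume "\<not> h \<le> card (Tv v)"
      then have "h \<le> card (T - Tv v)"
        using fD D(9) by (subst card_Diff_subset) (auto simp: Tv_def intro: finite_subset)
      moreover have "card (U \<times> {g' v}) = s" using D(8) by (simp add: card_cartesian_product)
      ultimately have "\<exists>a\<in>U \<times> {g' v}. \<exists>y\<in>T - Tv v. y \<in> coloured_nbrs S' a"
        using D by (intro coloured_joinedD[OF S']) auto
      then obtain w z where wz: "w \<in> U" "z \<in> T" "z \<notin> Tv v" "(g' v, {w, z}) \<in> S'"
        by (auto simp: coloured_nbrs_def)
      then have "(g' v, {z, w}) \<in> S'" by (simp add: insert_commute)
      then show False using wz by (auto simp: Tv_def)
    qed
    then have "(\<Sum>v\<in>D. h) \<le> (\<Sum>v\<in>D. card (Tv v))" by (rule sum_mono)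
    ultimately have big: "s * h \<le> card (F (A, A', U, T))" using D(7) by simp
    have "F (A, A', U, T) \<subseteq> pairs"
    proof
      fix x assume "x \<in> F (A, A', U, T)"
      then obtain v z where x: "x = (g v, {v, z})" "v \<in> D" "z \<in> T" by (auto simp: Feq Tv_def)
      moreover from this have "v \<noteq> z" using D(5) by blast
      ultimately show "x \<in> pairs" using D by (auto simp: complete_edges_def)
    qed
    moreover have "S \<inter> F (A, A', U, T) = {}"
      unfolding Feq using no by (auto simp: Tv_def)
    ultimately show "\<exists>i\<in>?I. S \<inter> F i = {}"
      using cA big D(2,3) by (intro bexI[of _ "(A, A', U, T)"]) auto
  qed
  then show ?thesis by simp
qed

lemma prob_not_graph_joined:
  fixes q :: real
  assumes q: "q \<in> {0..1}"
  shows "measure_pmf.prob (random_subset (complete_edges V) q) {G. \<not> graph_joined G V t} \<le>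
    4 ^ n * (1 - q) ^ (t * t)"
proof -
  let ?I = "{(P, Q). P \<subseteq> V \<and> Q \<subseteq> V \<and> P \<inter> Q = {} \<and> card P = t \<and> card Q = t}"
  let ?F = "\<lambda>(P, Q). (\<lambda>(x, y). {y, x}) ` (P \<times> Q)"
  have sub: "?I \<subseteq> Pow V \<times> Pow V" by auto
  have "card ?I \<le> card (Pow V \<times> Pow V)" using fin by (intro card_mono sub) auto
  also have "\<dots> = 4 ^ n" using fin cards
    by (simp add: card_cartesian_product card_Pow power_mult_distrib[symmetric])
  finally have K: "real (card ?I) \<le> real (4 ^ n)" by (rule of_nat_mono)
  have "measure_pmf.prob (random_subset (complete_edges V) q) {G. \<not> graph_joined G V t} \<le>
    real (4 ^ n) * (1 - q) ^ (t * t)"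
  proof (rule prob_union_no_edge[where I = ?I and F = ?F, OF finite_complete_edges[OF fin(1)] _ q K])
    show "finite ?I" using fin by (intro finite_subset[OF sub]) auto
    fix i assume "i \<in> ?I"
    then obtain P Q where i: "i = (P, Q)" "P \<subseteq> V" "Q \<subseteq> V" "P \<inter> Q = {}" "card P = t" "card Q = t" by auto
    have "inj_on (\<lambda>(x, y). {y, x}) (P \<times> Q)"
      using i(4) by (auto simp: inj_on_def doubleton_eq_iff)
    then have "card (?F i) = t * t" using i by (simp add: card_image card_cartesian_product)
    moreover have "?F i \<subseteq> complete_edges V"
    proof
      fix e assume "e \<in> ?F i"
      then obtain x y where "e = {y, x}" "x \<in> P" "y \<in> Q" using i(1) by auto
      moreover from this have "x \<noteq> y" using i(4) by blast
      ultimately show "e \<in> complete_edges V" using i by (auto simp: complete_edges_def)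
    qed
    ultimately show "?F i \<subseteq> complete_edges V \<and> t * t \<le> card (?F i)" by simp
  next
    fix G assume "\<not> graph_joined G V t"
    then obtain P Q where PQ: "P \<subseteq> V" "Q \<subseteq> V" "P \<inter> Q = {}" "card P = t" "card Q = t"
      "\<not> (\<exists>x\<in>P. \<exists>y\<in>Q. {y, x} \<in> G)" unfolding graph_joined_def by blast
    then show "\<exists>i\<in>?I. G \<inter> ?F i = {}" by (intro bexI[of _ "(P, Q)"]) auto
  qed
  then show ?thesis by simp
qed

text \<open>The boosters depend on the jokers already used. Letting \<open>A\<close> range over all
  edge sets of size at most \<open>n\<close> removes this dependence, as \<open>\<Phi> A\<close> is
  deterministic for fixed \<open>A\<close>; the factor (n^2 + 1)^n is affordable because
  \<open>M\<close> will be quadratic.\<close>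

lemma prob_missing_some:
  fixes q :: real
  assumes q: "q \<in> {0..1}" and \<Phi>: "\<And>A. \<Phi> A \<subseteq> complete_edges V"
  shows "measure_pmf.prob (random_subset (complete_edges V) q)
      {G. \<not> (\<forall>A\<subseteq>G. card A \<le> n \<longrightarrow> M \<le> card (\<Phi> A) \<longrightarrow> G \<inter> \<Phi> A \<noteq> {})} \<le>
    (n * n + 1) ^ n * (1 - q) ^ M"
proof -
  let ?E = "complete_edges V"
  let ?I = "{A. A \<subseteq> ?E \<and> card A \<le> n \<and> M \<le> card (\<Phi> A)}"
  have fE: "finite ?E" using fin by (intro finite_complete_edges)
  have fA: "finite {A. A \<subseteq> ?E \<and> card A \<le> n}" using fE by (auto intro: finite_subset[of _ "Pow ?E"])
  have "card ?I \<le> card {A. A \<subseteq> ?E \<and> card A \<le> n}" using fA by (intro card_mono) auto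
  also have "\<dots> \<le> Suc (card ?E) ^ n" by (rule card_small_subsets_le[OF fE])
  also have "\<dots> \<le> (n * n + 1) ^ n"
    using card_complete_edges[OF fin(1)] cards by (intro power_mono) (auto simp: power2_eq_square)
  finally have K: "real (card ?I) \<le> real ((n * n + 1) ^ n)" by (rule of_nat_mono)
  have "measure_pmf.prob (random_subset ?E q)
      {G. \<not> (\<forall>A\<subseteq>G. card A \<le> n \<longrightarrow> M \<le> card (\<Phi> A) \<longrightarrow> G \<inter> \<Phi> A \<noteq> {})} \<le>
    real ((n * n + 1) ^ n) * (1 - q) ^ M"
  proof (rule prob_union_no_edge[where I = ?I and F = \<Phi>, OF fE _ q K])
    show "finite ?I" using fA by (rule finite_subset[rotated]) auto
    show "\<Phi> A \<subseteq> ?E \<and> M \<le> card (\<Phi> A)" if "A \<in> ?I" for A using that \<Phi> by blast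
    fix G assume "G \<subseteq> ?E" "\<not> (\<forall>A\<subseteq>G. card A \<le> n \<longrightarrow> M \<le> card (\<Phi> A) \<longrightarrow> G \<inter> \<Phi> A \<noteq> {})"
    then show "\<exists>A\<in>?I. G \<inter> \<Phi> A = {}" by blast
  qed
  then show ?thesis by simp
qed

end

section \<open>Hamilton cycles for a fixed colouring\<close>

definition has_coloured_cycle :: "('c \<times> 'v set) set \<Rightarrow> 'v set \<Rightarrow> nat \<Rightarrow> (nat \<Rightarrow> 'c) \<Rightarrow> bool" where
  "has_coloured_cycle S V n f \<longleftrightarrow> (\<exists>vs. distinct vs \<and> set vs = V \<and>
     (\<forall>i<n. (f i, {vs ! i, vs ! (Suc i mod n)}) \<in> S))"

definition has_joker_cycle ::
    "('c \<times> 'v set) set \<Rightarrow> 'v set set \<Rightarrow> 'v set \<Rightarrow> nat \<Rightarrow> (nat \<Rightarrow> 'c) \<Rightarrow> bool" where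
  "has_joker_cycle S G V n f \<longleftrightarrow> (\<exists>vs. distinct vs \<and> set vs = V \<and>
     (\<forall>i<n. {vs ! i, vs ! (Suc i mod n)} \<in> G \<or> (f i, {vs ! i, vs ! (Suc i mod n)}) \<in> S))"

text \<open>This provides the injectivity that the coupling asks for: a Hamilton cycle uses an edge
  at one position only. For n = 2 both positions would carry the same edge.\<close>

lemma cyclic_edges_inj:
  assumes "distinct vs" "length vs = n" "3 \<le> n" "i < n" "j < n"
    and eq: "{vs ! i, vs ! (Suc i mod n)} = {vs ! j, vs ! (Suc j mod n)}"
  shows "i = j"
proof (rule ccontr)
  assume "i \<noteq> j"
  have lt: "Suc i mod n < n" "Suc j mod n < n" using assms by auto
  have "vs ! i \<noteq> vs ! j" using assms \<open>i \<noteq> j\<close> by (simp add: nth_eq_iff_index_eq)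
  then have "vs ! i = vs ! (Suc j mod n)" "vs ! (Suc i mod n) = vs ! j"
    using eq by (auto simp: doubleton_eq_iff)
  then have "i = Suc j mod n" "Suc i mod n = j" using assms lt by (simp_all add: nth_eq_iff_index_eq)
  then show False using assms(3-5) by (auto simp: mod_Suc split: if_splits)
qed

context coloured_setup begin

text \<open>Joinedness is used at the scale \<open>2 * h\<close>, but the edges of the second hops are joined already
  at scale \<open>h\<close>, so that they miss at most half of any set of \<open>2 * h\<close> vertices.\<close>

definition good_setup :: "'v set \<Rightarrow> 'v set \<Rightarrow> 'v set \<Rightarrow> nat \<Rightarrow> nat \<Rightarrow> nat \<Rightarrow> bool" where
  "good_setup X Z Y s h l \<longleftrightarrow>
     X \<subseteq> V \<and> Z \<subseteq> V \<and> Y \<subseteq> V \<and> X \<inter> Z = {} \<and> X \<inter> Y = {} \<and> Y \<inter> Z = {} \<and>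
     30 * (2 * h) \<le> card X \<and> 30 * (2 * h) \<le> card Z \<and> 30 * (2 * h) \<le> card Y \<and>
     1 \<le> s \<and> s \<le> 2 * h \<and> 1 \<le> h \<and> 1 \<le> l \<and> 2 * h \<le> 2 ^ l \<and> 2 ^ l \<le> 2 * (2 * h) \<and>
     (3 * s + 4) * (2 * l + 1) \<le> 2 * h"

text \<open>The first joker round determines the rigid path and the remainder \<open>W\<close>; the
  second is independent of both and supplies the boosters.\<close>

lemma prob_no_joker_cycle:
  fixes q :: real
  assumes q: "q \<in> {0..1}" and par: "good_setup X Z Y s h l"
    and S: "coloured_expansion S V C Z s" "coloured_joined S V C s (2 * h)" "two_step_joined S S' V C s (2 * h)"
    and f: "\<And>i. f i \<in> C"
  shows "measure_pmf.prob (random_subset (complete_edges V) (q + q - q * q))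
      {G. \<not> has_joker_cycle (S \<union> S') G V n f} \<le>
    4 ^ n * (1 - q) ^ (2 * h * (2 * h)) + (n * n + 1) ^ n * (1 - q) ^ (2 * h * h)"
proof -
  let ?E = "complete_edges V" and ?b = "(n * n + 1) ^ n * (1 - q) ^ (2 * h * h)"
  let ?X = "{G. \<not> has_joker_cycle (S \<union> S') G V n f}"
  have fE: "finite ?E" using fin by (intro finite_complete_edges)
  have "measure_pmf.prob (random_subset ?E (q + q - q * q)) ?X =
     measure_pmf.prob (random_subset ?E q \<bind> (\<lambda>G. map_pmf (\<lambda>G'. G \<union> G') (random_subset ?E q))) ?X"
    by (simp only: random_subset_union[OF fE q q])
  also have "\<dots> \<le> measure_pmf.prob (random_subset ?E q) {G. \<not> graph_joined G V (2 * h)} + ?b"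
  proof (rule prob_bind_le)
    show "0 \<le> ?b" using q by simp
    fix G assume "G \<notin> {G. \<not> graph_joined G V (2 * h)}"
    then have G: "graph_joined G V (2 * h)" by simp
    obtain us a b where us: "distinct us" "us \<noteq> []" "hd us = a" "last us = b" "a \<noteq> b"
      "coloured_path (S \<union> S') f us" "set us \<subseteq> V" "expands G (V - set us \<union> {a, b}) (2 * h)"
      by (rule rigid_structure[where X = X and Z = Z and Y = Y and t = "2 * h" and s = s and l = l and
          S = S and S' = S' and \<Gamma> = G and f = f and V = V and C = C])
        (use par fin S G f in \<open>auto simp: good_setup_def\<close>)
    define W where "W = V - set us \<union> {a, b}"
    have ab: "a \<in> set us" "b \<in> set us" using us(2-4) by auto
    have W: "W \<subseteq> V" "finite W" "a \<in> W" "b \<in> W" using ab us(7) fin finite_subset by (auto simp: W_def)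
    have cW: "card W \<le> n" using card_mono[OF fin(1) W(1)] cards by simp
    \<comment> \<open>With the first round fixed, the boosters are a function of \<open>A\<close>
      alone. Expansion up to \<open>2 * h\<close> gives at least half of (2h)^2 of them, which is
      the exponent \<open>2 * h * h\<close>.\<close>
    define \<Phi> where "\<Phi> A = boosters (G \<union> A) W a b" for A
    have \<Phi>: "\<Phi> A \<subseteq> ?E" for A
      using boosters_subset[of "G \<union> A" W a b] W(1) by (auto simp: \<Phi>_def complete_edges_def)
    have "measure_pmf.prob (map_pmf (\<lambda>G'. G \<union> G') (random_subset ?E q)) ?X \<le>
      measure_pmf.prob (random_subset ?E q)
        {G'. \<not> (\<forall>A\<subseteq>G'. card A \<le> n \<longrightarrow> 2 * h * h \<le> card (\<Phi> A) \<longrightarrow> G' \<inter> \<Phi> A \<noteq> {})}"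
    proof (unfold measure_map_pmf, rule prob_mono_support, rule ccontr)
      fix G' assume G': "G' \<in> (\<lambda>G'. G \<union> G') -` ?X"
        "G' \<notin> {G'. \<not> (\<forall>A\<subseteq>G'. card A \<le> n \<longrightarrow> 2 * h * h \<le> card (\<Phi> A) \<longrightarrow> G' \<inter> \<Phi> A \<noteq> {})}"
      have "spanning_path (G \<union> G') W b a"
      proof (rule spanning_path_of_boosters[OF W(2,3,4) us(5)])
        show "expands G W (2 * h)" using us(8) by (simp add: W_def)
        then show "\<exists>x\<in>P. \<exists>y\<in>W - P. {x, y} \<in> G" if "P \<subseteq> W" "P \<noteq> {}" "P \<noteq> W" for P
          using spanning_structure_connected[OF G fin(1) W(1) _ that] by blast
        fix A assume "A \<subseteq> G'" "card A \<le> card W" "2 * h * (2 * h) \<le> 2 * card (boosters (G \<union> A) W a b)"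
        then have "A \<subseteq> G'" "card A \<le> n" "2 * h * h \<le> card (\<Phi> A)"
          using cW by (auto simp: \<Phi>_def)
        then show "G' \<inter> boosters (G \<union> A) W a b \<noteq> {}" using G'(2) by (simp add: \<Phi>_def)
      qed
      then obtain vs where vs: "distinct vs" "set vs = V"
        "\<And>i. i < length vs \<Longrightarrow> {vs ! i, vs ! (Suc i mod length vs)} \<in> G \<union> G' \<or>
           (f i, {vs ! i, vs ! (Suc i mod length vs)}) \<in> S \<union> S'"
        using cycle_of_paths[OF us(1-7), of "G \<union> G'"] unfolding W_def by metis
      have "length vs = n" using vs(1,2) cards distinct_card by metis
      then have "has_joker_cycle (S \<union> S') (G \<union> G') V n f"
        using vs unfolding has_joker_cycle_def by blast
      then show False using G'(1) by simp
    qed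
    also have "\<dots> \<le> ?b" by (rule prob_missing_some[OF q \<Phi>])
    finally show "measure_pmf.prob (map_pmf (\<lambda>G'. G \<union> G') (random_subset ?E q)) ?X \<le> ?b" .
  qed
  also have "measure_pmf.prob (random_subset ?E q) {G. \<not> graph_joined G V (2 * h)} \<le>
      4 ^ n * (1 - q) ^ (2 * h * (2 * h))" by (rule prob_not_graph_joined[OF q])
  finally show ?thesis by simp
qed

text \<open>The coupling is applied to the coloured edges that a cycle would still need beyond the
  fixed set \<open>S\<close>; the jokers stand for exactly these.\<close>

lemma prob_no_coloured_cycle:
  fixes q :: real
  assumes q: "q \<in> {0..1}" and n: "3 \<le> n" and f: "\<And>i. f i \<in> C"
  shows "measure_pmf.prob (random_subset pairs q) {J. \<not> has_coloured_cycle (S \<union> J) V n f} \<le>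
    measure_pmf.prob (random_subset (complete_edges V) q) {G. \<not> has_joker_cycle S G V n f}"
proof -
  let ?E = "complete_edges V"
  define ed where "ed vs i = {vs ! i, vs ! (Suc i mod n)}" for vs :: "'v list" and i
  define F where "F vs = {(f i, ed vs i) | i. i < n \<and> (f i, ed vs i) \<notin> S}" for vs
  define \<F> where "\<F> = {F vs | vs. distinct vs \<and> set vs = V}"
  have "G \<in> {G. \<exists>F\<in>\<F>. snd ` F \<subseteq> G}" if "has_joker_cycle S G V n f" for G
  proof -
    obtain vs where vs: "distinct vs" "set vs = V"
      "\<And>i. i < n \<Longrightarrow> ed vs i \<in> G \<or> (f i, ed vs i) \<in> S"
      using \<open>has_joker_cycle S G V n f\<close> unfolding has_joker_cycle_def ed_def by blast
    have "snd ` F vs \<subseteq> G"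
    proof
      fix e assume "e \<in> snd ` F vs"
      then obtain i where "e = ed vs i" "i < n" "(f i, ed vs i) \<notin> S" unfolding F_def by force
      then show "e \<in> G" using vs(3)[of i] by blast
    qed
    then show ?thesis using vs(1,2) by (auto simp: \<F>_def)
  qed
  then have "measure_pmf.prob (random_subset ?E q) {G. has_joker_cycle S G V n f} \<le>
    measure_pmf.prob (random_subset ?E q) {G. \<exists>F\<in>\<F>. snd ` F \<subseteq> G}"
    by (intro measure_pmf.finite_measure_mono) auto
  also have "\<dots> \<le> measure_pmf.prob (random_subset pairs q) {J. \<exists>F\<in>\<F>. F \<subseteq> J}"
  proof (rule prob_coupled_le[OF fin(2) finite_complete_edges[OF fin(1)] q])
    fix A assume "A \<in> \<F>"
    then obtain vs where vs: "A = F vs" "distinct vs" "set vs = V" by (auto simp: \<F>_def)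
    have len: "length vs = n" using vs cards distinct_card by metis
    have e: "ed vs i \<in> ?E" if i: "i < n" for i
    proof -
      have lt: "Suc i mod n < n" using n by simp
      have "Suc i mod n \<noteq> i" using i n by (auto simp: mod_Suc)
      then have "vs ! i \<noteq> vs ! (Suc i mod n)" using vs(2) len i lt by (simp add: nth_eq_iff_index_eq)
      moreover have "vs ! i \<in> V" "vs ! (Suc i mod n) \<in> V" using vs(3) len i lt by (metis nth_mem)+
      ultimately show ?thesis by (simp add: ed_def complete_edges_def)
    qed
    have "inj_on snd A"
    proof (rule inj_onI)
      fix x y assume "x \<in> A" "y \<in> A" and eq: "snd x = snd y"
      then obtain i j where ij: "x = (f i, ed vs i)" "y = (f j, ed vs j)" "i < n" "j < n"
        by (auto simp: vs(1) F_def)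
      then have "ed vs i = ed vs j" using eq by simp
      then have "i = j" using cyclic_edges_inj[OF vs(2) len n ij(3,4)] unfolding ed_def by blast
      then show "x = y" using ij by simp
    qed
    then show "A \<subseteq> pairs \<and> inj_on snd A" using e f by (auto simp: vs(1) F_def)
  qed
  also have "\<dots> \<le> measure_pmf.prob (random_subset pairs q) {J. has_coloured_cycle (S \<union> J) V n f}"
  proof (rule measure_pmf.finite_measure_mono)
    show "{J. \<exists>F\<in>\<F>. F \<subseteq> J} \<subseteq> {J. has_coloured_cycle (S \<union> J) V n f}"
    proof
      fix J assume "J \<in> {J. \<exists>F\<in>\<F>. F \<subseteq> J}"
      then obtain vs where vs: "distinct vs" "set vs = V" "F vs \<subseteq> J" by (auto simp: \<F>_def)
      have "(f i, ed vs i) \<in> S \<union> J" if "i < n" for i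
        using vs(3) that by (auto simp: F_def)
      then show "J \<in> {J. has_coloured_cycle (S \<union> J) V n f}"
        using vs unfolding has_coloured_cycle_def ed_def by blast
    qed
  qed auto
  finally have le: "measure_pmf.prob (random_subset ?E q) {G. has_joker_cycle S G V n f} \<le>
    measure_pmf.prob (random_subset pairs q) {J. has_coloured_cycle (S \<union> J) V n f}" .
  have compl: "measure_pmf.prob M {x. \<not> P x} = 1 - measure_pmf.prob M {x. P x}" for M :: "'x pmf" and P
    using measure_pmf.prob_compl[of "{x. P x}" M] by (simp add: Compl_eq_Diff_UNIV[symmetric] Collect_neg_eq)
  show ?thesis using le by (simp add: compl)
qed

end

section \<open>From tuples of graphs to random sets of coloured edges\<close>

lemma random_subset_image:
  assumes "finite A" "inj_on g A"
  shows "random_subset (g ` A) q = map_pmf (image g) (random_subset A q)"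
  using assms
proof (induction A)
  case (insert a A)
  then have "g a \<notin> g ` A" "finite (g ` A)" by auto
  then show ?case using insert
    by (simp add: random_subset_insert map_bind_pmf map_pmf_comp if_distrib cong: if_cong)
qed simp

lemma Pi_pmf_random_subset:
  assumes "finite C" "finite E"
  shows "Pi_pmf C {} (\<lambda>_. random_subset E p) =
    map_pmf (\<lambda>S c. {e. (c, e) \<in> S}) (random_subset (C \<times> E) p)"
  using assms(1)
proof (induction C)
  case empty
  then show ?case by simp
next
  case (insert c C)
  have "insert c C \<times> E = (Pair c ` E) \<union> C \<times> E" by auto
  then have "random_subset (insert c C \<times> E) p = random_subset (Pair c ` E) p \<bind>
      (\<lambda>S. map_pmf (\<lambda>S'. S \<union> S') (random_subset (C \<times> E) p))"
    using insert assms(2) by (auto intro!: random_subset_Un_disjoint)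
  then have eq: "random_subset (insert c C \<times> E) p = random_subset E p \<bind>
      (\<lambda>S. map_pmf (\<lambda>S'. Pair c ` S \<union> S') (random_subset (C \<times> E) p))"
    using assms(2) by (simp add: random_subset_image inj_on_def bind_map_pmf)
  have upd: "(\<lambda>c'. {e. (c', e) \<in> S'})(c := S) = (\<lambda>c'. {e. (c', e) \<in> Pair c ` S \<union> S'})"
    if "S' \<in> set_pmf (random_subset (C \<times> E) p)" for S S'
  proof -
    have "S' \<subseteq> C \<times> E" using set_random_subset[OF _ that] insert.hyps assms(2) by blast
    then show ?thesis using insert.hyps by (auto simp: fun_eq_iff)
  qed
  show ?case
    unfolding Pi_pmf_insert[OF insert.hyps] insert.IH eq
    by (simp add: pair_pmf_def map_bind_pmf map_pmf_comp)
       (simp add: map_pmf_def bind_assoc_pmf bind_return_pmf upd cong: bind_pmf_cong)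
qed

lemma random_graph_tuple_random_subset:
  assumes "finite V"
  shows "random_graph_tuple V p = map_pmf (\<lambda>S c. {e. (c, e) \<in> S})
    (random_subset ({1..card V} \<times> complete_edges V) p)"
  using Pi_pmf_random_subset[of "{1..card V}" "complete_edges V" p] finite_complete_edges[OF assms]
  by (simp add: random_graph_tuple_def random_graph_def random_subset_def)

text \<open>Positions of lists start at 0, those of Hamilton cycles at 1, whence the shift;
  reduction modulo \<open>n\<close> keeps the colour in range at every position, as the path
  construction demands.\<close>

lemma hamilton_universal_of_cycles:
  assumes n: "card V = n" "3 \<le> n"
    and c: "\<And>chi. chi \<in> {1..n} \<rightarrow> {1..n} \<Longrightarrow> has_coloured_cycle S V n (\<lambda>i. chi (i mod n + 1))"
  shows "hamilton_universal V (\<lambda>c. {e. (c, e) \<in> S})"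
  unfolding hamilton_universal_def n(1)
proof
  fix chi assume "chi \<in> {1..n} \<rightarrow> {1..n}"
  from c[OF this] obtain vs where vs: "distinct vs" "set vs = V"
    "\<And>i. i < n \<Longrightarrow> (chi (i mod n + 1), {vs ! i, vs ! (Suc i mod n)}) \<in> S"
    unfolding has_coloured_cycle_def by blast
  have len: "length vs = n" using vs n distinct_card by metis
  define v where "v i = vs ! (i - 1)" for i
  have "bij_betw v {1..n} V"
  proof -
    have "bij_betw (\<lambda>i. i - 1) {1..n} {..<n}"
      by (rule bij_betwI[of _ _ _ Suc]) auto
    moreover have "bij_betw ((!) vs) {..<n} V" using bij_betw_nth[OF vs(1)] len vs(2) by auto
    ultimately show ?thesis
      using bij_betw_trans[of "\<lambda>i. i - 1" "{1..n}" "{..<n}" "(!) vs" V] by (simp add: v_def[abs_def] o_def)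
  qed
  then have "hamilton_cycle V (\<lambda>i. {v i, v (i mod n + 1)})"
    using n by (auto simp: hamilton_cycle_def)
  moreover have "{v i, v (i mod n + 1)} \<in> {e. (chi i, e) \<in> S}" if i: "i \<in> {1..n}" for i
  proof -
    obtain k where k: "i = Suc k" "k < n" using i by (cases i) auto
    then show ?thesis using vs(3)[of k] by (simp add: v_def)
  qed
  ultimately show "\<exists>e. hamilton_cycle V e \<and> (\<forall>i\<in>{1..n}. e i \<in> {e. (chi i, e) \<in> S})" by blast
qed

lemma prob_not_hamilton_universal:
  fixes p q :: real
  assumes V: "finite V" "card V = n" "3 \<le> n" and q: "0 \<le> q" "4 * q \<le> p" "p \<le> 1"
    and par: "coloured_setup.good_setup V X Z Y s h l" and r: "r + 16 * s \<le> card Z"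
  shows "measure_pmf.prob (random_graph_tuple V p) {G. \<not> hamilton_universal V G} \<le>
     2 * ((n * n) ^ s * 2 ^ n * (1 - q) ^ (s * h)) + (\<Sum>u=1..2 * s. (real n ^ 9 * (1 - q) ^ r) ^ u) +
     (n * n) ^ (2 * s) * 4 ^ n * (1 - q) ^ (s * h) +
     n ^ n * (4 ^ n * (1 - q) ^ (2 * h * (2 * h)) + (n * n + 1) ^ n * (1 - q) ^ (2 * h * h))"
  (is "_ \<le> 2 * ?P1 + ?P2 + ?P3 + ?P4")
proof -
  let ?C = "{1..n}"
  interpret coloured_setup V ?C n by unfold_locales (use V in auto)
  let ?R = "random_subset pairs"
  \<comment> \<open>\<open>q2\<close> combines the two joker rounds, \<open>q3\<close> adds the
    round of \<open>S\<close> and \<open>q4\<close> that of \<open>S'\<close>. Overlaps only help,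
    so \<open>q4 \<le> 4 * q \<le> p\<close>.\<close>
  define q2 where "q2 = q + q - q * q"
  define q3 where "q3 = q + q2 - q * q2"
  define q4 where "q4 = q + q3 - q * q3"
  have q01: "q \<in> {0..1}" using q by auto
  have or01: "0 \<le> a + b - a * b" "a + b - a * b \<le> a + b" "a + b - a * b \<le> 1"
    if "a \<in> {0..1}" "b \<in> {0..1}" for a b :: real
  proof -
    have "0 \<le> a * (1 - b)" "0 \<le> (1 - a) * (1 - b)" "0 \<le> a * b" using that by auto
    then show "0 \<le> a + b - a * b" "a + b - a * b \<le> a + b" "a + b - a * b \<le> 1"
      using that by (auto simp: algebra_simps)
  qed
  have q2: "q2 \<in> {0..1}" "q2 \<le> 2 * q" using or01[OF q01 q01] by (auto simp: q2_def)
  have q3: "q3 \<in> {0..1}" "q3 \<le> 3 * q" using or01[OF q01 q2(1)] q2(2) by (auto simp: q3_def)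
  have q4: "q4 \<in> {0..1}" "q4 \<le> 4 * q" using or01[OF q01 q3(1)] q3(2) by (auto simp: q4_def)
  define f where "f chi = (\<lambda>i. chi (i mod n + 1))" for chi :: "nat \<Rightarrow> nat"
  define bad where "bad S \<longleftrightarrow> (\<exists>chi\<in>?C \<rightarrow> ?C. \<not> has_coloured_cycle S V n (f chi))" for S
  have badmono: "bad S" if "bad S'" "S \<subseteq> S'" for S S'
    using that unfolding bad_def has_coloured_cycle_def by blast
  have "measure_pmf.prob (random_graph_tuple V p) {G. \<not> hamilton_universal V G} =
    measure_pmf.prob (?R p) {S. \<not> hamilton_universal V (\<lambda>c. {e. (c, e) \<in> S})}"
    using V by (simp add: random_graph_tuple_random_subset vimage_def)
  also have "\<dots> \<le> measure_pmf.prob (?R p) {S. bad S}"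
    using hamilton_universal_of_cycles[OF V(2,3)]
    by (intro measure_pmf.finite_measure_mono) (auto simp: bad_def f_def)
  also have "\<dots> \<le> measure_pmf.prob (?R q4) {S. bad S}"
  proof -
    have "measure_pmf.prob (?R q4) {S. \<not> bad S} \<le> measure_pmf.prob (?R p) {S. \<not> bad S}"
      using q4 q badmono by (intro prob_random_subset_mono fin_pairs) auto
    moreover have compl: "measure_pmf.prob M {x. bad x} = 1 - measure_pmf.prob M {x. \<not> bad x}" for M
      using measure_pmf.prob_compl[of "{x. \<not> bad x}" M]
      by (simp add: Compl_eq_Diff_UNIV[symmetric] Collect_neg_eq)
    ultimately show ?thesis by (simp add: compl)
  qed
  also have "?R q4 = ?R q \<bind> (\<lambda>S'. map_pmf (\<lambda>S. S' \<union> S) (?R q3))"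
    unfolding q4_def by (rule random_subset_union[OF fin_pairs q01 q3(1)])
  \<comment> \<open>\<open>S'\<close> is exposed first, because two-step joinedness of
    \<open>S\<close> is estimated for a fixed joined \<open>S'\<close>. Both sets have to be joined,
    which explains the factor 2 on the first summand.\<close>
  also have "measure_pmf.prob \<dots> {S. bad S} \<le>
      measure_pmf.prob (?R q) {S. \<not> coloured_joined S V ?C s h} + (?P1 + ?P2 + ?P3 + ?P4)"
  proof (rule prob_bind_le)
    show "0 \<le> ?P1 + ?P2 + ?P3 + ?P4" using q01 by (intro add_nonneg_nonneg sum_nonneg) auto
    fix S' assume "S' \<notin> {S. \<not> coloured_joined S V ?C s h}"
    then have S': "coloured_joined S' V ?C s h" by simp
    let ?B = "{S. \<not> coloured_joined S V ?C s h} \<union> {S. \<not> coloured_expansion S V ?C Z s} \<union>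
      {S. \<not> two_step_joined S S' V ?C s (2 * h)}"
    have s: "1 \<le> s" using par by (simp add: good_setup_def)
    have "map_pmf (\<lambda>S. S' \<union> S) (?R q3) = ?R q \<bind> (\<lambda>S. map_pmf (\<lambda>J. S' \<union> (S \<union> J)) (?R q2))"
      unfolding q3_def random_subset_union[OF fin_pairs q01 q2(1)]
      by (simp add: map_bind_pmf map_pmf_comp)
    then have "measure_pmf.prob (map_pmf (\<lambda>S. S' \<union> S) (?R q3)) {S. bad S} =
      measure_pmf.prob (?R q \<bind> (\<lambda>S. map_pmf (\<lambda>J. S' \<union> (S \<union> J)) (?R q2))) {S. bad S}" by simp
    also have "\<dots> \<le> measure_pmf.prob (?R q) ?B + ?P4"
    proof (rule prob_bind_le)
      show "0 \<le> ?P4" using q01 by simp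
      fix S assume "S \<notin> ?B"
      then have S: "coloured_joined S V ?C s h" "coloured_expansion S V ?C Z s"
        "two_step_joined S S' V ?C s (2 * h)" by auto
      have S2: "coloured_joined S V ?C s (2 * h)"
        unfolding coloured_joined_def using coloured_joinedD[OF S(1)] by (metis le_add1 mult_2 order_refl)
      have "measure_pmf.prob (map_pmf (\<lambda>J. S' \<union> (S \<union> J)) (?R q2)) {S. bad S} \<le>
        measure_pmf.prob (?R q2) (\<Union>chi\<in>?C \<rightarrow>\<^sub>E ?C. {J. \<not> has_coloured_cycle ((S \<union> S') \<union> J) V n (f chi)})"
      proof (unfold measure_map_pmf, rule measure_pmf.finite_measure_mono)
        show "(\<lambda>J. S' \<union> (S \<union> J)) -` {S. bad S} \<subseteq>
          (\<Union>chi\<in>?C \<rightarrow>\<^sub>E ?C. {J. \<not> has_coloured_cycle ((S \<union> S') \<union> J) V n (f chi)})"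
        proof
          fix J assume "J \<in> (\<lambda>J. S' \<union> (S \<union> J)) -` {S. bad S}"
          then obtain chi where chi: "chi \<in> ?C \<rightarrow> ?C" "\<not> has_coloured_cycle (S' \<union> (S \<union> J)) V n (f chi)"
            by (auto simp: bad_def)
          have "S' \<union> (S \<union> J) = (S \<union> S') \<union> J" by auto
          \<comment> \<open>Only the values on \<open>?C\<close> matter; restricting the maps leaves
            n^n of them for the union bound.\<close>
          moreover have "f (restrict chi ?C) i = f chi i" for i
          proof -
            have "i mod n + 1 \<in> ?C" using V(3) by (auto simp: Suc_le_eq)
            then show ?thesis by (simp add: f_def)
          qed
          moreover have "restrict chi ?C \<in> ?C \<rightarrow>\<^sub>E ?C" using chi(1) by (auto simp: Pi_iff)
          ultimately have "\<not> has_coloured_cycle ((S \<union> S') \<union> J) V n (f (restrict chi ?C))"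
            using chi(2) by (simp add: has_coloured_cycle_def)
          then show "J \<in> (\<Union>chi\<in>?C \<rightarrow>\<^sub>E ?C. {J. \<not> has_coloured_cycle ((S \<union> S') \<union> J) V n (f chi)})"
            using \<open>restrict chi ?C \<in> ?C \<rightarrow>\<^sub>E ?C\<close> by blast
        qed
      qed auto
      also have "\<dots> \<le> card (?C \<rightarrow>\<^sub>E ?C) *
        (4 ^ n * (1 - q) ^ (2 * h * (2 * h)) + (n * n + 1) ^ n * (1 - q) ^ (2 * h * h))"
      proof (rule prob_union_bound)
        show "finite (?C \<rightarrow>\<^sub>E ?C)" by (intro finite_PiE) auto
        fix chi assume chi: "chi \<in> ?C \<rightarrow>\<^sub>E ?C"
        have fC: "f chi i \<in> ?C" for i
        proof -
          have "i mod n + 1 \<in> ?C" using V(3) by (auto simp: Suc_le_eq)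
          then show ?thesis using chi unfolding f_def by blast
        qed
        have "measure_pmf.prob (?R q2) {J. \<not> has_coloured_cycle ((S \<union> S') \<union> J) V n (f chi)} \<le>
          measure_pmf.prob (random_subset (complete_edges V) q2) {G. \<not> has_joker_cycle (S \<union> S') G V n (f chi)}"
          by (rule prob_no_coloured_cycle[OF q2(1) V(3) fC])
        also have "\<dots> \<le> 4 ^ n * (1 - q) ^ (2 * h * (2 * h)) + (n * n + 1) ^ n * (1 - q) ^ (2 * h * h)"
          unfolding q2_def by (rule prob_no_joker_cycle[OF q01 par S(2) S2 S(3) fC])
        finally show "measure_pmf.prob (?R q2) {J. \<not> has_coloured_cycle ((S \<union> S') \<union> J) V n (f chi)} \<le>
          4 ^ n * (1 - q) ^ (2 * h * (2 * h)) + (n * n + 1) ^ n * (1 - q) ^ (2 * h * h)" .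
      qed
      also have "real (card (?C \<rightarrow>\<^sub>E ?C)) = n ^ n" by (simp add: card_PiE)
      finally show "measure_pmf.prob (map_pmf (\<lambda>J. S' \<union> (S \<union> J)) (?R q2)) {S. bad S} \<le> ?P4" by (simp add: add.commute)
    qed
    also have "measure_pmf.prob (?R q) ?B \<le> ?P1 + ?P2 + ?P3"
    proof -
      have "measure_pmf.prob (?R q) ?B \<le> measure_pmf.prob (?R q) {S. \<not> coloured_joined S V ?C s h} +
        measure_pmf.prob (?R q) {S. \<not> coloured_expansion S V ?C Z s} +
        measure_pmf.prob (?R q) {S. \<not> two_step_joined S S' V ?C s (2 * h)}"
        by (intro order.trans[OF measure_Un_le] add_right_mono measure_Un_le) simp_all
      also have "\<dots> \<le> ?P1 + ?P2 + ?P3"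
        using prob_not_coloured_joined[OF q01, of s h] prob_not_two_step_joined[OF q01 S' s]
          prob_not_expanding[OF q01 _ r] par
        by (intro add_mono) (auto simp: good_setup_def)
      finally show ?thesis .
    qed
    finally show "measure_pmf.prob (map_pmf (\<lambda>S. S' \<union> S) (?R q3)) {S. bad S} \<le> ?P1 + ?P2 + ?P3 + ?P4"
      by simp
  qed
  also have "measure_pmf.prob (?R q) {S. \<not> coloured_joined S V ?C s h} \<le> ?P1"
    using prob_not_coloured_joined[OF q01, of s h] by simp
  finally show ?thesis by (simp only: mult_2 add.assoc)
qed

section \<open>Asymptotics\<close>

lemma power_one_minus_le:
  fixes q x :: real
  assumes "0 \<le> q" "q \<le> 1" "x \<le> q * real m"
  shows "(1 - q) ^ m \<le> exp (- x)"
proof -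
  have "(1 - q) ^ m \<le> exp (- q) ^ m"
    using assms exp_ge_add_one_self[of "- q"] by (intro power_mono) auto
  also have "\<dots> = exp (- (q * real m))" by (simp add: exp_of_nat_mult[symmetric] mult.commute)
  also have "\<dots> \<le> exp (- x)" using assms by simp
  finally show ?thesis .
qed

text \<open>The summands come from coloured joinedness, coloured expansion, two-step joinedness, and the
  joker rounds (summed over all maps \<open>chi\<close>).\<close>

definition error_bound :: "real \<Rightarrow> real" where
  "error_bound x = 2 * exp (2 * x / 10 ^ 5 + 2 * ln x + x - 10 * x) + x * exp (- 3 * ln x) +
     exp (4 * x / 10 ^ 5 + 4 * ln x + 2 * x - 10 * x) +
     exp (x * ln x) * (exp (2 * x - 500 * x * ln x) + exp (3 * x * ln x - 500 * x * ln x))"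

lemma error_bound_tendsto: "((\<lambda>n. error_bound (real n)) \<longlongrightarrow> 0) at_top"
  unfolding error_bound_def by real_asymp

text \<open>Here \<open>s\<close> is replaced by its upper bound and \<open>l\<close> by 2 ln n,
  while the right-hand side is a lower bound for \<open>2 * h\<close>.\<close>

lemma eventually_small_path:
  "\<forall>\<^sub>F n in at_top. (3 * (real n / (10 ^ 5 * ln (real n)) + 1) + 4) * (4 * ln (real n) + 1) \<le> real n / 1000 - 2"
  by real_asymp

lemma eventually_small_sets:
  "\<forall>\<^sub>F n in at_top. 32 * (real n / (10 ^ 5 * ln (real n)) + 1) \<le> real n / 1000 - 2"
  by real_asymp

lemma prob_not_hamilton_universal_le:
  fixes p :: real and n :: nat
  assumes n: "10 ^ 5 \<le> n" and p: "16 * 10 ^ 9 * ln (real n) / real n \<le> p" "p \<le> 1"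
    and path: "(3 * (real n / (10 ^ 5 * ln (real n)) + 1) + 4) * (4 * ln (real n) + 1) \<le> real n / 1000 - 2"
    and sets: "32 * (real n / (10 ^ 5 * ln (real n)) + 1) \<le> real n / 1000 - 2"
  shows "measure_pmf.prob (random_graph_tuple {1..n} p) {G. \<not> hamilton_universal {1..n} G} \<le> error_bound (real n)"
proof -
  define x where "x = real n"
  define L where "L = ln x"
  \<comment> \<open>A quarter of the assumed lower bound for \<open>p\<close>, since there are four
    rounds. The constant makes q s h at least 10 n, which beats the exp(O(n)) choices in the
    joinedness bounds, and 2 q h^2 at least 500 n ln n, which beats the n^n maps and the at most
    n^(3n) sets of jokers.\<close>
  define q where "q = 4 * 10 ^ 9 * L / x"
  define h where "h = n div 2000"
  \<comment> \<open>Of order n / ln n, so that (n^2)^s is at most exp(2 n / 10^5 + 2 ln n).\<close>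
  define s where "s = nat \<lceil>x / (10 ^ 5 * L)\<rceil>"
  \<comment> \<open>The three parts are thirds of the vertex set; about half of the reservoir,
    \<open>r\<close> vertices, stays available for counting missed pairs.\<close>
  define m where "m = n div 3"
  define r where "r = n div 6"
  have x: "100000 \<le> x" using n by (simp add: x_def)
  have "exp 1 \<le> x" using x exp_le by linarith
  then have L: "1 \<le> L" using x unfolding L_def by (subst ln_ge_iff) auto
  have "0 \<le> q" using x L by (simp add: q_def)
  moreover have "4 * q \<le> p" using p(1) by (simp add: q_def x_def L_def)
  ultimately have q: "0 \<le> q" "4 * q \<le> p" "q \<le> 1" using p(2) by linarith+
  have h: "x / 4000 \<le> real h" "x / 1000 - 2 \<le> 2 * real h" "1 \<le> h"
    using n x by (auto simp: h_def x_def)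
  have s0: "0 < x / (10 ^ 5 * L)" using x L by simp
  have s: "x / (10 ^ 5 * L) \<le> real s" "real s \<le> x / (10 ^ 5 * L) + 1" "1 \<le> s"
    using s0 unfolding s_def by linarith+
  obtain l where l: "2 * h \<le> 2 ^ l" "2 ^ l \<le> 4 * h" "1 \<le> l"
  proof -
    \<comment> \<open>The least power of 2 that is at least \<open>2 * h\<close> is at most twice as
      large.\<close>
    define l where "l = (LEAST l. 2 * h \<le> 2 ^ l)"
    have ex: "2 * h \<le> 2 ^ (2 * h)" using less_exp[of "2 * h"] by simp
    then have 1: "2 * h \<le> 2 ^ l" unfolding l_def by (rule LeastI)
    then have "l \<noteq> 0" using h(3) by (intro notI) simp
    then obtain k where k: "l = Suc k" by (cases l) auto
    then have "\<not> 2 * h \<le> 2 ^ k" unfolding l_def using not_less_Least by (metis lessI)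
    then show thesis using that[of l] 1 k by simp
  qed
  have hx: "4 * real h \<le> x" unfolding h_def x_def by linarith
  have "(2::real) ^ l \<le> x" using l(2) hx by (metis of_nat_le_iff of_nat_mult of_nat_numeral of_nat_power order_trans)
  then have "real l * ln 2 \<le> L" using x by (simp add: L_def ln_realpow[symmetric])
  moreover have "real l * (1 / 2) \<le> real l * ln 2" using ln2_ge_two_thirds by (intro mult_left_mono) auto
  ultimately have lL: "real l \<le> 2 * L" by simp
  have "16 * real s \<le> real h"
    using sets s(2) h(2) unfolding x_def[symmetric] L_def[symmetric] by argo
  then have sL: "s * 16 \<le> h" "s \<le> 2 * h" by linarith+
  have path': "(3 * s + 4) * (2 * l + 1) \<le> 2 * h"
  proof -
    have "real ((3 * s + 4) * (2 * l + 1)) = (3 * real s + 4) * (2 * real l + 1)"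
      by (simp add: algebra_simps)
    also have "\<dots> \<le> (3 * (x / (10 ^ 5 * L) + 1) + 4) * (4 * L + 1)"
      using s(2) lL L by (intro mult_mono) auto
    also have "\<dots> \<le> x / 1000 - 2" using path unfolding x_def[symmetric] L_def[symmetric] .
    also have "\<dots> \<le> real (2 * h)" using h(2) by simp
    finally show ?thesis by (simp only: of_nat_le_iff)
  qed
  interpret coloured_setup "{1..n}" "{1..n}" n by unfold_locales auto
  have par: "good_setup {1..m} {m+1..2*m} {2*m+1..n} s h l"
    unfolding good_setup_def using path' l sL s(3) h(3) n by (auto simp: m_def h_def)
  have r: "r + 16 * s \<le> card {m+1..2*m}"
    using sL(1) n by (simp add: r_def m_def h_def)
  have main: "measure_pmf.prob (random_graph_tuple {1..n} p) {G. \<not> hamilton_universal {1..n} G} \<le>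
     2 * (real (n * n) ^ s * 2 ^ n * (1 - q) ^ (s * h)) + (\<Sum>u=1..2 * s. (real n ^ 9 * (1 - q) ^ r) ^ u) +
     real (n * n) ^ (2 * s) * 4 ^ n * (1 - q) ^ (s * h) +
     real n ^ n * (4 ^ n * (1 - q) ^ (2 * h * (2 * h)) + (real n * real n + 1) ^ n * (1 - q) ^ (2 * h * h))"
    using prob_not_hamilton_universal[OF _ _ _ q(1,2) p(2) par r] n by simp
  have nx: "real n = exp L" using x by (simp add: L_def x_def)
  have nn: "real (n * n) ^ s \<le> exp (2 * x / 10 ^ 5 + 2 * L)"
  proof -
    have "real (n * n) ^ s = exp (real s * (2 * L))"
      by (simp add: nx exp_add[symmetric] exp_of_nat_mult[symmetric])
    also have "\<dots> \<le> exp ((x / (10 ^ 5 * L) + 1) * (2 * L))"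
      using s(2) L by (intro iffD2[OF exp_le_cancel_iff] mult_right_mono) auto
    also have "(x / (10 ^ 5 * L) + 1) * (2 * L) = 2 * x / 10 ^ 5 + 2 * L"
      using L by (simp add: field_simps)
    finally show ?thesis .
  qed
  have two: "(2::real) ^ n \<le> exp x" "(4::real) ^ n \<le> exp (2 * x)"
  proof -
    have e: "(2::real) \<le> exp 1" using exp_ge_add_one_self[of 1] by simp
    have "(2::real) ^ n \<le> exp 1 ^ n" using e by (intro power_mono) auto
    then show t: "(2::real) ^ n \<le> exp x" by (simp add: exp_of_nat_mult[symmetric] x_def)
    have "(4::real) ^ n = 2 ^ n * 2 ^ n" by (simp add: power_mult_distrib[symmetric])
    also have "\<dots> \<le> exp x * exp x" using t by (intro mult_mono) auto
    finally show "(4::real) ^ n \<le> exp (2 * x)" by (simp add: exp_add[symmetric])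
  qed
  have sh: "(1 - q) ^ (s * h) \<le> exp (- (10 * x))"
  proof (rule power_one_minus_le[OF q(1,3)])
    have "10 * x = q * (x / (10 ^ 5 * L) * (x / 4000))" using x L by (simp add: q_def field_simps)
    also have "\<dots> \<le> q * (real s * real h)"
      using s(1) h(1) s0 q(1) x by (intro mult_left_mono mult_mono) auto
    finally show "10 * x \<le> q * real (s * h)" by simp
  qed
  have P1: "real (n * n) ^ s * 2 ^ n * (1 - q) ^ (s * h) \<le> exp (2 * x / 10 ^ 5 + 2 * L + x - 10 * x)"
  proof -
    have "real (n * n) ^ s * 2 ^ n * (1 - q) ^ (s * h) \<le>
      exp (2 * x / 10 ^ 5 + 2 * L) * exp x * exp (- (10 * x))"
      using nn two(1) sh q by (intro mult_mono) auto
    then show ?thesis by (simp add: exp_add[symmetric])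
  qed
  have P3: "real (n * n) ^ (2 * s) * 4 ^ n * (1 - q) ^ (s * h) \<le> exp (4 * x / 10 ^ 5 + 4 * L + 2 * x - 10 * x)"
  proof -
    have "real (n * n) ^ (2 * s) = real (n * n) ^ s * real (n * n) ^ s" by (simp add: mult_2 power_add)
    also have "\<dots> \<le> exp (2 * x / 10 ^ 5 + 2 * L) * exp (2 * x / 10 ^ 5 + 2 * L)"
      using nn by (intro mult_mono) auto
    finally have "real (n * n) ^ (2 * s) \<le> exp (4 * x / 10 ^ 5 + 4 * L)" by (simp add: exp_add[symmetric])
    then have "real (n * n) ^ (2 * s) * 4 ^ n * (1 - q) ^ (s * h) \<le>
      exp (4 * x / 10 ^ 5 + 4 * L) * exp (2 * x) * exp (- (10 * x))"
      using two(2) sh q by (intro mult_mono) auto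
    then show ?thesis by (simp add: exp_add[symmetric])
  qed
  have P2: "(\<Sum>u=1..2 * s. (real n ^ 9 * (1 - q) ^ r) ^ u) \<le> x * exp (- 3 * L)"
  proof -
    let ?y = "real n ^ 9 * (1 - q) ^ r"
    have "n \<le> 12 * r" using n unfolding r_def by simp
    then have rr: "x / 12 \<le> real r" unfolding x_def by linarith
    have "(1 - q) ^ r \<le> exp (- (12 * L))"
    proof (rule power_one_minus_le[OF q(1,3)])
      have "12 * L \<le> q * (x / 12)" using x L by (simp add: q_def field_simps)
      also have "\<dots> \<le> q * real r" using rr q(1) by (intro mult_left_mono) auto
      finally show "12 * L \<le> q * real r" .
    qed
    then have "?y \<le> exp (9 * L) * exp (- (12 * L))"
      unfolding nx by (intro mult_mono) (use q in \<open>auto simp: exp_of_nat_mult[symmetric]\<close>)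
    then have y: "?y \<le> exp (- 3 * L)" by (simp add: exp_add[symmetric])
    also have "\<dots> \<le> 1" using L by simp
    finally have y1: "?y \<le> 1" .
    have y0: "0 \<le> ?y" using q by simp
    \<comment> \<open>Each summand is at most n^(-3) and there are at most n of them. The resulting
      n^(-2) is the only part of the error that is not exponentially small.\<close>
    have "(\<Sum>u=1..2 * s. ?y ^ u) \<le> (\<Sum>u=1..2 * s. ?y)"
      using y0 y1 by (intro sum_mono) (metis atLeastAtMost_iff power_decreasing power_one_right)
    also have "\<dots> = real (2 * s) * ?y" by simp
    also have "\<dots> \<le> x * exp (- 3 * L)"
      using y y0 sL(1) hx x by (intro mult_mono) auto
    finally show ?thesis .
  qed
  have hh: "500 * x * L \<le> q * real (2 * h * h)"
  proof -
    have "500 * x * L = q * (2 * (x / 4000) * (x / 4000))" using x by (simp add: q_def field_simps)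
    also have "\<dots> \<le> q * (2 * real h * real h)"
      using h(1) q(1) x by (intro mult_left_mono mult_mono) auto
    finally show ?thesis by simp
  qed
  have b1: "(1 - q) ^ (2 * h * h) \<le> exp (- (500 * x * L))"
    by (rule power_one_minus_le[OF q(1,3) hh])
  have b2: "(1 - q) ^ (2 * h * (2 * h)) \<le> exp (- (500 * x * L))"
  proof -
    have "(1 - q) ^ (2 * h * (2 * h)) \<le> (1 - q) ^ (2 * h * h)" using q by (intro power_decreasing) auto
    then show ?thesis using b1 by linarith
  qed
  have nn': "real n ^ n = exp (x * L)" unfolding nx by (simp add: exp_of_nat_mult[symmetric] x_def)
  have cube: "(real n * real n + 1) ^ n \<le> exp (3 * x * L)"
  proof -
    have "x * x + 1 \<le> x ^ 3"
    proof -
      have "2 * (x * x) \<le> x * (x * x)" "1 \<le> x * x" using x by (auto intro: mult_right_mono order.trans[of 1 x])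
      then show ?thesis by (simp add: power3_eq_cube mult.assoc)
    qed
    then have "(real n * real n + 1) ^ n \<le> (x ^ 3) ^ n" by (intro power_mono) (auto simp: x_def)
    also have "x ^ 3 = exp (3 * L)" using nx by (simp add: x_def exp_of_nat_mult[symmetric])
    also have "exp (3 * L) ^ n = exp (3 * x * L)" by (simp add: exp_of_nat_mult[symmetric] x_def mult_ac)
    finally show ?thesis .
  qed
  have "4 ^ n * (1 - q) ^ (2 * h * (2 * h)) \<le> exp (2 * x) * exp (- (500 * x * L))"
    using two(2) b2 q by (intro mult_mono) auto
  moreover have "(real n * real n + 1) ^ n * (1 - q) ^ (2 * h * h) \<le> exp (3 * x * L) * exp (- (500 * x * L))"
    using cube b1 q by (intro mult_mono) auto
  ultimately have "real n ^ n * (4 ^ n * (1 - q) ^ (2 * h * (2 * h)) +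
        (real n * real n + 1) ^ n * (1 - q) ^ (2 * h * h))
     \<le> exp (x * L) * (exp (2 * x) * exp (- (500 * x * L)) + exp (3 * x * L) * exp (- (500 * x * L)))"
    unfolding nn' by (intro mult_left_mono[OF add_mono]) simp_all
  then have P4: "real n ^ n * (4 ^ n * (1 - q) ^ (2 * h * (2 * h)) +
        (real n * real n + 1) ^ n * (1 - q) ^ (2 * h * h))
     \<le> exp (x * L) * (exp (2 * x - 500 * x * L) + exp (3 * x * L - 500 * x * L))"
    by (simp only: exp_add[symmetric] diff_conv_add_uminus)
  show ?thesis
    using main P1 P2 P3 P4 unfolding error_bound_def x_def[symmetric] L_def[symmetric]
    by linarith
qed

theorem theorem1p1:
  "\<exists>C::real. C > 0 \<and>
     (\<forall>p :: nat \<Rightarrow> real.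
        (\<forall>\<^sub>F n in sequentially. C * ln (real n) / real n \<le> p n \<and> p n \<le> 1) \<longrightarrow>
        (\<lambda>n. measure_pmf.prob (random_graph_tuple {1..n} (p n))
               {G. hamilton_universal {1..n} G}) \<longlonglongrightarrow> 1)"
proof (intro exI[of _ "16 * 10 ^ 9"] conjI allI impI)
  fix p :: "nat \<Rightarrow> real"
  assume p: "\<forall>\<^sub>F n in sequentially. 16 * 10 ^ 9 * ln (real n) / real n \<le> p n \<and> p n \<le> 1"
  let ?P = "\<lambda>n. measure_pmf.prob (random_graph_tuple {1..n} (p n))"
  have compl: "?P n {G. hamilton_universal {1..n} G} = 1 - ?P n {G. \<not> hamilton_universal {1..n} G}" for n
    using measure_pmf.prob_compl[of "{G. \<not> hamilton_universal {1..n} G}" "random_graph_tuple {1..n} (p n)"]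
    by (simp add: Compl_eq_Diff_UNIV[symmetric] Collect_neg_eq)
  have "\<forall>\<^sub>F n in sequentially. 1 - error_bound (real n) \<le> ?P n {G. hamilton_universal {1..n} G}"
    using p eventually_ge_at_top[of "10 ^ 5"] eventually_small_path eventually_small_sets
  proof eventually_elim
    case (elim n)
    then have "?P n {G. \<not> hamilton_universal {1..n} G} \<le> error_bound (real n)"
      by (intro prob_not_hamilton_universal_le) auto
    then show ?case using compl[of n] by linarith
  qed
  moreover have "\<forall>\<^sub>F n in sequentially. ?P n {G. hamilton_universal {1..n} G} \<le> 1" by simp
  moreover have "(\<lambda>n. 1 - error_bound (real n)) \<longlonglongrightarrow> 1"
    using tendsto_diff[OF tendsto_const[of 1] error_bound_tendsto] by simp
  ultimately show "(\<lambda>n. ?P n {G. hamilton_universal {1..n} G}) \<longlonglongrightarrow> 1"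
    by (rule tendsto_sandwich[OF _ _ _ tendsto_const])
qed simp

end
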